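(* Let $p_1,p_2$ be distinct odd primes, $N=p_1p_2$, and let $D<0$ be the discriminant of the order $\mathcal{O}_f$ of conductor $f$ in an imaginary quadratic field, with $\bigl(\frac{D}{p_1}\bigr)\neq-1$, $\bigl(\frac{D}{p_2}\bigr)\neq-1$ and $p_1,p_2\nmid f$. Let $N(H_D)$ be the number of distinct polynomials among the class polynomials $H_{B,N}(X)$, where $B$ ranges over integers with $B^2\equiv D\pmod{4N}$. Then $N(H_D)\in\{1,2\}$ if $\bigl(\frac{D}{p_1}\bigr)=\bigl(\frac{D}{p_2}\bigr)=1$, and $N(H_D)=1$ if $\bigl(\frac{D}{p_1}\bigr)=1$ and $\bigl(\frac{D}{p_2}\bigr)=0$.
   Context: $\eta$ is the Dedekind eta function, $\mathfrak{w}_{p_1,p_2}(z)=\frac{\eta(z/p_1)\eta(z/p_2)}{\eta(z)\eta(z/(p_1p_2))}$, $s=24/\gcd(24,(p_1-1)(p_2-1))$. Forms $[A,B,C]=AX^2+BXY+CY^2$ are primitive, positive definite, of discriminant $D$; $\alpha_{[A,B,C]}=\frac{-B+\sqrt D}{2A}$. An $N$-system for $D$ is a set of $h(D)$ (the class number of $\mathcal{O}_f$) primitive forms $[A_i,B_i,C_i]$ of discriminant $D$ with $\gcd(A_i,N)=1$, $N\mid C_i$, $B_i\equiv B_j\pmod{2N}$ for all $i,j$, such that the ideals $\mathbb{Z}A_i+\mathbb{Z}\frac{-B_i+\sqrt D}{2}$ represent all proper ideal classes of $\mathcal{O}_f$. For $B$ with $B^2\equiv D\pmod{4N}$, $\mathfrak{N}_B$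 is an $N$-system containing $[1,B,(B^2-D)/4]$ (one exists), and $H_{B,N}(X)=\prod_{\mathfrak q\in\mathfrak{N}_B}(X-\mathfrak{w}_{p_1,p_2}^s(\alpha_{\mathfrak q}))$, which depends only on $B\bmod 2N$. *)

theory Defs
  imports
    "HOL-Analysis.Analysis"
    "HOL-Number_Theory.Number_Theory"
    "HOL-Algebra.Ideal"
    "HOL-Computational_Algebra.Polynomial"
begin

(* Meaningful for Im z > 0, where the product converges; the index n stands for the factor n + 1. *)
definition dedekind_eta :: "complex \<Rightarrow> complex" where
  "dedekind_eta z =
     exp (2 * of_real pi * \<i> * z / 24) *
     prodinf (\<lambda>n. 1 - exp (2 * of_real pi * \<i> * of_nat (Suc n) * z))"

definition double_eta_quotient :: "nat \<Rightarrow> nat \<Rightarrow> complex \<Rightarrow> complex" where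
  "double_eta_quotient p1 p2 z =
     (dedekind_eta (z / of_nat p1) * dedekind_eta (z / of_nat p2)) /
     (dedekind_eta z * dedekind_eta (z / of_nat (p1 * p2)))"

definition eta_exponent :: "nat \<Rightarrow> nat \<Rightarrow> nat" where
  "eta_exponent p1 p2 = 24 div gcd 24 ((p1 - 1) * (p2 - 1))"

(* Imaginary quadratic fields are normal over the rationals, so each has a unique image in the
   complex numbers, and we work with that subfield. For a negative integer d,
   csqrt d is the square root on the positive imaginary axis. *)
definition imaginary_quadratic_field :: "complex set \<Rightarrow> bool" where
  "imaginary_quadratic_field K \<longleftrightarrow>
     (\<exists>d::int. d < 0 \<and> K = {of_rat x + of_rat y * csqrt (of_int d) | x y. True})"

definition ring_of_integers :: "complex set \<Rightarrow> complex set" where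
  "ring_of_integers K = {z \<in> K. algebraic_int z}"

definition quad_order :: "complex set \<Rightarrow> nat \<Rightarrow> complex set" where
  "quad_order K f = {of_int a + of_nat f * w | a w. w \<in> ring_of_integers K}"

(* The discriminant as the squared determinant of the conjugates of an integral basis; the
   nontrivial automorphism of an imaginary quadratic field is complex conjugation. *)
definition is_discriminant :: "complex set \<Rightarrow> int \<Rightarrow> bool" where
  "is_discriminant R D \<longleftrightarrow>
     (\<exists>u v. R = {of_int a * u + of_int b * v | a b. True} \<and>
            of_int D = (u * cnj v - v * cnj u)\<^sup>2)"

definition quad_order_ring :: "complex set \<Rightarrow> nat \<Rightarrow> complex ring" where
  "quad_order_ring K f =
     \<lparr>carrier = quad_order K f, mult = (*), one = 1, zero = 0, add = (+)\<rparr>"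

(* Proper is meant in the sense of orders: the multiplier ring of I is exactly the order. The
   unit ideal is proper in this sense. *)
definition proper_ideals :: "complex set \<Rightarrow> nat \<Rightarrow> complex set set" where
  "proper_ideals K f =
     {I. ideal I (quad_order_ring K f) \<and> I \<noteq> {0} \<and>
         {x \<in> K. \<forall>y\<in>I. x * y \<in> I} = quad_order K f}"

definition same_ideal_class :: "complex set \<Rightarrow> complex set \<Rightarrow> complex set \<Rightarrow> bool" where
  "same_ideal_class K I J \<longleftrightarrow> (\<exists>x\<in>K. x \<noteq> 0 \<and> J = (\<lambda>y. x * y) ` I)"

definition class_number :: "complex set \<Rightarrow> nat \<Rightarrow> nat" where
  "class_number K f =
     card (proper_ideals K f //
       {(I, J). I \<in> proper_ideals K f \<and> J \<in> proper_ideals K f \<and> same_ideal_class K I J})"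

(* (A, B, C) stands for the binary quadratic form A X^2 + B X Y + C Y^2. *)
type_synonym bqf = "int \<times> int \<times> int"

definition positive_definite :: "bqf \<Rightarrow> bool" where
  "positive_definite = (\<lambda>(A, B, C).
     \<forall>x y. (x, y) \<noteq> (0, 0) \<longrightarrow> A * x\<^sup>2 + B * x * y + C * y\<^sup>2 > 0)"

definition forms :: "int \<Rightarrow> bqf set" where
  "forms D = {(A, B, C). gcd A (gcd B C) = 1 \<and> positive_definite (A, B, C) \<and>
                         B\<^sup>2 - 4 * A * C = D}"

definition form_root :: "int \<Rightarrow> bqf \<Rightarrow> complex" where
  "form_root D = (\<lambda>(A, B, C). (- of_int B + csqrt (of_int D)) / (2 * of_int A))"

definition form_ideal :: "int \<Rightarrow> bqf \<Rightarrow> complex set" where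
  "form_ideal D = (\<lambda>(A, B, C).
     {of_int m * of_int A + of_int n * ((- of_int B + csqrt (of_int D)) / 2) | m n. True})"

definition N_system :: "complex set \<Rightarrow> nat \<Rightarrow> int \<Rightarrow> nat \<Rightarrow> bqf set \<Rightarrow> bool" where
  "N_system K f D N S \<longleftrightarrow>
     S \<subseteq> forms D \<and> finite S \<and> card S = class_number K f \<and>
     (\<forall>(A, B, C)\<in>S. gcd A (int N) = 1 \<and> int N dvd C) \<and>
     (\<forall>(A, B, C)\<in>S. \<forall>(A', B', C')\<in>S. [B = B'] (mod 2 * int N)) \<and>
     (\<forall>I\<in>proper_ideals K f. \<exists>q\<in>S. same_ideal_class K (form_ideal D q) I)"

(* The possible values of H_{B,N}, one for each N-system containing [1, B, (B^2 - D)/4]. The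
   polynomial does not depend on that system, so under the usual hypotheses this is the
   singleton {H_{B,N}}; no choice of a system is built into the definition. *)
definition class_polys ::
    "complex set \<Rightarrow> nat \<Rightarrow> int \<Rightarrow> nat \<Rightarrow> nat \<Rightarrow> int \<Rightarrow> complex poly set" where
  "class_polys K f D p1 p2 B =
     {\<Prod>q\<in>S. [:- (double_eta_quotient p1 p2 (form_root D q) ^ eta_exponent p1 p2), 1:] | S.
        N_system K f D (p1 * p2) S \<and> (1, B, (B\<^sup>2 - D) div 4) \<in> S}"

definition num_class_polys :: "complex set \<Rightarrow> nat \<Rightarrow> int \<Rightarrow> nat \<Rightarrow> nat \<Rightarrow> nat" where
  "num_class_polys K f D p1 p2 =
     card (\<Union>B\<in>{B. [B\<^sup>2 = D] (mod 4 * int (p1 * p2))}. class_polys K f D p1 p2 B)"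

end

theory Submission
  imports Defs "HOL-Complex_Analysis.Complex_Analysis"
begin

text \<open>
  The normalised theta function of \<open>z\<close> is determined by its quasi-periodicity (Liouville), which gives
  its behaviour under \<open>z \<mapsto> -1/z\<close> and hence that of the Klein forms \<open>k(r, s)\<close> under the modular
  group. For odd \<open>p\<close> one has \<open>\<eta>(z/p) = \<plusminus>\<eta>(z)^p \<Prod>k(j/p, 0)(z)\<close> over \<open>1 \<le> j \<le> (p-1)/2\<close>, so the
  double eta quotient is a product of Klein forms and of \<open>\<eta>(z)^(-(p1-1)(p2-1))\<close>. The power \<open>s\<close> turns
  the latter into a power of \<open>\<eta>^24\<close>, and all multipliers for matrices with upper right entry divisible
  by \<open>N\<close> cancel, Gauss's lemma accounting for the signs. Hence \<open>H_B\<close> depends only on \<open>B\<close> modulo \<open>2N\<close>.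
  The double eta quotient is also invariant under \<open>z \<mapsto> -N/z\<close>, which sends \<open>[A, B, NC]\<close> to \<open>[C, -B, AN]\<close>,
  so \<open>H_B = H_(-B)\<close>. Up to sign there are at most two square roots of \<open>D\<close> modulo \<open>4N\<close> (considered
  modulo \<open>2N\<close>), and only one if \<open>p2\<close> divides \<open>D\<close>.
\<close>

section \<open>q-products\<close>

text \<open>The obstacle is the multiplier system of eta, a 24th root of unity given by Dedekind
  sums; it is never computed. Klein forms transform under SL(2,Z) without a multiplier, because
  \<open>theta\<close> is normalised by its derivative at 0. Roots of unity appear only when indices
  are reduced modulo 1, where they are explicit exponentials. Apart from Klein forms, only eta^24
  has to be transformed, and this too comes from Klein forms: eta^6 times their product over the
  three half periods is constant.

  On the arithmetic side, a matrix joining two forms of level N with middle coefficients congruent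
  modulo 2N automatically has upper right entry divisible by N. The Fricke image of such a form is
  primitive because p1^2 and p2^2 do not divide D, which is what p1, p2 not dividing f provides.
  Since \<open>class_polys\<close> is a set of possible values, the count would be 0 if there were
  no N-system. Excluding this takes representatives of level N and, as \<open>card\<close> of an
  infinite set is 0, reduction theory for the finiteness of the class group.\<close>

definition e2pi :: "complex \<Rightarrow> complex" where
  "e2pi x = exp (2 * of_real pi * \<i> * x)"

lemma e2pi_add: "e2pi (x + y) = e2pi x * e2pi y"
  by (simp add: e2pi_def ring_distribs exp_add)

lemma e2pi_nonzero [simp]: "e2pi x \<noteq> 0"
  by (simp add: e2pi_def)

lemma e2pi_0 [simp]: "e2pi 0 = 1"
  by (simp add: e2pi_def)

lemma e2pi_minus: "e2pi (- x) = inverse (e2pi x)"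
  by (simp add: e2pi_def exp_minus)

lemma e2pi_diff: "e2pi (x - y) = e2pi x / e2pi y"
  by (simp add: e2pi_def ring_distribs exp_diff)

lemma e2pi_power: "e2pi x ^ n = e2pi (of_nat n * x)"
  by (simp add: e2pi_def flip: exp_of_nat_mult) (simp add: mult_ac)

lemma e2pi_eq_1_iff: "e2pi x = 1 \<longleftrightarrow> (\<exists>n::int. x = of_int n)"
proof
  assume "e2pi x = 1"
  then obtain n :: int where "2 * pi * Re x = of_int (2 * n) * pi" "2 * pi * Im x = 0"
    unfolding e2pi_def exp_eq_1 by (auto simp: field_simps)
  then have "x = of_int n"
    by (auto simp: complex_eq_iff)
  then show "\<exists>n::int. x = of_int n" ..
qed (auto simp: e2pi_def exp_eq_1)

lemma e2pi_of_int [simp]: "e2pi (of_int n) = 1"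
  using e2pi_eq_1_iff by blast

lemma e2pi_of_nat [simp]: "e2pi (of_nat n) = 1"
  using e2pi_of_int[of "int n"] by simp

lemma e2pi_1 [simp]: "e2pi 1 = 1"
  using e2pi_of_nat[of 1] by simp

lemma e2pi_half [simp]: "e2pi (1 / 2) = -1"
  by (simp add: e2pi_def)

lemma e2pi_half_int: "e2pi (of_int n / 2) = (-1) ^ nat \<bar>n\<bar>"
proof -
  have *: "e2pi (of_nat m / 2) = (-1) ^ m" for m
    using e2pi_power[of "1/2" m] by simp
  show ?thesis
  proof (cases "n \<ge> 0")
    case True
    then show ?thesis using *[of "nat n"] by simp
  next
    case False
    then have "e2pi (- (of_int n / 2)) = (-1) ^ nat (-n)"
      using *[of "nat (-n)"] by (simp add: of_nat_nat)
    then have "inverse (e2pi (of_int n / 2)) = (-1) ^ nat (-n)"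
      by (simp add: e2pi_minus)
    then have "e2pi (of_int n / 2) = inverse ((-1) ^ nat (-n))"
      by (metis inverse_inverse_eq)
    then show ?thesis using False by (simp add: abs_if flip: power_inverse)
  qed
qed

lemma norm_e2pi: "norm (e2pi z) = exp (- 2 * pi * Im z)"
  by (simp add: e2pi_def)

lemma norm_e2pi_less_1: "Im z > 0 \<Longrightarrow> norm (e2pi z) < 1"
  by (simp add: norm_e2pi)

lemma holomorphic_on_e2pi [holomorphic_intros]:
  "f holomorphic_on S \<Longrightarrow> (\<lambda>w. e2pi (f w)) holomorphic_on S"
  unfolding e2pi_def by (intro holomorphic_intros)

text \<open>The exponents start at 1, so this is the infinite q-Pochhammer symbol (qx; q). With x =
  1 it is the product in eta.\<close>

definition qpoch :: "complex \<Rightarrow> complex \<Rightarrow> complex" where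
  "qpoch x q = prodinf (\<lambda>n. 1 - q ^ Suc n * x)"

lemma qpoch_convergent:
  fixes q x :: complex
  assumes "norm q < 1"
  shows "convergent_prod (\<lambda>n. 1 - q ^ Suc n * x)"
proof (rule abs_convergent_prod_imp_convergent_prod)
  have "summable (\<lambda>n. norm q ^ n * (norm q * norm x))"
    using assms by (intro summable_mult2 summable_geometric) auto
  then show "abs_convergent_prod (\<lambda>n. 1 - q ^ Suc n * x)"
    unfolding abs_convergent_prod_conv_summable
    by (simp add: norm_mult norm_power mult_ac)
qed

lemma qpoch_tendsto:
  assumes "norm q < 1"
  shows "(\<lambda>M. \<Prod>n<M. 1 - q ^ Suc n * x) \<longlonglongrightarrow> qpoch x q"
  unfolding qpoch_def by (rule has_prod_imp_tendsto'[OF convergent_prod_has_prod[OF qpoch_convergent[OF assms]]])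

lemma qpoch_nonzero:
  assumes "norm q < 1" "\<And>n. q ^ Suc n * x \<noteq> 1"
  shows "qpoch x q \<noteq> 0"
  unfolding qpoch_def using prodinf_nonzero[OF qpoch_convergent[OF assms(1)]] assms(2)
  by (metis eq_iff_diff_eq_0)

lemma qpoch_nonzero':
  assumes "norm q < 1" "norm x \<le> 1"
  shows "qpoch x q \<noteq> 0"
proof (rule qpoch_nonzero[OF assms(1)])
  fix n
  have "norm (q ^ Suc n * x) \<le> norm q ^ Suc n * 1"
    unfolding norm_mult norm_power by (intro mult_left_mono assms) auto
  also have "\<dots> < 1" using assms by (simp add: power_less_one_iff del: power_Suc)
  finally show "q ^ Suc n * x \<noteq> 1" by auto
qed

text \<open>Both the quasi-periodicity of theta and the pairing of residues in eta(z/p) come down to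
  splitting off this one factor.\<close>

lemma qpoch_Suc:
  assumes "norm q < 1"
  shows "qpoch x q = (1 - q * x) * qpoch (q * x) q"
proof -
  have "(\<Prod>n<Suc M. 1 - q ^ Suc n * x) = (1 - q * x) * (\<Prod>n<M. 1 - q ^ Suc n * (q * x))" for M
    by (subst prod.lessThan_Suc_shift) (simp add: mult_ac)
  moreover have "(\<lambda>M. (1 - q * x) * (\<Prod>n<M. 1 - q ^ Suc n * (q * x))) \<longlonglongrightarrow> (1 - q * x) * qpoch (q * x) q"
    by (intro tendsto_intros qpoch_tendsto assms)
  ultimately have "(\<lambda>M. \<Prod>n<Suc M. 1 - q ^ Suc n * x) \<longlonglongrightarrow> (1 - q * x) * qpoch (q * x) q"
    by simp
  moreover have "(\<lambda>M. \<Prod>n<Suc M. 1 - q ^ Suc n * x) \<longlonglongrightarrow> qpoch x q"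
    using LIMSEQ_Suc[OF qpoch_tendsto[OF assms]] .
  ultimately show ?thesis using LIMSEQ_unique by blast
qed

lemma qpoch_holomorphic:
  assumes S: "open S" and x: "x holomorphic_on S" and q: "q holomorphic_on S"
    and less: "\<And>w. w \<in> S \<Longrightarrow> norm (q w) < 1"
  shows "(\<lambda>w. qpoch (x w) (q w)) holomorphic_on S"
proof (rule holomorphic_uniform_sequence[OF S, where f = "\<lambda>M w. \<Prod>n<M. 1 - q w ^ Suc n * x w"])
  show "(\<lambda>w. \<Prod>n<M. 1 - q w ^ Suc n * x w) holomorphic_on S" for M
    by (intro holomorphic_intros x q)
next
  fix w assume "w \<in> S"
  with S obtain d where d: "d > 0" "cball w d \<subseteq> S"
    using open_contains_cball by blast
  have cq: "continuous_on (cball w d) q" and cx: "continuous_on (cball w d) x"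
    using x q d holomorphic_on_imp_continuous_on continuous_on_subset by blast+
  \<comment> \<open>The maxima of |q| and |x| over the closed ball give a geometric majorant that is
    uniform on the ball.\<close>
  obtain v where v: "v \<in> cball w d" "\<And>u. u \<in> cball w d \<Longrightarrow> norm (q u) \<le> norm (q v)"
    using continuous_attains_sup[OF compact_cball, of w d "\<lambda>u. norm (q u)"] continuous_on_norm[OF cq] d
    by force
  obtain v' where v': "v' \<in> cball w d" "\<And>u. u \<in> cball w d \<Longrightarrow> norm (x u) \<le> norm (x v')"
    using continuous_attains_sup[OF compact_cball, of w d "\<lambda>u. norm (x u)"] continuous_on_norm[OF cx] d
    by force
  have "norm (q v) < 1" using v d less by auto
  then have "summable (\<lambda>n. norm (q v) ^ n * (norm (q v) * norm (x v')))"
    by (intro summable_mult2 summable_geometric) auto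
  then have sm: "summable (\<lambda>n. norm (q v) ^ Suc n * norm (x v'))"
    by (simp add: mult_ac)
  have "uniformly_convergent_on (cball w d) (\<lambda>N u. \<Sum>n<N. norm ((1 - q u ^ Suc n * x u) - 1))"
  proof (rule Weierstrass_m_test'[OF _ sm])
    fix n u assume u: "u \<in> cball w d"
    have "norm (q u) ^ Suc n * norm (x u) \<le> norm (q v) ^ Suc n * norm (x v')"
      by (intro mult_mono power_mono v v' u) auto
    then show "norm (norm ((1 - q u ^ Suc n * x u) - 1)) \<le> norm (q v) ^ Suc n * norm (x v')"
      by (simp add: norm_mult norm_power)
  qed
  then have "uniformly_convergent_on (cball w d) (\<lambda>N u. \<Prod>n<N. 1 - q u ^ Suc n * x u)"
    by (intro uniformly_convergent_on_prod' compact_cball) (auto intro!: continuous_intros cq cx)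
  then obtain l where l: "uniform_limit (cball w d) (\<lambda>N u. \<Prod>n<N. 1 - q u ^ Suc n * x u) l sequentially"
    by (auto simp: uniformly_convergent_on_def)
  have "l u = qpoch (x u) (q u)" if "u \<in> cball w d" for u
    using LIMSEQ_unique[OF tendsto_uniform_limitI[OF l that] qpoch_tendsto[OF less]] that d by blast
  then have "uniform_limit (cball w d) (\<lambda>N u. \<Prod>n<N. 1 - q u ^ Suc n * x u) (\<lambda>u. qpoch (x u) (q u)) sequentially"
    using l by (subst (asm) uniform_limit_cong'[where g = "\<lambda>N u. \<Prod>n<N. 1 - q u ^ Suc n * x u" and i = "\<lambda>u. qpoch (x u) (q u)"]) auto
  with d show "\<exists>d>0. cball w d \<subseteq> S \<and> uniform_limit (cball w d) (\<lambda>N u. \<Prod>n<N. 1 - q u ^ Suc n * x u) (\<lambda>u. qpoch (x u) (q u)) sequentially"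
    by blast
qed

text \<open>Every exponent m >= 1 is uniquely p(k + 1) - r with r < p. Sorting the factors by r
  gives products in t^p; counting down from p(k + 1) is why inverse powers of t occur.\<close>

lemma qpoch_blocks:
  assumes t: "norm t < 1" "t \<noteq> 0" and p: "p > 0"
  shows "(\<Prod>r<p. qpoch (x * inverse (t ^ r)) (t ^ p)) = qpoch x t"
proof -
  have tp: "norm (t ^ p) < 1" using t p by (simp add: norm_power power_less_one_iff)
  have "(\<lambda>M. \<Prod>n<M * p. 1 - t ^ Suc n * x) \<longlonglongrightarrow> qpoch x t"
    by (rule filterlim_compose[OF qpoch_tendsto[OF t(1)]]) (use p in \<open>simp add: filterlim_subseq strict_mono_def\<close>)
  moreover have "(\<Prod>n<M * p. 1 - t ^ Suc n * x) = (\<Prod>k<M. \<Prod>r<p. 1 - (t ^ p) ^ Suc k * (x * inverse (t ^ r)))" for M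
  proof -
    have "(\<Prod>n<M * p. 1 - t ^ Suc n * x) = (\<Prod>k<M. \<Prod>n\<in>{k*p..<k*p+p}. 1 - t ^ Suc n * x)"
      by (rule prod.nat_group[symmetric])
    also have "\<dots> = (\<Prod>k<M. \<Prod>r<p. 1 - (t ^ p) ^ Suc k * (x * inverse (t ^ r)))"
    proof (rule prod.cong[OF refl])
      fix k
      show "(\<Prod>n\<in>{k*p..<k*p+p}. 1 - t ^ Suc n * x) = (\<Prod>r<p. 1 - (t ^ p) ^ Suc k * (x * inverse (t ^ r)))"
      proof (rule prod.reindex_bij_witness[where i = "\<lambda>r. k * p + (p - 1 - r)" and j = "\<lambda>n. k * p + p - 1 - n"])
        fix n assume n: "n \<in> {k*p..<k*p+p}"
        have e: "(t ^ p) ^ Suc k = t ^ Suc n * t ^ (k * p + p - 1 - n)"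
          unfolding power_mult[symmetric] power_add[symmetric]
          using n p by (intro arg_cong[where f = "\<lambda>n. t ^ n"]) (auto simp: algebra_simps)
        show "1 - (t ^ p) ^ Suc k * (x * inverse (t ^ (k * p + p - 1 - n))) = 1 - t ^ Suc n * x"
          unfolding e using t(2) by (simp add: field_simps)
      qed (use p in auto)
    qed
    finally show ?thesis .
  qed
  moreover have "(\<lambda>M. \<Prod>r<p. \<Prod>k<M. 1 - (t ^ p) ^ Suc k * (x * inverse (t ^ r))) \<longlonglongrightarrow>
      (\<Prod>r<p. qpoch (x * inverse (t ^ r)) (t ^ p))"
    by (intro tendsto_prod qpoch_tendsto tp)
  ultimately show ?thesis
    by (subst (asm) prod.swap) (auto intro: LIMSEQ_unique)
qed

section \<open>The theta function\<close>

text \<open>This is 2 pi i times Jacobi's odd theta function over its derivative at 0. The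
  denominator gives the derivative 2 pi i at 0 for every z, so no unknown factor is left when z is
  replaced by -1/z.\<close>

definition theta :: "complex \<Rightarrow> complex \<Rightarrow> complex" where
  "theta u z = (e2pi (u / 2) - e2pi (- u / 2)) * qpoch (e2pi u) (e2pi z) * qpoch (e2pi (- u)) (e2pi z) /
     (qpoch 1 (e2pi z))\<^sup>2"

lemma e2pi_double: "e2pi u = e2pi (u / 2) ^ 2"
  by (simp add: e2pi_power)

lemma theta_minus: "theta (- u) z = - theta u z"
  by (simp add: theta_def minus_divide_left algebra_simps del: minus_divide_left[symmetric])

lemma theta_plus_1: "theta (u + 1) z = - theta u z"
proof -
  have "e2pi ((u + 1) / 2) = - e2pi (u / 2)" "e2pi (- (u + 1) / 2) = - e2pi (- u / 2)"
    "e2pi (u + 1) = e2pi u" "e2pi (- (u + 1)) = e2pi (- u)"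
    by (simp_all add: add_divide_distrib diff_divide_distrib e2pi_add e2pi_minus e2pi_diff)
  then show ?thesis
    by (simp only: theta_def minus_divide_left) (simp add: algebra_simps)
qed

lemma theta_plus_tau:
  assumes "Im z > 0"
  shows "theta (u + z) z = - e2pi (- u - z / 2) * theta u z"
proof -
  \<comment> \<open>In the half-argument exponentials \<open>h\<close> and \<open>g\<close> the
    claim is an identity of rational functions, once a single factor has been split off each
    product.\<close>
  define h g where "h = e2pi (u / 2)" and "g = e2pi (z / 2)"
  have nz: "h \<noteq> 0" "g \<noteq> 0" by (simp_all add: h_def g_def)
  have eqs: "e2pi u = h\<^sup>2" "e2pi z = g\<^sup>2" "e2pi (- u) = inverse (h\<^sup>2)" "e2pi (- u / 2) = inverse h"
    "e2pi ((u + z) / 2) = h * g" "e2pi (- (u + z) / 2) = inverse (h * g)"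
    "e2pi (u + z) = g\<^sup>2 * h\<^sup>2" "e2pi (- (u + z)) = inverse (g\<^sup>2 * h\<^sup>2)"
    "e2pi (- u - z / 2) = inverse (h\<^sup>2 * g)"
    by (simp_all add: h_def g_def e2pi_power flip: e2pi_minus e2pi_add)
       (auto intro!: arg_cong[where f = e2pi] simp: field_simps)
  have q: "norm (g\<^sup>2) < 1" using norm_e2pi_less_1[OF assms] by (simp add: eqs)
  have 1: "qpoch (h\<^sup>2) (g\<^sup>2) = (1 - g\<^sup>2 * h\<^sup>2) * qpoch (g\<^sup>2 * h\<^sup>2) (g\<^sup>2)"
    by (rule qpoch_Suc[OF q])
  have "g\<^sup>2 * inverse (g\<^sup>2 * h\<^sup>2) = inverse (h\<^sup>2)" using nz by (simp add: field_simps)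
  then have 2: "qpoch (inverse (g\<^sup>2 * h\<^sup>2)) (g\<^sup>2) = (1 - inverse (h\<^sup>2)) * qpoch (inverse (h\<^sup>2)) (g\<^sup>2)"
    using qpoch_Suc[OF q, of "inverse (g\<^sup>2 * h\<^sup>2)"] by (simp only:)
  have "(h * g - inverse (h * g)) * qpoch (g\<^sup>2 * h\<^sup>2) (g\<^sup>2) * qpoch (inverse (g\<^sup>2 * h\<^sup>2)) (g\<^sup>2)
      = - inverse (h * g) * ((1 - g\<^sup>2 * h\<^sup>2) * qpoch (g\<^sup>2 * h\<^sup>2) (g\<^sup>2)) * ((1 - inverse (h\<^sup>2)) * qpoch (inverse (h\<^sup>2)) (g\<^sup>2))"
    unfolding 2 using nz by (simp add: field_simps power2_eq_square)
  also have "\<dots> = - inverse (h\<^sup>2 * g) * ((h - inverse h) * qpoch (h\<^sup>2) (g\<^sup>2) * qpoch (inverse (h\<^sup>2)) (g\<^sup>2))"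
    unfolding 1[symmetric] using nz by (simp add: field_simps power2_eq_square)
  finally have *: "(h * g - inverse (h * g)) * qpoch (g\<^sup>2 * h\<^sup>2) (g\<^sup>2) * qpoch (inverse (g\<^sup>2 * h\<^sup>2)) (g\<^sup>2)
      = - inverse (h\<^sup>2 * g) * ((h - inverse h) * qpoch (h\<^sup>2) (g\<^sup>2) * qpoch (inverse (h\<^sup>2)) (g\<^sup>2))" .
  show ?thesis
    unfolding theta_def eqs h_def[symmetric] by (simp only: * times_divide_eq_right)
qed

lemma theta_0 [simp]: "theta 0 z = 0"
  by (simp add: theta_def)

text \<open>A vanishing product has a vanishing factor, and each factor says that e2pi (m z + u) = 1
  for some integer m: m = 0 for the prefactor, m > 0 for the first product, m < 0 for the
  second.\<close>

lemma theta_eq_0_imp: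
  assumes "Im z > 0" "theta u z = 0"
  obtains m n :: int where "u = of_int m * z + of_int n"
proof -
  have q: "norm (e2pi z) < 1" using norm_e2pi_less_1[OF assms(1)] .
  have "qpoch 1 (e2pi z) \<noteq> 0" by (rule qpoch_nonzero'[OF q]) simp
  then consider "e2pi (u / 2) = e2pi (- u / 2)" | "qpoch (e2pi u) (e2pi z) = 0" | "qpoch (e2pi (- u)) (e2pi z) = 0"
    using assms(2) by (auto simp: theta_def)
  then obtain m :: int where "e2pi (of_int m * z + u) = 1"
  proof cases
    case 1
    then have "e2pi (of_int 0 * z + u) = 1"
      unfolding e2pi_double[of "of_int 0 * z + u"]
      by (simp add: e2pi_minus power2_eq_square field_simps)
    then show ?thesis by (rule that)
  next
    case 2
    then obtain n where "e2pi z ^ Suc n * e2pi u = 1"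
      using qpoch_nonzero[OF q] by blast
    then have "e2pi (of_int (int (Suc n)) * z + u) = 1"
      unfolding e2pi_add e2pi_power by simp
    then show ?thesis by (rule that)
  next
    case 3
    then obtain n where "e2pi z ^ Suc n * e2pi (- u) = 1"
      using qpoch_nonzero[OF q] by blast
    then have "e2pi (of_nat (Suc n) * z - u) = 1"
      unfolding e2pi_diff e2pi_power by (simp add: e2pi_minus field_simps)
    then have "inverse (e2pi (of_nat (Suc n) * z - u)) = 1" by simp
    then have "e2pi (of_int (- int (Suc n)) * z + u) = 1"
      unfolding e2pi_minus[symmetric] by (simp add: algebra_simps)
    then show ?thesis by (rule that)
  qed
  then obtain n :: int where "of_int m * z + u = of_int n"
    using e2pi_eq_1_iff by blast
  then have "u = of_int (- m) * z + of_int n" by (simp add: algebra_simps)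
  then show ?thesis by (rule that)
qed

lemma theta_holomorphic:
  assumes "Im z > 0"
  shows "(\<lambda>u. theta u z) holomorphic_on S"
proof -
  have q: "norm (e2pi z) < 1" using norm_e2pi_less_1[OF assms] .
  have "qpoch 1 (e2pi z) \<noteq> 0" by (rule qpoch_nonzero'[OF q]) simp
  then have "(\<lambda>u. theta u z) holomorphic_on UNIV"
    unfolding theta_def by (intro holomorphic_intros qpoch_holomorphic) (use q in auto)
  then show ?thesis by (rule holomorphic_on_subset) simp
qed

lemma theta_has_field_derivative_0:
  assumes "Im z > 0"
  shows "((\<lambda>u. theta u z) has_field_derivative 2 * of_real pi * \<i>) (at 0)"
proof -
  have q: "norm (e2pi z) < 1" using norm_e2pi_less_1[OF assms] .
  have nz: "qpoch 1 (e2pi z) \<noteq> 0" by (rule qpoch_nonzero'[OF q]) simp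
  define f where "f u = qpoch (e2pi u) (e2pi z) * qpoch (e2pi (- u)) (e2pi z) / (qpoch 1 (e2pi z))\<^sup>2" for u
  have "f holomorphic_on UNIV"
    unfolding f_def by (intro holomorphic_intros qpoch_holomorphic) (use q nz in auto)
  then obtain f' where f': "(f has_field_derivative f') (at 0)"
    using holomorphic_on_imp_differentiable_at[of f UNIV 0] by (auto simp: field_differentiable_def)
  have "f 0 = 1" using nz by (simp add: f_def power2_eq_square)
  have "((\<lambda>u. (e2pi (u / 2) - e2pi (- u / 2)) * f u) has_field_derivative 2 * of_real pi * \<i>) (at 0)"
    unfolding e2pi_def
    by (rule derivative_eq_intros f' refl | simp add: \<open>f 0 = 1\<close>)+
  then show ?thesis by (simp add: theta_def f_def mult.assoc)
qed

text \<open>Phrased for predicates because it serves two purposes: a function is invariant under the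
  lattice, and a zero at 0 of a merely quasi-periodic function spreads to all lattice
  points.\<close>

lemma lattice_shift:
  fixes z u :: complex and m n :: int
  assumes "\<And>u. P (u + 1) \<longleftrightarrow> P u" "\<And>u. P (u + z) \<longleftrightarrow> P u"
  shows "P (u + (of_int m * z + of_int n)) \<longleftrightarrow> P u"
proof -
  have *: "P (u + of_int m * w) \<longleftrightarrow> P u" if w: "\<And>u. P (u + w) \<longleftrightarrow> P u" for w u and m :: int
  proof (induction m rule: int_induct[where k = 0])
    case (step1 i)
    then show ?case using w[of "u + of_int i * w"] by (simp add: algebra_simps)
  next
    case (step2 i)
    then show ?case using w[of "u + of_int (i - 1) * w"] by (simp add: algebra_simps)
  qed simp
  show ?thesis
    using *[OF assms(1), of "u + of_int m * z" n] *[OF assms(2), of u m] by (simp add: add.assoc)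
qed

text \<open>The quotient of \<open>G\<close> by the theta function is elliptic without poles, hence constant.\<close>

lemma theta_unique:
  assumes z: "Im z > 0" and G: "G holomorphic_on UNIV" "G 0 = 0"
      "(G has_field_derivative 2 * of_real pi * \<i>) (at 0)"
    and G1: "\<And>u. G (u + 1) = - G u" and Gz: "\<And>u. G (u + z) = - e2pi (- u - z / 2) * G u"
  shows "G u = theta u z"
proof -
  define t where "t u = theta u z" for u
  note t_hol = theta_holomorphic[OF z, folded t_def]
  have t1: "t (u + 1) = - t u" and tz: "t (u + z) = - e2pi (- u - z / 2) * t u" for u
    using theta_plus_1[of u z] theta_plus_tau[OF z, of u] by (simp_all add: t_def)
  \<comment> \<open>The value 1 at the zeros of \<open>t\<close> is the one that removes the
    singularities, since \<open>G\<close> and \<open>t\<close> have the same derivative at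
    0.\<close>
  define R where "R u = (if t u = 0 then 1 else G u / t u)" for u
  have R1: "R (u + 1) = R u" and Rz: "R (u + z) = R u" for u
    by (simp_all add: R_def t1 tz G1 Gz)
  have R_shift: "R (u + (of_int m * z + of_int n)) = R u" for u and m n :: int
    using lattice_shift[of "\<lambda>v. R v = R u" z u m n] by (simp add: R1 Rz)
  have "((\<lambda>u. t u / u) \<longlongrightarrow> 2 * of_real pi * \<i>) (at 0)"
    using theta_has_field_derivative_0[OF z] by (simp add: has_field_derivative_iff t_def)
  then have "eventually (\<lambda>u. t u / u \<noteq> 0) (at 0)"
    by (rule tendsto_imp_eventually_ne) simp
  then obtain d where d: "d > 0" "\<And>u. u \<noteq> 0 \<Longrightarrow> dist u 0 < d \<Longrightarrow> t u / u \<noteq> 0"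
    by (auto simp: eventually_at)
  have "((\<lambda>u. G u / t u) \<longlongrightarrow> 1) (at 0)"
    by (rule lhopital_complex_simple[OF G(3) theta_has_field_derivative_0[OF z, folded t_def]])
       (use G(2) in \<open>auto simp: t_def\<close>)
  moreover have "eventually (\<lambda>u. G u / t u = R u) (at 0)"
    unfolding eventually_at by (rule exI[of _ d]) (use d in \<open>auto simp: R_def\<close>)
  ultimately have R_lim: "(R \<longlongrightarrow> R 0) (at 0)"
    by (auto simp: R_def t_def elim: Lim_transform_eventually)
  have "R holomorphic_on ball 0 d"
  proof (rule no_isolated_singularity'[where K = "{0}"])
    have "(\<lambda>u. G u / t u) holomorphic_on ball 0 d - {0}"
      by (intro holomorphic_intros t_hol holomorphic_on_subset[OF G(1)]) (use d in auto)
    then show "R holomorphic_on ball 0 d - {0}"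
      by (rule holomorphic_transform) (use d in \<open>auto simp: R_def\<close>)
  qed (use R_lim d in \<open>auto intro: tendsto_within_subset\<close>)
  then have R0: "R field_differentiable at 0"
    using d(1) by (auto simp: holomorphic_on_open field_differentiable_def)
  have t_cont: "continuous_on UNIV t"
    using t_hol holomorphic_on_imp_continuous_on by blast
  have "R field_differentiable at v" for v
  proof (cases "t v = 0")
    case True
    then obtain m n :: int where v: "v = of_int m * z + of_int n"
      using theta_eq_0_imp[OF z] unfolding t_def by blast
    \<comment> \<open>By periodicity, \<open>R\<close> near a lattice point is a translate of
      \<open>R\<close> near 0.\<close>
    have "R = R \<circ> (\<lambda>u. u - v)"
    proof
      fix u show "R u = (R \<circ> (\<lambda>u. u - v)) u"
        using R_shift[of "u - v" m n] by (simp add: v)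
    qed
    moreover have "R \<circ> (\<lambda>u. u - v) field_differentiable at v"
      by (rule field_differentiable_compose) (use R0 in \<open>auto intro!: derivative_intros\<close>)
    ultimately show ?thesis by metis
  next
    case False
    define S where "S = {u. t u \<noteq> 0}"
    have S: "open S"
      unfolding S_def using t_cont by (intro open_Collect_neq) (auto intro: continuous_intros)
    have "(\<lambda>u. G u / t u) holomorphic_on S"
      by (intro holomorphic_intros t_hol holomorphic_on_subset[OF G(1)]) (auto simp: S_def)
    then have "R holomorphic_on S"
      by (rule holomorphic_transform) (auto simp: R_def S_def)
    then show ?thesis using S False
      by (auto simp: holomorphic_on_open field_differentiable_def S_def)
  qed
  then have R_hol: "R holomorphic_on UNIV"
    by (auto simp: holomorphic_on_def field_differentiable_at_within)
  \<comment> \<open>All values are taken on the closed period parallelogram, which is compact; so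
    the entire function \<open>R\<close> is bounded.\<close>
  have "range R \<subseteq> R ` ((\<lambda>(s, r). of_real s + of_real r * z) ` ({0..1} \<times> {0..1}))"
  proof
    fix y assume "y \<in> range R"
    then obtain v where y: "y = R v" by auto
    define r where "r = Im v / Im z"
    define s where "s = Re v - r * Re z"
    have v: "v = of_real s + of_real r * z"
      using z by (simp add: complex_eq_iff s_def r_def)
    have "R v = R ((of_real (frac s) + of_real (frac r) * z) + (of_int \<lfloor>r\<rfloor> * z + of_int \<lfloor>s\<rfloor>))"
      by (rule arg_cong[where f = R]) (simp add: v frac_def algebra_simps)
    also have "\<dots> = R (of_real (frac s) + of_real (frac r) * z)"
      by (rule R_shift)
    finally show "y \<in> R ` ((\<lambda>(s, r). of_real s + of_real r * z) ` ({0..1} \<times> {0..1}))"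
      unfolding y by (intro image_eqI[OF _ image_eqI[where x = "(frac s, frac r)"]])
        (auto simp: less_imp_le frac_lt_1)
  qed
  moreover have "compact (R ` ((\<lambda>(s, r). of_real s + of_real r * z) ` ({0..1::real} \<times> {0..1::real})))"
    by (intro compact_continuous_image compact_Times compact_Icc
          continuous_on_subset[OF holomorphic_on_imp_continuous_on[OF R_hol]])
       (auto simp: case_prod_unfold intro!: continuous_intros)
  ultimately have "bounded (range R)"
    using compact_imp_bounded bounded_subset by blast
  then obtain c where c: "\<And>u. R u = c"
    using Liouville_theorem[OF R_hol] by (auto simp: constant_on_def)
  have "R u = 1" using c[of u] c[of 0] by (simp add: R_def t_def)
  have "G u = t u"
  \<comment> \<open>At the zeros of \<open>t\<close> the quotient says nothing about
    \<open>G\<close>; there \<open>G\<close> vanishes because its zero at 0 spreads over the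
    lattice.\<close>
  proof (cases "t u = 0")
    case True
    then obtain m n :: int where u: "u = of_int m * z + of_int n"
      using theta_eq_0_imp[OF z] unfolding t_def by blast
    then have "G u = 0"
      using lattice_shift[of "\<lambda>v. G v = 0" z 0 m n] G(2) by (simp add: G1 Gz)
    then show ?thesis using True by simp
  qed (use \<open>R u = 1\<close> in \<open>simp add: R_def\<close>)
  then show ?thesis by (simp add: t_def)
qed

lemma Im_minus_inverse_pos:
  assumes "Im z > 0"
  shows "Im (- 1 / z) > 0"
proof -
  have "(Re z)\<^sup>2 + (Im z)\<^sup>2 > 0"
    using assms by (simp add: sum_power2_gt_zero_iff)
  then show ?thesis using assms by (simp add: Im_divide)
qed

text \<open>The Gaussian factor absorbs the change of quasi-periods when the lattice is rescaled by
  z, and the factor z restores the derivative at 0. Then \<open>theta_unique\<close>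
  applies.\<close>

lemma theta_S:
  assumes z: "Im z > 0"
  shows "theta (u / z) (- 1 / z) = e2pi (u\<^sup>2 / (2 * z)) * theta u z / z"
proof -
  have nz: "z \<noteq> 0" using z by auto
  define z' where "z' = - 1 / z"
  have z': "Im z' > 0" unfolding z'_def by (rule Im_minus_inverse_pos[OF z])
  define G where "G u = e2pi (- u\<^sup>2 / (2 * z)) * z * theta (u / z) z'" for u
  have "G u = theta u z"
  proof (rule theta_unique[OF z])
    have "((\<lambda>v. theta v z') \<circ> (\<lambda>u. u / z)) holomorphic_on UNIV"
      by (intro holomorphic_on_compose holomorphic_intros theta_holomorphic z') (use nz in auto)
    then show "G holomorphic_on UNIV"
      unfolding G_def using nz by (auto intro!: holomorphic_intros simp: o_def)
    show "G 0 = 0" by (simp add: G_def)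
    have D: "((\<lambda>v. theta v z') has_field_derivative 2 * of_real pi * \<i>) (at (0 / z))"
      using theta_has_field_derivative_0[OF z'] by simp
    have D': "((\<lambda>u. u / z) has_field_derivative 1 / z) (at 0)"
      using nz by (auto intro!: derivative_eq_intros)
    have 1: "((\<lambda>u. theta (u / z) z') has_field_derivative 2 * of_real pi * \<i> * (1 / z)) (at 0)"
      using DERIV_chain2[OF D D'] .
    have 2: "((\<lambda>u. e2pi (- u\<^sup>2 / (2 * z)) * z) has_field_derivative 0) (at 0)"
      unfolding e2pi_def using nz by (auto intro!: derivative_eq_intros)
    show "(G has_field_derivative 2 * of_real pi * \<i>) (at 0)"
      unfolding G_def using DERIV_mult[OF 2 1] nz by simp
    fix u
    \<comment> \<open>The two periods exchange roles: adding 1 to \<open>u\<close> subtracts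
      \<open>z'\<close> from u/z, so the quasi-periodicity is read backwards.\<close>
    have "theta (u / z) z' = theta ((u / z - z') + z') z'" by simp
    also have "\<dots> = - e2pi (- (u / z - z') - z' / 2) * theta (u / z - z') z'"
      by (rule theta_plus_tau[OF z'])
    finally have "theta (u / z - z') z' = - inverse (e2pi (- (u / z - z') - z' / 2)) * theta (u / z) z'"
      by simp
    also have "inverse (e2pi (- (u / z - z') - z' / 2)) = e2pi (u / z - z' / 2)"
      unfolding e2pi_minus[symmetric] by (simp add: algebra_simps)
    finally have *: "theta (u / z - z') z' = - e2pi (u / z - z' / 2) * theta (u / z) z'" .
    have "(u + 1) / z = u / z - z'" by (simp add: z'_def add_divide_distrib)
    then have "G (u + 1) = - (e2pi (- (u + 1)\<^sup>2 / (2 * z)) * e2pi (u / z - z' / 2)) * z * theta (u / z) z'"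
      unfolding G_def by (simp add: *)
    also have "e2pi (- (u + 1)\<^sup>2 / (2 * z)) * e2pi (u / z - z' / 2) = e2pi (- u\<^sup>2 / (2 * z))"
      unfolding e2pi_add[symmetric] z'_def using nz
      by (intro arg_cong[where f = e2pi]) (simp add: field_simps power2_eq_square)
    finally show "G (u + 1) = - G u" by (simp add: G_def)
    have "(u + z) / z = u / z + 1" using nz by (simp add: add_divide_distrib)
    then have "G (u + z) = - e2pi (- (u + z)\<^sup>2 / (2 * z)) * z * theta (u / z) z'"
      unfolding G_def by (simp add: theta_plus_1)
    also have "e2pi (- (u + z)\<^sup>2 / (2 * z)) = e2pi (- u - z / 2) * e2pi (- u\<^sup>2 / (2 * z))"
      unfolding e2pi_add[symmetric] using nz
      by (intro arg_cong[where f = e2pi]) (simp add: field_simps power2_eq_square)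
    finally show "G (u + z) = - e2pi (- u - z / 2) * G u" by (simp add: G_def)
  qed
  then have "e2pi (u\<^sup>2 / (2 * z)) * theta u z / z = (e2pi (u\<^sup>2 / (2 * z)) * e2pi (- (u\<^sup>2 / (2 * z)))) * theta (u / z) z'"
    using nz by (simp add: G_def flip: \<open>G u = theta u z\<close>)
  then show ?thesis by (simp add: e2pi_minus z'_def)
qed

section \<open>Klein forms\<close>

text \<open>Up to the factor \<open>2 \<pi> \<i>\<close> this is the Klein form; \<open>r\<close> and \<open>s\<close> are allowed to be complex.\<close>

definition klein_form :: "complex \<Rightarrow> complex \<Rightarrow> complex \<Rightarrow> complex" where
  "klein_form r s z = e2pi (r * (r * z + s) / 2) * theta (r * z + s) z"

lemma klein_form_minus: "klein_form (- r) (- s) z = - klein_form r s z"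
proof -
  have "- r * (- r * z + - s) / 2 = r * (r * z + s) / 2" "- r * z + - s = - (r * z + s)"
    by (simp_all add: algebra_simps)
  then show ?thesis unfolding klein_form_def by (simp only: theta_minus) simp
qed

lemma klein_form_snd_plus_1: "klein_form r (s + 1) z = - e2pi (r / 2) * klein_form r s z"
proof -
  have "r * (r * z + (s + 1)) / 2 = r / 2 + r * (r * z + s) / 2" "r * z + (s + 1) = (r * z + s) + 1"
    by (simp_all add: field_simps)
  then show ?thesis unfolding klein_form_def by (simp only: theta_plus_1 e2pi_add) simp
qed

lemma klein_form_fst_plus_1:
  assumes "Im z > 0"
  shows "klein_form (r + 1) s z = - e2pi (- s / 2) * klein_form r s z"
proof -
  define u where "u = r * z + s"
  have "(r + 1) * ((r + 1) * z + s) / 2 + (- u - z / 2) = - s / 2 + r * u / 2"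
    by (simp add: u_def field_simps)
  then have *: "e2pi ((r + 1) * ((r + 1) * z + s) / 2) * e2pi (- u - z / 2) = e2pi (- s / 2) * e2pi (r * u / 2)"
    unfolding e2pi_add[symmetric] by simp
  have "(r + 1) * z + s = u + z" by (simp add: u_def algebra_simps)
  then have "klein_form (r + 1) s z = - (e2pi ((r + 1) * ((r + 1) * z + s) / 2) * e2pi (- u - z / 2)) * theta u z"
    unfolding klein_form_def by (simp add: theta_plus_tau[OF assms])
  then show ?thesis unfolding * by (simp add: klein_form_def u_def)
qed

lemma klein_form_snd_plus_int:
  "klein_form r (s + of_int n) z = (-1) ^ nat \<bar>n\<bar> * e2pi (of_int n * r / 2) * klein_form r s z"
proof -
  have *: "klein_form r (s + of_nat m) z = (-1) ^ m * e2pi (of_nat m * r / 2) * klein_form r s z" for m s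
  proof (induction m)
    case (Suc m)
    have "klein_form r (s + of_nat (Suc m)) z = klein_form r ((s + of_nat m) + 1) z" by (simp add: add_ac)
    also have "\<dots> = - (e2pi (r / 2) * ((-1) ^ m * e2pi (of_nat m * r / 2) * klein_form r s z))"
      by (simp add: klein_form_snd_plus_1 Suc.IH)
    also have "\<dots> = (-1) ^ Suc m * (e2pi (r / 2) * e2pi (of_nat m * r / 2)) * klein_form r s z"
      by simp
    also have "e2pi (r / 2) * e2pi (of_nat m * r / 2) = e2pi (of_nat (Suc m) * r / 2)"
      unfolding e2pi_add[symmetric] by (simp add: field_simps)
    finally show ?case .
  qed simp
  show ?thesis
  proof (cases "n \<ge> 0")
    case True
    then show ?thesis using *[of s "nat n"] by simp
  next
    case False
    define m where "m = nat (- n)"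
    have n: "n = - int m" using False by (simp add: m_def)
    have "klein_form r s z = (-1) ^ m * e2pi (of_nat m * r / 2) * klein_form r (s + of_int n) z"
      using *[of "s + of_int n" m] by (simp add: n)
    also have "(-1) ^ m * inverse (e2pi (of_nat m * r / 2)) * \<dots>
       = ((-1) ^ m * (-1) ^ m) * (inverse (e2pi (of_nat m * r / 2)) * e2pi (of_nat m * r / 2)) * klein_form r (s + of_int n) z"
      by (simp only: mult_ac)
    also have "\<dots> = klein_form r (s + of_int n) z"
      by (simp flip: power_add mult_2)
    finally have "klein_form r (s + of_int n) z = (-1) ^ m * inverse (e2pi (of_nat m * r / 2)) * klein_form r s z" by simp
    moreover have "e2pi (of_int n * r / 2) = inverse (e2pi (of_nat m * r / 2))" "nat \<bar>n\<bar> = m"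
      unfolding e2pi_minus[symmetric] by (simp_all add: n)
    ultimately show ?thesis by simp
  qed
qed

lemma klein_form_T: "klein_form r s (z + 1) = klein_form r (r + s) z"
proof -
  have "e2pi (z + 1) = e2pi z" by (simp add: e2pi_add)
  moreover have "r * (z + 1) + s = r * z + (r + s)" by (simp add: algebra_simps)
  ultimately show ?thesis by (simp only: klein_form_def theta_def)
qed

lemma klein_form_S:
  assumes z: "Im z > 0"
  shows "klein_form r s (- 1 / z) = klein_form s (- r) z / z"
proof -
  have nz: "z \<noteq> 0" using z by auto
  have 1: "r * (- 1 / z) + s = (s * z - r) / z" using nz by (simp add: field_simps)
  have "klein_form r s (- 1 / z) = (e2pi (r * ((s * z - r) / z) / 2) * e2pi ((s * z - r)\<^sup>2 / (2 * z))) * theta (s * z - r) z / z"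
    unfolding klein_form_def 1 theta_S[OF z] by simp
  also have "e2pi (r * ((s * z - r) / z) / 2) * e2pi ((s * z - r)\<^sup>2 / (2 * z)) = e2pi (s * (s * z + - r) / 2)"
    unfolding e2pi_add[symmetric] using nz
    by (intro arg_cong[where f = e2pi]) (simp add: field_simps power2_eq_square)
  finally show ?thesis by (simp add: klein_form_def)
qed

text \<open>Euclid's algorithm on the first column: powers of T divide with remainder, S exchanges
  the rows up to sign, and |c| decreases. The rules are left multiplications, matching -1/w, w + 1
  and w - 1 for the transformed point w.\<close>

lemma sl2_induct:
  fixes P :: "int \<Rightarrow> int \<Rightarrow> int \<Rightarrow> int \<Rightarrow> bool"
  assumes det: "a * d - b * c = 1"
    and one: "P 1 0 0 1"
    and S: "\<And>a b c d. a * d - b * c = 1 \<Longrightarrow> P a b c d \<Longrightarrow> P (- c) (- d) a b"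
    and T: "\<And>a b c d. a * d - b * c = 1 \<Longrightarrow> P a b c d \<Longrightarrow> P (a + c) (b + d) c d"
    and T': "\<And>a b c d. a * d - b * c = 1 \<Longrightarrow> P a b c d \<Longrightarrow> P (a - c) (b - d) c d"
  shows "P a b c d"
proof -
  have Tn: "P (a + k * c) (b + k * d) c d" if "P a b c d" "a * d - b * c = 1" for a b c d k
  proof (induction k rule: int_induct[where k = 0])
    case (step1 i)
    have "(a + i * c) * d - (b + i * d) * c = 1" using that(2) by (simp add: algebra_simps)
    then have "P (a + i * c + c) (b + i * d + d) c d" using step1 T by blast
    then show ?case by (simp add: algebra_simps)
  next
    case (step2 i)
    have "(a + i * c) * d - (b + i * d) * c = 1" using that(2) by (simp add: algebra_simps)
    then have "P (a + i * c - c) (b + i * d - d) c d" using step2 T' by blast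
    then show ?case by (simp add: algebra_simps)
  qed (use that in simp)
  \<comment> \<open>The square of S is minus the identity; this settles c = 0 with a = d =
    -1.\<close>
  have neg: "P (- a) (- b) (- c) (- d)" if "P a b c d" "a * d - b * c = 1" for a b c d
    using S[where a = "- c" and b = "- d" and c = a and d = b, OF _ S[OF that(2,1)]] that(2) by (simp add: mult_ac)
  show ?thesis using det
  proof (induction "nat \<bar>c\<bar>" arbitrary: a b c d rule: less_induct)
    case less
    show ?case
    proof (cases "c = 0")
      case True
      then have "a * d = 1" using less.prems by simp
      then consider "a = 1" "d = 1" | "a = -1" "d = -1" by (metis zmult_eq_1_iff)
      then show ?thesis
      proof cases
        case 1
        then show ?thesis using Tn[OF one, of b] True by simp
      next
        case 2
        then have "P 1 (- b) 0 1" using Tn[OF one, of "- b"] by simp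
        then show ?thesis using neg[of 1 "- b" 0 1] 2 True by simp
      qed
    next
      case False
      define k where "k = a div c"
      define a' b' where "a' = a - k * c" and "b' = b - k * d"
      have det': "a' * d - b' * c = 1" using less.prems by (simp add: a'_def b'_def algebra_simps)
      have "\<bar>a'\<bar> < \<bar>c\<bar>"
        unfolding a'_def k_def minus_div_mult_eq_mod using False by (rule abs_mod_less)
      moreover have "c * (- b') - d * (- a') = 1" using det' by (simp add: algebra_simps)
      ultimately have "P c d (- a') (- b')"
        by (intro less.hyps) (auto simp: algebra_simps)
      then have "P a' b' c d"
        using S[where a = c and b = d and c = "- a'" and d = "- b'"] \<open>c * (- b') - d * (- a') = 1\<close> by (simp add: algebra_simps)
      then show ?thesis
        using Tn[of a' b' c d k] det' by (simp add: a'_def b'_def)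
    qed
  qed
qed

section \<open>Moebius transformations of the upper half-plane\<close>

lemma moebius_denominator_nonzero:
  fixes c d :: int
  assumes "Im z > 0" "c \<noteq> 0 \<or> d \<noteq> 0"
  shows "of_int c * z + of_int d \<noteq> 0"
  using assms by (auto simp: complex_eq_iff)

lemma moebius_Im:
  fixes a b c d :: int
  assumes "Im z > 0" "c \<noteq> 0 \<or> d \<noteq> 0"
  shows "Im ((of_int a * z + of_int b) / (of_int c * z + of_int d)) =
     of_int (a * d - b * c) * Im z / (norm (of_int c * z + of_int d))\<^sup>2"
proof -
  have "(norm (of_int c * z + of_int d))\<^sup>2 = (of_int c * Re z + of_int d)\<^sup>2 + (of_int c * Im z)\<^sup>2"
    by (simp add: cmod_power2)
  then show ?thesis
    by (simp add: Im_divide) (simp add: algebra_simps)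
qed

lemma moebius_Im_pos:
  fixes a b c d :: int
  assumes "Im z > 0" "a * d - b * c = 1"
  shows "Im ((of_int a * z + of_int b) / (of_int c * z + of_int d)) > 0"
proof -
  have *: "c \<noteq> 0 \<or> d \<noteq> 0" using assms(2) by auto
  show ?thesis
    unfolding moebius_Im[OF assms(1) *] using moebius_denominator_nonzero[OF assms(1) *] assms by simp
qed

text \<open>One reduction to generators for two families, the Klein forms (k = 1) and the reciprocal
  of eta^24 (k = 12). The pair (r, s) is acted on as a row vector.\<close>

lemma moebius_weight:
  fixes a b c d :: int and F :: "complex \<Rightarrow> complex \<Rightarrow> complex \<Rightarrow> complex"
  assumes det: "a * d - b * c = 1" and z: "Im z > 0"
    and T: "\<And>r s z. Im z > 0 \<Longrightarrow> F r s (z + 1) = F r (r + s) z"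
    and S: "\<And>r s z. Im z > 0 \<Longrightarrow> F r s (- 1 / z) * z ^ k = F s (- r) z"
  shows "F r s ((of_int a * z + of_int b) / (of_int c * z + of_int d)) * (of_int c * z + of_int d) ^ k =
    F (r * of_int a + s * of_int c) (r * of_int b + s * of_int d) z"
proof -
  define g where "g a b c d = (of_int a * z + of_int b) / (of_int c * z + of_int d)" for a b c d :: int
  define j where "j c d = of_int c * z + of_int d" for c d :: int
  have j: "j c d \<noteq> 0" if "a * d - b * c = 1" for a b c d
    using moebius_denominator_nonzero[OF z, of c d] that by (cases "c = 0") (auto simp: j_def)
  have g: "Im (g a b c d) > 0" if "a * d - b * c = 1" for a b c d
    using moebius_Im_pos[OF z that] by (simp add: g_def)
  \<comment> \<open>All \<open>r\<close> and \<open>s\<close> at once, because each generator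
    changes the index pair before the hypothesis for the shorter word is applied.\<close>
  define P where "P a b c d \<longleftrightarrow> (\<forall>r s. F r s (g a b c d) * j c d ^ k =
    F (r * of_int a + s * of_int c) (r * of_int b + s * of_int d) z)" for a b c d
  have "P a b c d"
  proof (rule sl2_induct[OF det])
    show "P 1 0 0 1" by (simp add: P_def g_def j_def)
  next
    fix a b c d :: int assume det: "a * d - b * c = 1" and P: "P a b c d"
    have nz: "j c d \<noteq> 0" "j a b \<noteq> 0" using j[OF det] j[of "- c" b "- d" a] det by (simp_all add: mult_ac)
    have "g (- c) (- d) a b = - 1 / g a b c d"
      by (simp add: g_def)
    moreover have "j a b = g a b c d * j c d"
      using nz by (simp add: g_def j_def)
    ultimately have "F r s (g (- c) (- d) a b) * j a b ^ k = F s (- r) (g a b c d) * j c d ^ k" for r s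
      using S[OF g[OF det], of r s] by (simp add: power_mult_distrib)
    then show "P (- c) (- d) a b"
      using P by (simp add: P_def algebra_simps)
  next
    fix a b c d :: int assume det: "a * d - b * c = 1" and P: "P a b c d"
    have "g (a + c) (b + d) c d = g a b c d + 1"
      using j[OF det] by (simp add: g_def j_def field_simps)
    then have "F r s (g (a + c) (b + d) c d) = F r (r + s) (g a b c d)" for r s
      using T[OF g[OF det]] by simp
    then show "P (a + c) (b + d) c d"
      using P by (simp add: P_def algebra_simps)
  next
    fix a b c d :: int assume det: "a * d - b * c = 1" and P: "P a b c d"
    have det': "(a - c) * d - (b - d) * c = 1" using det by (simp add: algebra_simps)
    have "g a b c d = g (a - c) (b - d) c d + 1"
      using j[OF det] by (simp add: g_def j_def field_simps)
    then have "F r s (g a b c d) = F r (r + s) (g (a - c) (b - d) c d)" for r s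
      using T[OF g[OF det']] by simp
    then have "F r s (g (a - c) (b - d) c d) = F r (s - r) (g a b c d)" for r s
      by simp
    then show "P (a - c) (b - d) c d"
      using P by (simp add: P_def algebra_simps)
  qed
  then show ?thesis by (simp add: P_def g_def j_def)
qed

lemma klein_form_moebius:
  fixes a b c d :: int
  assumes det: "a * d - b * c = 1" and z: "Im z > 0"
  shows "klein_form r s ((of_int a * z + of_int b) / (of_int c * z + of_int d)) * (of_int c * z + of_int d) =
    klein_form (r * of_int a + s * of_int c) (r * of_int b + s * of_int d) z"
proof -
  have "klein_form r s (- 1 / z) * z ^ 1 = klein_form s (- r) z" if "Im z > 0" for r s z
    using klein_form_S[OF that, of r s] that by auto
  from moebius_weight[where F = klein_form and k = 1, OF det z klein_form_T this] show ?thesis by simp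
qed

section \<open>The Dedekind eta function\<close>

lemma e2pi_sum: "e2pi (\<Sum>i\<in>A. f i) = (\<Prod>i\<in>A. e2pi (f i))"
  by (induction A rule: infinite_finite_induct) (auto simp: e2pi_add)

lemma dedekind_eta_eq: "dedekind_eta z = e2pi (z / 24) * qpoch 1 (e2pi z)"
proof -
  have "exp (2 * of_real pi * \<i> * of_nat (Suc n) * z) = e2pi z ^ Suc n" for n
    unfolding e2pi_power by (simp add: e2pi_def mult_ac)
  moreover have "exp (2 * of_real pi * \<i> * z / 24) = e2pi (z / 24)"
    by (simp add: e2pi_def)
  ultimately show ?thesis
    unfolding dedekind_eta_def qpoch_def by (simp only: mult_1_right)
qed

lemma qpoch_1_e2pi_nonzero: "Im z > 0 \<Longrightarrow> qpoch 1 (e2pi z) \<noteq> 0"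
  by (rule qpoch_nonzero'[OF norm_e2pi_less_1]) auto

lemma dedekind_eta_nonzero: "Im z > 0 \<Longrightarrow> dedekind_eta z \<noteq> 0"
  by (simp add: dedekind_eta_eq qpoch_1_e2pi_nonzero)

lemma dedekind_eta_holomorphic: "dedekind_eta holomorphic_on {z. Im z > 0}"
proof -
  have "(\<lambda>z. e2pi (z / 24) * qpoch 1 (e2pi z)) holomorphic_on {z. Im z > 0}"
    by (intro holomorphic_intros qpoch_holomorphic open_halfspace_Im_gt) (auto simp: norm_e2pi_less_1)
  then show ?thesis by (simp add: dedekind_eta_eq[abs_def])
qed

text \<open>The division points j z / p, one from each pair j, -j modulo p. For odd p this is, up to
  sign, eta(z/p) / eta(z)^p.\<close>

definition klein_prod :: "nat \<Rightarrow> complex \<Rightarrow> complex" where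
  "klein_prod p z = (\<Prod>j=1..p div 2. klein_form (of_nat j / of_nat p) 0 z)"

lemma sum_linear_squares:
  fixes a b :: complex
  shows "(\<Sum>j=1..n. of_nat j ^ 2 * a + of_nat j * b) =
    of_nat n * of_nat (n + 1) * of_nat (2 * n + 1) / 6 * a + of_nat n * of_nat (n + 1) / 2 * b"
  by (induction n) (auto simp: field_simps power2_eq_square)

lemma klein_form_div:
  assumes z: "Im z > 0" and p: "p > 0"
  defines "t \<equiv> e2pi (z / of_nat p)"
  shows "klein_form (of_nat j / of_nat p) 0 z =
    - e2pi (of_nat j ^ 2 * (z / (2 * of_nat p ^ 2)) + of_nat j * (- z / (2 * of_nat p))) *
    ((1 - t ^ j) * qpoch (t ^ j) (e2pi z) * qpoch (inverse (t ^ j)) (e2pi z)) / (qpoch 1 (e2pi z))\<^sup>2"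
proof -
  define u where "u = of_nat j / of_nat p * z"
  have tj: "t ^ j = e2pi u" "inverse (t ^ j) = e2pi (- u)"
    by (simp_all add: t_def e2pi_power u_def flip: e2pi_minus)
  have "e2pi (u / 2) = e2pi (- u / 2) * e2pi u"
    unfolding e2pi_add[symmetric] by simp
  then have 1: "e2pi (u / 2) - e2pi (- u / 2) = - e2pi (- u / 2) * (1 - t ^ j)"
    by (simp add: tj algebra_simps)
  have 2: "e2pi (of_nat j / of_nat p * u / 2) * e2pi (- u / 2) =
      e2pi (of_nat j ^ 2 * (z / (2 * of_nat p ^ 2)) + of_nat j * (- z / (2 * of_nat p)))"
    unfolding e2pi_add[symmetric] u_def using p
    by (intro arg_cong[where f = e2pi]) (simp add: field_simps power2_eq_square)
  show ?thesis
    unfolding klein_form_def theta_def 2[symmetric] u_def[symmetric] add_0_right 1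
    unfolding tj by (simp add: e2pi_minus)
qed

text \<open>With t = e2pi (z/p), the factors 1 - t^m are sorted by m modulo p. Residue 0 gives the
  product of eta(z), and residues j and -j together give the theta product at j z / p. Each of the
  (p - 1)/2 theta functions has the square of the product of eta(z) as denominator, whence the
  exponent p.\<close>

lemma dedekind_eta_div:
  assumes z: "Im z > 0" and p: "odd p"
  shows "dedekind_eta (z / of_nat p) = (-1) ^ (p div 2) * dedekind_eta z ^ p * klein_prod p z"
proof -
  define n where "n = p div 2"
  have pn: "p = 2 * n + 1" using p by (auto simp: n_def)
  define t where "t = e2pi (z / of_nat p)"
  define q where "q = e2pi z"
  have t0: "t \<noteq> 0" by (simp add: t_def)
  have p0: "(of_nat p :: complex) \<noteq> 0" using pn by (simp del: of_nat_Suc)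
  then have q: "q = t ^ p" by (simp add: q_def t_def e2pi_power)
  have "Im (z / of_nat p) > 0" using z pn by (simp add: Im_divide_of_nat)
  then have t1: "norm t < 1" unfolding t_def by (rule norm_e2pi_less_1)
  have q1: "norm q < 1" unfolding q_def by (rule norm_e2pi_less_1[OF z])
  define Q where "Q = qpoch 1 q"
  have Q: "Q \<noteq> 0" unfolding Q_def q_def by (rule qpoch_1_e2pi_nonzero[OF z])
  define f where "f r = qpoch (inverse (t ^ r)) q" for r
  have "qpoch 1 t = (\<Prod>r<p. f r)"
    using qpoch_blocks[OF t1 t0, of p 1] pn by (simp add: f_def q)
  also have "{..<p} = insert 0 ({1..n} \<union> {n+1..2*n})"
    using pn by auto
  also have "(\<Prod>r\<in>\<dots>. f r) = f 0 * ((\<Prod>j=1..n. f j) * (\<Prod>j=n+1..2*n. f j))"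
    by (subst prod.insert) (auto simp: prod.union_disjoint)
  also have "f 0 = Q" by (simp add: f_def Q_def)
  \<comment> \<open>The upper half is reflected by j -> p - j; splitting off the first factor turns
    the inverse power into a positive one.\<close>
  also have "(\<Prod>j=n+1..2*n. f j) = (\<Prod>j=1..n. (1 - t ^ j) * qpoch (t ^ j) q)"
  proof (rule prod.reindex_bij_witness[where i = "\<lambda>j. p - j" and j = "\<lambda>j. p - j"])
    fix j assume j: "j \<in> {n+1..2*n}"
    then have "t ^ p = t ^ j * t ^ (p - j)"
      using pn by (simp flip: power_add)
    then have "q * inverse (t ^ j) = t ^ (p - j)"
      using t0 by (simp add: q)
    then show "(1 - t ^ (p - j)) * qpoch (t ^ (p - j)) q = f j"
      using qpoch_Suc[OF q1, of "inverse (t ^ j)"] by (simp add: f_def)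
  qed (use pn in auto)
  finally have blocks: "qpoch 1 t = Q * (\<Prod>j=1..n. (1 - t ^ j) * qpoch (t ^ j) q * f j)"
    by (simp add: prod.distrib mult_ac)
  define g where "g j = of_nat j ^ 2 * (z / (2 * of_nat p ^ 2)) + of_nat j * (- z / (2 * of_nat p))" for j
  have "klein_prod p z = (\<Prod>j=1..n. (- e2pi (g j) / Q\<^sup>2) * ((1 - t ^ j) * qpoch (t ^ j) q * f j))"
    unfolding klein_prod_def n_def[symmetric]
    by (intro prod.cong refl, subst klein_form_div[OF z])
       (use pn in \<open>auto simp: g_def Q_def q_def t_def f_def\<close>)
  also have "\<dots> = (\<Prod>j=1..n. (-1) * inverse (Q\<^sup>2) * e2pi (g j)) * (\<Prod>j=1..n. (1 - t ^ j) * qpoch (t ^ j) q * f j)"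
    unfolding prod.distrib[symmetric] by (simp add: field_simps)
  also have "(\<Prod>j=1..n. (-1) * inverse (Q\<^sup>2) * e2pi (g j)) = (-1) ^ n * inverse (Q ^ (2 * n)) * e2pi (\<Sum>j=1..n. g j)"
    by (simp only: prod.distrib e2pi_sum) (simp add: power_mult power_inverse)
  also have "(\<Sum>j=1..n. g j) = - (of_nat n * of_nat (n + 1) / (6 * of_nat p)) * z"
  proof -
    show ?thesis
      unfolding g_def sum_linear_squares pn[symmetric] using p0 by (simp add: field_simps power2_eq_square)
  qed
  finally have K: "klein_prod p z * Q * Q ^ (2 * n) = (-1) ^ n * e2pi (- (of_nat n * of_nat (n + 1) / (6 * of_nat p)) * z) * qpoch 1 t"
    using Q by (simp add: blocks)
  \<comment> \<open>The leading exponents balance: n(n + 1) = (p^2 - 1)/4, so p/24 - (p^2 - 1)/(24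
    p) = 1/(24 p).\<close>
  have e: "e2pi (of_nat p * (z / 24)) * e2pi (- (of_nat n * of_nat (n + 1) / (6 * of_nat p)) * z) = e2pi (z / of_nat p / 24)"
  proof -
    have n: "of_nat n = (of_nat p - 1) / (2 :: complex)"
      using pn by simp
    show ?thesis
      unfolding e2pi_add[symmetric] of_nat_add of_nat_1 n using p0
      by (intro arg_cong[where f = e2pi]) (simp add: field_simps power2_eq_square)
  qed
  have "dedekind_eta z ^ p = e2pi (of_nat p * (z / 24)) * (Q * Q ^ (2 * n))"
  proof -
    have "Q * Q ^ (2 * n) = Q ^ p" by (simp add: pn)
    then show ?thesis
      by (simp add: dedekind_eta_eq Q_def q_def power_mult_distrib e2pi_power)
  qed
  then have "(-1) ^ n * dedekind_eta z ^ p * klein_prod p z =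
      (-1) ^ n * e2pi (of_nat p * (z / 24)) * (klein_prod p z * Q * Q ^ (2 * n))"
    by simp
  also have "\<dots> = ((-1) ^ n * (-1) ^ n) * (e2pi (of_nat p * (z / 24)) * e2pi (- (of_nat n * of_nat (n + 1) / (6 * of_nat p)) * z)) * qpoch 1 t"
    unfolding K by simp
  also have "\<dots> = e2pi (z / of_nat p / 24) * qpoch 1 t"
    unfolding e by (simp flip: power_add mult_2)
  finally show ?thesis
    by (simp add: dedekind_eta_eq t_def n_def)
qed

section \<open>The transformation of eta^24, by means of the three half periods\<close>

lemma qpoch_square:
  assumes "norm q < 1"
  shows "qpoch x q * qpoch (- x) q = qpoch (x\<^sup>2) (q\<^sup>2)"
proof -
  have "norm (q\<^sup>2) < 1" using assms by (simp add: norm_power power_less_one_iff)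
  then have "(\<lambda>M. \<Prod>n<M. 1 - (q\<^sup>2) ^ Suc n * x\<^sup>2) \<longlonglongrightarrow> qpoch (x\<^sup>2) (q\<^sup>2)"
    by (rule qpoch_tendsto)
  moreover have "(\<Prod>n<M. 1 - (q\<^sup>2) ^ Suc n * x\<^sup>2) = (\<Prod>n<M. 1 - q ^ Suc n * x) * (\<Prod>n<M. 1 - q ^ Suc n * (- x))" for M
    unfolding prod.distrib[symmetric]
    by (intro prod.cong refl) (simp add: algebra_simps power2_eq_square power_mult_distrib)
  moreover have "(\<lambda>M. (\<Prod>n<M. 1 - q ^ Suc n * x) * (\<Prod>n<M. 1 - q ^ Suc n * (- x))) \<longlonglongrightarrow> qpoch x q * qpoch (- x) q"
    by (intro tendsto_mult qpoch_tendsto assms)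
  ultimately show ?thesis by (auto intro: LIMSEQ_unique)
qed

text \<open>With q = t^2 the first two products combine to the product of 1 - q^(2n-1) and the third
  is the product of 1 + q^n. This is Euler's identity behind partitions into odd and into distinct
  parts.\<close>

lemma qpoch_euler:
  assumes t: "norm t < 1" "t \<noteq> 0"
  shows "qpoch (inverse t) (t\<^sup>2) * qpoch (- inverse t) (t\<^sup>2) * qpoch (- 1) (t\<^sup>2) = 1"
proof -
  define q where "q = t\<^sup>2"
  have q: "norm q < 1" "q \<noteq> 0" using t by (simp_all add: q_def norm_power power_less_one_iff)
  have q2: "norm (q\<^sup>2) < 1" using q by (simp add: norm_power power_less_one_iff)
  have "qpoch (inverse t) q * qpoch (- inverse t) q = qpoch (inverse q) (q\<^sup>2)"
    unfolding qpoch_square[OF q(1)] by (simp add: q_def power_inverse)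
  moreover have "qpoch 1 (q\<^sup>2) * qpoch (inverse q) (q\<^sup>2) = qpoch 1 q"
    using qpoch_blocks[OF q, of 2 1] by (simp add: numeral_2_eq_2)
  moreover have "qpoch 1 q * qpoch (- 1) q = qpoch 1 (q\<^sup>2)"
    using qpoch_square[OF q(1), of 1] by simp
  moreover have "qpoch 1 q \<noteq> 0" "qpoch 1 (q\<^sup>2) \<noteq> 0"
    using qpoch_nonzero'[OF q(1), of 1] qpoch_nonzero'[OF q2, of 1] by auto
  ultimately have "(qpoch (inverse t) q * qpoch (- inverse t) q) * qpoch (- 1) q * (qpoch 1 q * qpoch 1 (q\<^sup>2)) = 1 * (qpoch 1 q * qpoch 1 (q\<^sup>2))"
    by (metis mult.assoc mult.commute mult.left_neutral)
  then show ?thesis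
    using \<open>qpoch 1 q \<noteq> 0\<close> \<open>qpoch 1 (q\<^sup>2) \<noteq> 0\<close> by (simp add: q_def)
qed

lemma klein_form_half_0:
  assumes "Im z > 0"
  shows "klein_form (1 / 2) 0 z = - e2pi (- z / 8) * (qpoch (inverse (e2pi (z / 2))) (e2pi z))\<^sup>2 / (qpoch 1 (e2pi z))\<^sup>2"
proof -
  define t where "t = e2pi (z / 2)"
  have t: "e2pi z = t\<^sup>2" "t \<noteq> 0" by (simp_all add: t_def e2pi_power)
  have "norm (e2pi z) < 1" by (rule norm_e2pi_less_1[OF assms])
  then have "qpoch (inverse t) (t\<^sup>2) = (1 - t\<^sup>2 * inverse t) * qpoch (t\<^sup>2 * inverse t) (t\<^sup>2)"
    unfolding t by (rule qpoch_Suc)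
  also have "t\<^sup>2 * inverse t = t" using t by (simp add: power2_eq_square)
  finally have *: "(1 - t) * qpoch t (t\<^sup>2) = qpoch (inverse t) (t\<^sup>2)" by simp
  have "klein_form (1 / 2) 0 z = - e2pi (z / 8 + - z / 4) * ((1 - t) * qpoch t (t\<^sup>2) * qpoch (inverse t) (t\<^sup>2)) / (qpoch 1 (t\<^sup>2))\<^sup>2"
    using klein_form_div[OF assms, of 2 1] by (simp add: t(1) flip: t_def)
  also have "z / 8 + - z / 4 = - z / 8" by simp
  finally show ?thesis unfolding * t_def[symmetric] t(1) by (simp add: power2_eq_square)
qed

lemma klein_form_0_half:
  "klein_form 0 (1 / 2) z = (e2pi (1 / 4) - e2pi (- 1 / 4)) * (qpoch (- 1) (e2pi z))\<^sup>2 / (qpoch 1 (e2pi z))\<^sup>2"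
  by (simp add: klein_form_def theta_def e2pi_minus power2_eq_square)

text \<open>The three nonzero half periods; S permutes them up to sign and lattice
  translation.\<close>

definition klein_half_prod :: "complex \<Rightarrow> complex" where
  "klein_half_prod z = klein_form (1 / 2) 0 z * klein_form 0 (1 / 2) z * klein_form (1 / 2) (1 / 2) z"

text \<open>Each of the three Klein forms is, up to an exponential and a constant, the square of a
  q-product over the square of the product of eta; by Euler's identity the three q-products multiply
  to 1. The constant is e2pi (-1/8) (e2pi (1/4) - e2pi (-1/4)).\<close>

lemma dedekind_eta_6:
  assumes z: "Im z > 0"
  shows "dedekind_eta z ^ 6 * klein_half_prod z = e2pi (1 / 8) - e2pi (- 3 / 8)"
proof -
  define t where "t = e2pi (z / 2)"
  have t: "e2pi z = t\<^sup>2" "t \<noteq> 0" by (simp_all add: t_def e2pi_power)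
  have "Im (z / 2) > 0" using z by simp
  then have t1: "norm t < 1" unfolding t_def by (rule norm_e2pi_less_1)
  define Q where "Q = qpoch 1 (t\<^sup>2)"
  have Q: "Q \<noteq> 0" using qpoch_1_e2pi_nonzero[OF z] by (simp add: Q_def t)
  have t': "e2pi ((z + 1) / 2) = - t" "e2pi (z + 1) = t\<^sup>2"
    by (simp_all add: add_divide_distrib e2pi_add t_def e2pi_power)
  \<comment> \<open>The translation z -> z + 1 takes the index (1/2, 0) to (1/2, 1/2), so the first
    evaluation also yields the third.\<close>
  have k3: "klein_form (1 / 2) (1 / 2) z = - e2pi (- (z + 1) / 8) * (qpoch (- inverse t) (t\<^sup>2))\<^sup>2 / Q\<^sup>2"
    using klein_form_half_0[of "z + 1"] z unfolding klein_form_T t' by (simp add: Q_def)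
  have k1: "klein_form (1 / 2) 0 z = - e2pi (- z / 8) * (qpoch (inverse t) (t\<^sup>2))\<^sup>2 / Q\<^sup>2"
    using klein_form_half_0[OF z] unfolding t(1) t_def[symmetric] by (simp add: Q_def)
  have k2: "klein_form 0 (1 / 2) z = (e2pi (1 / 4) - e2pi (- 1 / 4)) * (qpoch (- 1) (t\<^sup>2))\<^sup>2 / Q\<^sup>2"
    using klein_form_0_half[of z] unfolding t(1) by (simp add: Q_def)
  have "klein_half_prod z * Q ^ 6 = (e2pi (- z / 8) * e2pi (- (z + 1) / 8)) * (e2pi (1 / 4) - e2pi (- 1 / 4)) *
      (qpoch (inverse t) (t\<^sup>2) * qpoch (- inverse t) (t\<^sup>2) * qpoch (- 1) (t\<^sup>2))\<^sup>2"
    unfolding klein_half_prod_def k1 k2 k3 using Q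
    by (simp add: power_mult_distrib field_simps power2_eq_square eval_nat_numeral)
  also have "e2pi (- z / 8) * e2pi (- (z + 1) / 8) = e2pi (- z / 4) * e2pi (- 1 / 8)"
    unfolding e2pi_add[symmetric] by (intro arg_cong[where f = e2pi]) (simp add: field_simps)
  finally have "klein_half_prod z * Q ^ 6 = e2pi (- z / 4) * e2pi (- 1 / 8) * (e2pi (1 / 4) - e2pi (- 1 / 4))"
    by (simp add: qpoch_euler[OF t1 t(2)])
  note * = this
  have "dedekind_eta z ^ 6 = e2pi (z / 4) * Q ^ 6"
    by (simp add: dedekind_eta_eq power_mult_distrib e2pi_power Q_def t(1))
  then have "dedekind_eta z ^ 6 * klein_half_prod z = e2pi (z / 4) * (klein_half_prod z * Q ^ 6)"
    by (simp only: mult_ac)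
  also have "\<dots> = (e2pi (z / 4) * e2pi (- z / 4)) *
      (e2pi (- 1 / 8) * e2pi (1 / 4) - e2pi (- 1 / 8) * e2pi (- 1 / 4))"
    unfolding * by (simp only: right_diff_distrib mult.assoc)
  finally show ?thesis unfolding e2pi_add[symmetric] by simp
qed

text \<open>S exchanges the first two indices up to sign and sends (1/2, 1/2) to (1/2, -1/2). The
  fourth power kills the resulting factor e2pi (1/4) = i, and this is what leads from eta^6 to
  eta^24.\<close>

lemma klein_half_prod_S:
  assumes z: "Im z > 0"
  shows "klein_half_prod (- 1 / z) ^ 4 * z ^ 12 = klein_half_prod z ^ 4"
proof -
  have nz: "z \<noteq> 0" using z by auto
  have 1: "klein_form 0 (- (1 / 2)) z = - klein_form 0 (1 / 2) z"
    using klein_form_minus[of 0 "1/2" z] by simp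
  have 2: "klein_form (1 / 2) (1 / 2) z = - e2pi (1 / 4) * klein_form (1 / 2) (- (1 / 2)) z"
    using klein_form_snd_plus_1[of "1/2" "- (1/2)" z] by simp
  have "e2pi (1 / 4) ^ 4 = 1" by (simp add: e2pi_power)
  moreover have "(e2pi (1 / 4) * klein_half_prod (- 1 / z)) * z ^ 3 = klein_half_prod z"
    unfolding klein_half_prod_def klein_form_S[OF z] 2
    using nz 1 by (simp add: field_simps power3_eq_cube)
  then have "((e2pi (1 / 4) * klein_half_prod (- 1 / z)) * z ^ 3) ^ 4 = klein_half_prod z ^ 4" by simp
  ultimately show ?thesis by (simp add: power_mult_distrib flip: power_mult)
qed

lemma dedekind_eta_24_S:
  assumes z: "Im z > 0"
  shows "dedekind_eta (- 1 / z) ^ 24 = z ^ 12 * dedekind_eta z ^ 24"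
proof -
  define C where "C = e2pi (1 / 8) - e2pi (- 3 / 8)"
  have C: "dedekind_eta z ^ 24 * klein_half_prod z ^ 4 = C ^ 4" if "Im z > 0" for z
  proof -
    have "(dedekind_eta z ^ 6 * klein_half_prod z) ^ 4 = C ^ 4"
      unfolding dedekind_eta_6[OF that] C_def ..
    then show ?thesis by (simp add: power_mult_distrib flip: power_mult)
  qed
  have "e2pi (1 / 8) = - e2pi (- 3 / 8)"
    using e2pi_add[of "- 3 / 8" "1 / 2"] by simp
  then have "C \<noteq> 0" by (simp add: C_def)
  have "dedekind_eta (- 1 / z) ^ 24 * klein_half_prod (- 1 / z) ^ 4 = z ^ 12 * dedekind_eta z ^ 24 * klein_half_prod (- 1 / z) ^ 4"
    using C[OF z] C[OF Im_minus_inverse_pos[OF z]] klein_half_prod_S[OF z] by (metis mult.commute mult.left_commute)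
  moreover have "klein_half_prod (- 1 / z) \<noteq> 0"
    using C[OF Im_minus_inverse_pos[OF z]] \<open>C \<noteq> 0\<close> by auto
  ultimately show ?thesis by simp
qed

lemma dedekind_eta_24_moebius:
  fixes a b c d :: int
  assumes det: "a * d - b * c = 1" and z: "Im z > 0"
  shows "dedekind_eta ((of_int a * z + of_int b) / (of_int c * z + of_int d)) ^ 24 =
    (of_int c * z + of_int d) ^ 12 * dedekind_eta z ^ 24"
proof -
  \<comment> \<open>The reciprocal has weight -12, the sign that \<open>moebius_weight\<close>
    expects; the indices are dummies.\<close>
  define F where "F r s z = inverse (dedekind_eta z ^ 24)" for r s z :: complex
  have T: "F r s (z + 1) = F r (r + s) z" for r s z
  proof -
    have "dedekind_eta (z + 1) ^ 24 = dedekind_eta z ^ 24"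
      by (simp add: dedekind_eta_eq power_mult_distrib e2pi_power e2pi_add add_divide_distrib)
    then show ?thesis by (simp add: F_def)
  qed
  have S: "F r s (- 1 / z) * z ^ 12 = F s (- r) z" if "Im z > 0" for r s z
  proof -
    have "z \<noteq> 0" using that by auto
    then show ?thesis using dedekind_eta_24_S[OF that] by (simp add: F_def)
  qed
  have "(of_int c * z + of_int d) ^ 12 \<noteq> 0"
    using moebius_denominator_nonzero[OF z, of c d] det by (cases "c = 0") auto
  then show ?thesis
    using moebius_weight[where F = F and k = 12, OF det z T S]
      dedekind_eta_nonzero[OF z] dedekind_eta_nonzero[OF moebius_Im_pos[OF z det]]
    by (simp add: F_def field_simps)
qed

section \<open>Gauss's lemma and the multipliers of the products of Klein forms\<close>

lemma odd_shift_sign: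
  fixes X :: "int \<Rightarrow> complex"
  assumes "\<And>j. X (j + p) = - X j"
  shows "X (j + p * m) = (-1) ^ nat \<bar>m\<bar> * X j"
proof (induction m rule: int_induct[where k = 0])
  case (step1 i)
  have "nat \<bar>i + 1\<bar> = Suc (nat \<bar>i\<bar>)" using step1(1) by simp
  moreover have "j + p * (i + 1) = j + p * i + p" by (simp add: algebra_simps)
  ultimately show ?case by (simp only: assms step1(2) power_Suc) simp
next
  case (step2 i)
  have "nat \<bar>i - 1\<bar> = Suc (nat \<bar>i\<bar>)" using step2(1) by simp
  moreover have "X (j + p * i) = - X (j + p * (i - 1))"
    using assms[of "j + p * (i - 1)"] by (simp add: algebra_simps)
  ultimately show ?case using step2(2) by (simp only: power_Suc) simp
qed simp

text \<open>As in Gauss's lemma, multiplication by \<open>a\<close> permutes \<open>1, \<dots>, (p - 1) / 2\<close> up to signs modulo \<open>p\<close>.\<close>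

lemma gauss_sign:
  fixes a :: int and p n :: nat
  assumes pn: "p = 2 * n + 1" and cop: "coprime a (int p)"
  obtains \<theta> :: complex where "\<theta> = 1 \<or> \<theta> = -1"
    "\<And>X :: int \<Rightarrow> complex. (\<And>j. X (j + int p) = - X j) \<Longrightarrow> (\<And>j. X (- j) = - X j) \<Longrightarrow>
       (\<Prod>j=1..n. X (int j * a)) = \<theta> * (\<Prod>j=1..n. X (int j))"
proof -
  \<comment> \<open>The sign \<open>s\<close> has to work for all odd, antiperiodic \<open>X\<close>
    simultaneously, so that the final sign can be chosen before \<open>X\<close>.\<close>
  define good where "good j i s \<longleftrightarrow> i \<in> {1..n} \<and> (s = 1 \<or> s = -1) \<and>
      (int p dvd int j * a - int i \<or> int p dvd int j * a + int i) \<and>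
      (\<forall>X :: int \<Rightarrow> complex. (\<forall>j. X (j + int p) = - X j) \<longrightarrow> (\<forall>j. X (- j) = - X j) \<longrightarrow> X (int j * a) = s * X (int i))"
    for j i :: nat and s :: complex
  have ex: "\<exists>i s. good j i s" if j: "j \<in> {1..n}" for j
  proof -
    define r m where "r = (int j * a) mod int p" and "m = (int j * a) div int p"
    have ja: "int j * a = r + int p * m" by (simp add: r_def m_def)
    have sgn: "(-1) ^ k = (1::complex) \<or> (-1) ^ k = (-1::complex)" for k :: nat
      by (cases "even k") auto
    have r: "0 \<le> r" "r < int p" using pn by (simp_all add: r_def)
    have "r \<noteq> 0"
    proof
      assume "r = 0"
      then have "int p dvd int j * a" by (simp add: r_def dvd_eq_mod_eq_0)
      then have "int p dvd int j" using cop by (simp add: coprime_dvd_mult_left_iff coprime_commute)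
      then have "p dvd j" by simp
      then show False using j pn by (auto dest: dvd_imp_le)
    qed
    show ?thesis
    proof (cases "r \<le> int n")
      case True
      have "good j (nat r) ((-1) ^ nat \<bar>m\<bar>)"
        unfolding good_def
      proof (intro conjI allI impI)
        show "int p dvd int j * a - int (nat r) \<or> int p dvd int j * a + int (nat r)"
          using r by (simp add: ja)
        fix X :: "int \<Rightarrow> complex" assume "\<forall>j. X (j + int p) = - X j"
        then have "X (r + int p * m) = (-1) ^ nat \<bar>m\<bar> * X r"
          by (intro odd_shift_sign) auto
        then show "X (int j * a) = (-1) ^ nat \<bar>m\<bar> * X (int (nat r))"
          using r by (simp only: ja) simp
      qed (use r \<open>r \<noteq> 0\<close> True sgn in auto)
      then show ?thesis by blast
    next
      case False
      have "good j (nat (int p - r)) (- ((-1) ^ nat \<bar>m + 1\<bar>))"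
        unfolding good_def
      proof (intro conjI allI impI)
        show "int p dvd int j * a - int (nat (int p - r)) \<or> int p dvd int j * a + int (nat (int p - r))"
          using r by (simp add: ja)
        fix X :: "int \<Rightarrow> complex" assume X: "\<forall>j. X (j + int p) = - X j" "\<forall>j. X (- j) = - X j"
        \<comment> \<open>A residue above (p - 1)/2 is replaced by its negative representative r -
          p, which raises the quotient to m + 1.\<close>
        have "int j * a = - (int p - r) + int p * (m + 1)" using ja by (simp add: algebra_simps)
        then have "X (int j * a) = X (- (int p - r) + int p * (m + 1))" by (rule arg_cong)
        also have "\<dots> = (-1) ^ nat \<bar>m + 1\<bar> * X (- (int p - r))"
          using X(1) by (intro odd_shift_sign) auto
        also have "X (- (int p - r)) = - X (int p - r)" using X(2) by blast
        finally show "X (int j * a) = - ((-1) ^ nat \<bar>m + 1\<bar>) * X (int (nat (int p - r)))"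
          using r by simp
      qed (use r False pn sgn[of "nat \<bar>m + 1\<bar>"] in auto)
      then show ?thesis by blast
    qed
  qed
  then obtain \<pi> \<sigma> where good: "\<And>j. j \<in> {1..n} \<Longrightarrow> good j (\<pi> j) (\<sigma> j)" by metis
  have inj: "inj_on \<pi> {1..n}"
  proof (rule inj_onI)
    fix i j assume ij: "i \<in> {1..n}" "j \<in> {1..n}" "\<pi> i = \<pi> j"
    have "int p dvd int i * a - int j * a \<or> int p dvd int i * a + int j * a"
      using good[OF ij(1)] good[OF ij(2)] ij(3) unfolding good_def
      by (smt (verit) dvd_add dvd_diff)
    then have "int p dvd (int i - int j) * a \<or> int p dvd (int i + int j) * a"
      by (simp add: algebra_simps)
    then have "int p dvd int i - int j \<or> int p dvd int i + int j"
      using cop by (simp add: coprime_dvd_mult_left_iff coprime_commute)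
    then show "i = j"
    proof
      assume "int p dvd int i - int j"
      then show ?thesis using ij pn dvd_imp_le_int[of "int i - int j" "int p"] by fastforce
    next
      assume "int p dvd int i + int j"
      then have "int p \<le> int i + int j" using ij by (intro zdvd_imp_le) auto
      then show ?thesis using ij pn by auto
    qed
  qed
  have "\<pi> ` {1..n} = {1..n}"
    by (rule endo_inj_surj[OF _ _ inj]) (use good in \<open>auto simp: good_def\<close>)
  define \<theta> where "\<theta> = (\<Prod>j=1..n. \<sigma> j)"
  have "\<theta> = 1 \<or> \<theta> = -1"
  proof -
    have "A \<subseteq> {1..n} \<Longrightarrow> (\<Prod>j\<in>A. \<sigma> j) = 1 \<or> (\<Prod>j\<in>A. \<sigma> j) = -1" for A
    proof (induction A rule: infinite_finite_induct)
      case (insert x A)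
      then show ?case using good[of x] by (auto simp: good_def)
    qed auto
    then show ?thesis by (auto simp: \<theta>_def)
  qed
  moreover have "(\<Prod>j=1..n. X (int j * a)) = \<theta> * (\<Prod>j=1..n. X (int j))"
    if X: "\<And>j. X (j + int p) = - X j" "\<And>j. X (- j) = - X j" for X :: "int \<Rightarrow> complex"
  proof -
    have "(\<Prod>j=1..n. X (int j * a)) = (\<Prod>j=1..n. \<sigma> j * X (int (\<pi> j)))"
      by (intro prod.cong refl) (use good X in \<open>auto simp: good_def\<close>)
    also have "\<dots> = \<theta> * (\<Prod>j=1..n. X (int (\<pi> j)))"
      by (simp add: prod.distrib \<theta>_def)
    also have "(\<Prod>j=1..n. X (int (\<pi> j))) = (\<Prod>j\<in>\<pi> ` {1..n}. X (int j))"
      unfolding prod.reindex[OF inj] o_def ..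
    finally show ?thesis unfolding \<open>\<pi> ` {1..n} = {1..n}\<close> .
  qed
  ultimately show ?thesis by (rule that)
qed

text \<open>The sign is obtained before b, c, d and z, so the same one serves at z and at z / p2.
  With upper right entry p b the index (j/p, 0) goes to (j a/p, j b), and the integer j b is removed
  at the cost of an explicit root of unity.\<close>

lemma klein_prod_moebius:
  fixes a :: int
  assumes p: "odd p" and cop: "coprime a (int p)"
  obtains \<theta> :: complex where "\<theta> = 1 \<or> \<theta> = -1"
    "\<And>(b :: int) (c :: int) (d :: int) z. Im z > 0 \<Longrightarrow> a * d - int p * b * c = 1 \<Longrightarrow>
      klein_prod p ((of_int a * z + of_int (int p * b)) / (of_int c * z + of_int d)) *
        (of_int c * z + of_int d) ^ (p div 2) =
      e2pi (of_int (b * (a + 3)) * of_nat ((p div 2) * (p div 2 + 1)) / 12) * \<theta> * klein_prod p z"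
proof -
  define n where "n = p div 2"
  have pn: "p = 2 * n + 1" using p by (auto simp: n_def)
  have p0: "(of_nat p :: complex) \<noteq> 0" using pn by (simp del: of_nat_Suc)
  obtain \<theta> :: complex where \<theta>: "\<theta> = 1 \<or> \<theta> = -1"
    "\<And>X :: int \<Rightarrow> complex. (\<And>j. X (j + int p) = - X j) \<Longrightarrow> (\<And>j. X (- j) = - X j) \<Longrightarrow>
       (\<Prod>j=1..n. X (int j * a)) = \<theta> * (\<Prod>j=1..n. X (int j))"
    using gauss_sign[OF pn cop] by metis
  show ?thesis
  proof (rule that[OF \<theta>(1)])
    fix b c d :: int and z :: complex
    assume z: "Im z > 0" and det: "a * d - int p * b * c = 1"
    define J where "J = of_int c * z + of_int d"
    define g where "g = (of_int a * z + of_int (int p * b)) / J"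
    define X where "X j = klein_form (of_int j / of_nat p) 0 z" for j
    have X1: "X (j + int p) = - X j" for j
      using klein_form_fst_plus_1[OF z, of "of_int j / of_nat p" 0] p0
      by (simp add: X_def add_divide_distrib)
    have X2: "X (- j) = - X j" for j
      using klein_form_minus[of "of_int j / of_nat p" 0 z] by (simp add: X_def)
    \<comment> \<open>The exponent of that root of unity: j b / 2 for the sign (-1)^(j b), plus j b
      (j a / p) / 2.\<close>
    define h where "h j = of_nat j ^ 2 * (of_int (a * b) / (2 * of_nat p)) + of_nat j * (of_int b / 2 :: complex)" for j
    have "klein_form (of_nat j / of_nat p) 0 g * J = e2pi (h j) * X (int j * a)" for j
    proof -
      have "klein_form (of_nat j / of_nat p) 0 g * J =
          klein_form (of_nat j / of_nat p * of_int a) (0 + of_int (int j * b)) z"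
        using klein_form_moebius[OF det z, of "of_nat j / of_nat p" 0] p0 by (simp add: g_def J_def mult_ac)
      also have "\<dots> = (e2pi (of_int (int j * b) / 2) *
          e2pi (of_int (int j * b) * (of_nat j / of_nat p * of_int a) / 2)) * X (int j * a)"
        unfolding klein_form_snd_plus_int e2pi_half_int by (simp add: X_def)
      also have "e2pi (of_int (int j * b) / 2) * e2pi (of_int (int j * b) * (of_nat j / of_nat p * of_int a) / 2) = e2pi (h j)"
        unfolding e2pi_add[symmetric] h_def using p0
        by (intro arg_cong[where f = e2pi]) (simp add: field_simps power2_eq_square)
      finally show ?thesis .
    qed
    then have "(\<Prod>j=1..n. klein_form (of_nat j / of_nat p) 0 g * J) = (\<Prod>j=1..n. e2pi (h j) * X (int j * a))"
      by (intro prod.cong refl)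
    then have "klein_prod p g * J ^ n = (\<Prod>j=1..n. e2pi (h j)) * (\<Prod>j=1..n. X (int j * a))"
      by (simp add: klein_prod_def n_def prod.distrib)
    also have "(\<Prod>j=1..n. X (int j * a)) = \<theta> * klein_prod p z"
      using \<theta>(2)[of X, OF X1 X2] by (simp add: klein_prod_def X_def n_def)
    also have "(\<Prod>j=1..n. e2pi (h j)) = e2pi (\<Sum>j=1..n. h j)"
      by (simp add: e2pi_sum)
    \<comment> \<open>The sum of squares n(n + 1)(2n + 1)/6 contains 2n + 1 = p, which cancels the
      denominator.\<close>
    also have "(\<Sum>j=1..n. h j) = of_int (b * (a + 3)) * of_nat (n * (n + 1)) / 12"
      unfolding h_def sum_linear_squares pn[symmetric] using p0 by (simp add: field_simps)
    finally show "klein_prod p ((of_int a * z + of_int (int p * b)) / (of_int c * z + of_int d)) *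
        (of_int c * z + of_int d) ^ (p div 2) =
      e2pi (of_int (b * (a + 3)) * of_nat ((p div 2) * (p div 2 + 1)) / 12) * \<theta> * klein_prod p z"
      by (simp add: g_def J_def n_def mult_ac)
  qed
qed

section \<open>The double eta quotient\<close>

text \<open>With y = z / p2 this is the quotient of eta(z/p1)/eta(z) by eta(y/p1)/eta(y). The
  formula for eta(z/p) is applied with p1 to z and to y, and then with p2 to the remaining powers of
  eta(y).\<close>

lemma double_eta_quotient_klein:
  assumes z: "Im z > 0" and p1: "odd p1" and p2: "odd p2"
  shows "double_eta_quotient p1 p2 z = klein_prod p1 z /
    (klein_prod p1 (z / of_nat p2) * klein_prod p2 z ^ (2 * (p1 div 2)) *
     dedekind_eta z ^ (4 * (p1 div 2) * (p2 div 2)))"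
    and "klein_prod p1 (z / of_nat p2) \<noteq> 0" and "klein_prod p2 z \<noteq> 0"
proof -
  define n1 n2 where "n1 = p1 div 2" and "n2 = p2 div 2"
  have pn: "p1 = 2 * n1 + 1" "p2 = 2 * n2 + 1" using p1 p2 by (auto simp: n1_def n2_def)
  define y where "y = z / of_nat p2"
  have y: "Im y > 0" using z pn by (simp add: y_def Im_divide_of_nat)
  have "Im (z / of_nat p1) > 0" "Im (y / of_nat p1) > 0"
    using z y pn by (simp_all add: Im_divide_of_nat)
  note nz = this[THEN dedekind_eta_nonzero] z[THEN dedekind_eta_nonzero] y[THEN dedekind_eta_nonzero]
  define s1 s2 :: complex where "s1 = (-1) ^ n1" and "s2 = (-1) ^ n2"
  have s: "s1 \<noteq> 0" "s2 ^ (2 * n1) = 1" by (simp_all add: s1_def s2_def mult.left_commute flip: power_mult)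
  have e1: "dedekind_eta (z / of_nat p1) = s1 * dedekind_eta z ^ p1 * klein_prod p1 z"
    and e2: "dedekind_eta (y / of_nat p1) = s1 * dedekind_eta y ^ p1 * klein_prod p1 y"
    and e3: "dedekind_eta y = s2 * dedekind_eta z ^ p2 * klein_prod p2 z"
    using dedekind_eta_div[OF z p1] dedekind_eta_div[OF y p1] dedekind_eta_div[OF z p2]
    by (simp_all add: s1_def s2_def n1_def n2_def y_def)
  show K: "klein_prod p1 (z / of_nat p2) \<noteq> 0" "klein_prod p2 z \<noteq> 0"
    using e2 e3 nz by (auto simp flip: y_def)
  have "double_eta_quotient p1 p2 z =
      dedekind_eta (z / of_nat p1) * dedekind_eta y / (dedekind_eta z * dedekind_eta (y / of_nat p1))"
    by (simp add: double_eta_quotient_def y_def mult_ac)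
  also have "\<dots> = klein_prod p1 z * dedekind_eta z ^ (2 * n1) / (klein_prod p1 y * dedekind_eta y ^ (2 * n1))"
  proof -
    have "dedekind_eta z ^ p1 = dedekind_eta z * dedekind_eta z ^ (2 * n1)"
      "dedekind_eta y ^ p1 = dedekind_eta y * dedekind_eta y ^ (2 * n1)"
      by (simp_all add: pn)
    then show ?thesis
      unfolding e1 e2 using nz s K[folded y_def] by (simp add: divide_simps)
  qed
  \<comment> \<open>The even exponent 2 n1 removes the sign in eta(y).\<close>
  also have "dedekind_eta y ^ (2 * n1) = dedekind_eta z ^ (2 * n1) * dedekind_eta z ^ (4 * n1 * n2) * klein_prod p2 z ^ (2 * n1)"
  proof -
    have "dedekind_eta y ^ (2 * n1) = dedekind_eta z ^ (p2 * (2 * n1)) * klein_prod p2 z ^ (2 * n1)"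
      unfolding e3 by (simp only: power_mult_distrib s power_mult[symmetric]) simp
    also have "p2 * (2 * n1) = 2 * n1 + 4 * n1 * n2" by (simp add: pn algebra_simps)
    finally show ?thesis by (simp only: power_add)
  qed
  finally show "double_eta_quotient p1 p2 z = klein_prod p1 z /
    (klein_prod p1 (z / of_nat p2) * klein_prod p2 z ^ (2 * (p1 div 2)) *
     dedekind_eta z ^ (4 * (p1 div 2) * (p2 div 2)))"
    unfolding n1_def[symmetric] n2_def[symmetric] y_def[symmetric] using nz K[folded y_def]
    by (simp add: divide_simps mult_ac)
qed

lemma eta_exponent_dvd: "24 dvd eta_exponent p1 p2 * ((p1 - 1) * (p2 - 1))"
proof -
  define x where "x = (p1 - 1) * (p2 - 1)"
  have "24 = eta_exponent p1 p2 * gcd 24 x"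
    by (simp add: eta_exponent_def x_def)
  moreover have "eta_exponent p1 p2 * gcd 24 x dvd eta_exponent p1 p2 * x"
    by (intro mult_dvd_mono) auto
  ultimately show ?thesis by (simp add: x_def)
qed

text \<open>The Gauss sign of p1 occurs in numerator and denominator, that of p2 with an even
  exponent. The exponentials cancel or become 1 because 24 divides s (p1 - 1)(p2 - 1).\<close>

lemma double_eta_quotient_moebius:
  fixes a b c d :: int
  assumes z: "Im z > 0" and p: "odd p1" "odd p2"
    and det: "a * d - b * c = 1" and N: "int (p1 * p2) dvd b"
  shows "double_eta_quotient p1 p2 ((of_int a * z + of_int b) / (of_int c * z + of_int d)) ^ eta_exponent p1 p2 =
    double_eta_quotient p1 p2 z ^ eta_exponent p1 p2"
proof -
  define s where "s = eta_exponent p1 p2"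
  define n1 n2 where "n1 = p1 div 2" and "n2 = p2 div 2"
  have pn: "p1 = 2 * n1 + 1" "p2 = 2 * n2 + 1" using p by (auto simp: n1_def n2_def)
  obtain m where m: "s * ((p1 - 1) * (p2 - 1)) = 24 * m"
    using eta_exponent_dvd[of p1 p2] by (auto simp: s_def)
  then have m: "s * n1 * n2 = 6 * m" by (simp add: pn mult_ac)
  obtain \<beta> where b: "b = int (p1 * p2) * \<beta>" using N by auto
  have cop: "coprime a (int p1)" "coprime a (int p2)"
  proof -
    have "coprime a b"
    proof (rule coprimeI)
      fix x assume "x dvd a" "x dvd b"
      then have "x dvd a * d - b * c" by simp
      then show "is_unit x" by (simp add: det)
    qed
    then show "coprime a (int p1)" "coprime a (int p2)"
      by (auto simp: b coprime_mult_right_iff)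
  qed
  obtain \<theta>1 where \<theta>1: "\<theta>1 = 1 \<or> \<theta>1 = -1"
    "\<And>(b :: int) (c :: int) (d :: int) z. Im z > 0 \<Longrightarrow> a * d - int p1 * b * c = 1 \<Longrightarrow>
      klein_prod p1 ((of_int a * z + of_int (int p1 * b)) / (of_int c * z + of_int d)) *
        (of_int c * z + of_int d) ^ n1 =
      e2pi (of_int (b * (a + 3)) * of_nat (n1 * (n1 + 1)) / 12) * \<theta>1 * klein_prod p1 z"
    using klein_prod_moebius[OF p(1) cop(1)] unfolding n1_def by metis
  obtain \<theta>2 where \<theta>2: "\<theta>2 = 1 \<or> \<theta>2 = -1"
    "\<And>(b :: int) (c :: int) (d :: int) z. Im z > 0 \<Longrightarrow> a * d - int p2 * b * c = 1 \<Longrightarrow>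
      klein_prod p2 ((of_int a * z + of_int (int p2 * b)) / (of_int c * z + of_int d)) *
        (of_int c * z + of_int d) ^ n2 =
      e2pi (of_int (b * (a + 3)) * of_nat (n2 * (n2 + 1)) / 12) * \<theta>2 * klein_prod p2 z"
    using klein_prod_moebius[OF p(2) cop(2)] unfolding n2_def by metis
  define J where "J = of_int c * z + of_int d"
  define g where "g = (of_int a * z + of_int b) / J"
  have J: "J \<noteq> 0"
    using moebius_denominator_nonzero[OF z, of c d] det by (cases "c = 0") (auto simp: J_def)
  have g: "Im g > 0" unfolding g_def J_def by (rule moebius_Im_pos[OF z det])
  have p20: "(of_nat p2 :: complex) \<noteq> 0" using pn by (simp del: of_nat_Suc)
  define y where "y = z / of_nat p2"
  have y: "Im y > 0" using z pn by (simp add: y_def Im_divide_of_nat)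
  define k1 k1' k2 where "k1 = e2pi (of_int (int p2 * \<beta> * (a + 3)) * of_nat (n1 * (n1 + 1)) / 12)"
    and "k1' = e2pi (of_int (\<beta> * (a + 3)) * of_nat (n1 * (n1 + 1)) / 12)"
    and "k2 = e2pi (of_int (int p1 * \<beta> * (a + 3)) * of_nat (n2 * (n2 + 1)) / 12)"
  have K1: "klein_prod p1 g * J ^ n1 = k1 * \<theta>1 * klein_prod p1 z"
    using \<theta>1(2)[OF z, of d "int p2 * \<beta>" c] det by (simp add: b g_def J_def k1_def mult_ac)
  have K2: "klein_prod p2 g * J ^ n2 = k2 * \<theta>2 * klein_prod p2 z"
    using \<theta>2(2)[OF z, of d "int p1 * \<beta>" c] det by (simp add: b g_def J_def k2_def mult_ac)
  \<comment> \<open>On \<open>y\<close> acts the matrix with entries a, p1 \<beta>, c p2, d, and its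
    automorphy factor is the same \<open>J\<close>.\<close>
  have Jy: "of_int (c * int p2) * y + of_int d = J" using p20 by (simp add: J_def y_def)
  have gy: "g / of_nat p2 = (of_int a * y + of_int (int p1 * \<beta>)) / J"
    using p20 J by (simp add: g_def y_def b field_simps)
  have K1': "klein_prod p1 (g / of_nat p2) * J ^ n1 = k1' * \<theta>1 * klein_prod p1 y"
    using \<theta>1(2)[OF y, of d \<beta> "c * int p2"] det unfolding Jy gy
    by (simp add: b k1'_def mult_ac)
  have E: "dedekind_eta g ^ 24 = J ^ 12 * dedekind_eta z ^ 24"
    using dedekind_eta_24_moebius[OF det z] by (simp add: g_def J_def)
  \<comment> \<open>The exponents differ by the factor p2, and p2 - 1 = 2 n2. After multiplication
    by s the discrepancy is an integer multiple of s n1 n2 / 6 = m.\<close>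
  have r1: "k1 ^ s = k1' ^ s"
  proof -
    have "of_nat s * (of_int (int p2 * \<beta> * (a + 3)) * of_nat (n1 * (n1 + 1)) / 12) =
      of_nat s * (of_int (\<beta> * (a + 3)) * of_nat (n1 * (n1 + 1)) / 12) +
      of_nat (s * n1 * n2) * of_int (\<beta> * (a + 3) * int (n1 + 1)) / (6::complex)"
      by (simp add: pn field_simps)
    also have "of_nat (s * n1 * n2) * of_int (\<beta> * (a + 3) * int (n1 + 1)) / (6::complex) = of_int (int m * (\<beta> * (a + 3) * int (n1 + 1)))"
      unfolding m by simp
    finally show ?thesis
      unfolding k1_def k1'_def e2pi_power by (simp only: e2pi_add e2pi_of_int mult_1_right)
  qed
  have r2: "k2 ^ (2 * n1 * s) = 1"
  proof -
    have "of_nat (2 * n1 * s) * (of_int (int p1 * \<beta> * (a + 3)) * of_nat (n2 * (n2 + 1)) / 12) =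
      of_nat (s * n1 * n2) * of_int (int p1 * \<beta> * (a + 3) * int (n2 + 1)) / (6::complex)"
      by (simp add: field_simps)
    also have "\<dots> = of_int (int m * (int p1 * \<beta> * (a + 3) * int (n2 + 1)))"
      unfolding m by simp
    finally show ?thesis unfolding k2_def e2pi_power by (simp only: e2pi_of_int)
  qed
  have t: "\<theta>1 \<noteq> 0" "\<theta>2 ^ (2 * n1 * s) = 1" using \<theta>1(1) \<theta>2(1) by (auto simp: power_mult mult.assoc)
  have k0: "k1 \<noteq> 0" "k1' \<noteq> 0" "k2 \<noteq> 0" by (simp_all add: k1_def k1'_def k2_def)
  have w: "double_eta_quotient p1 p2 x ^ s = klein_prod p1 x ^ s /
      (klein_prod p1 (x / of_nat p2) ^ s * klein_prod p2 x ^ (2 * n1 * s) * (dedekind_eta x ^ 24) ^ m)"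
    if "Im x > 0" for x
  proof -
    have "4 * n1 * n2 * s = 24 * m" using m by (simp add: mult_ac)
    then show ?thesis
      unfolding double_eta_quotient_klein(1)[OF that p] n1_def[symmetric] n2_def[symmetric]
      by (simp only: power_divide power_mult_distrib power_mult[symmetric])
  qed
  \<comment> \<open>The power of \<open>klein_prod p2\<close> has weight -12 m and (eta^24)^m has
    weight 12 m, so their automorphy factors cancel.\<close>
  have "n2 * (2 * n1 * s) = 2 * (s * n1 * n2)" by (simp add: mult_ac)
  also have "\<dots> = 12 * m" unfolding m by simp
  finally have J12: "J ^ (n2 * (2 * n1 * s)) = (J ^ 12) ^ m"
    by (simp only: power_mult)
  have A: "klein_prod p1 g ^ s * (J ^ n1) ^ s = k1 ^ s * \<theta>1 ^ s * klein_prod p1 z ^ s"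
    using arg_cong[OF K1, of "\<lambda>x. x ^ s"] by (simp only: power_mult_distrib)
  have B: "klein_prod p1 (g / of_nat p2) ^ s * (J ^ n1) ^ s = k1 ^ s * \<theta>1 ^ s * klein_prod p1 y ^ s"
    using arg_cong[OF K1', of "\<lambda>x. x ^ s"] by (simp only: power_mult_distrib r1)
  have C: "klein_prod p2 g ^ (2 * n1 * s) * (J ^ 12) ^ m = klein_prod p2 z ^ (2 * n1 * s)"
    using arg_cong[OF K2, of "\<lambda>x. x ^ (2 * n1 * s)"]
    by (simp only: power_mult_distrib r2 t(2) J12 mult_1_left flip: power_mult)
  have D: "(dedekind_eta g ^ 24) ^ m = (J ^ 12) ^ m * (dedekind_eta z ^ 24) ^ m"
    unfolding E power_mult_distrib ..
  have nz: "(J ^ n1) ^ s \<noteq> 0" "(J ^ 12) ^ m \<noteq> 0" "k1 ^ s * \<theta>1 ^ s \<noteq> 0"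
    using J t k0 by simp_all
  have "double_eta_quotient p1 p2 g ^ s =
      (klein_prod p1 g ^ s * (J ^ n1) ^ s) /
      ((klein_prod p1 (g / of_nat p2) ^ s * (J ^ n1) ^ s) * (klein_prod p2 g ^ (2 * n1 * s) * (J ^ 12) ^ m) * (dedekind_eta z ^ 24) ^ m)"
    unfolding w[OF g] D using J by simp
  also have "\<dots> = double_eta_quotient p1 p2 z ^ s"
    unfolding A B C w[OF z] y_def[symmetric] using t(1) k0(1) by simp
  finally show ?thesis by (simp add: g_def J_def s_def)
qed

text \<open>The 24th powers of both sides agree by the transformation of eta^24. The ratio is
  therefore continuous with values among the 24th roots of unity on a connected set, hence constant,
  and one value decides.\<close>

lemma double_eta_quotient_fricke:
  assumes z: "Im z > 0" and p: "p1 > 0" "p2 > 0"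
  shows "double_eta_quotient p1 p2 (- of_nat (p1 * p2) / z) = double_eta_quotient p1 p2 z"
proof -
  define H where "H = {z. Im z > 0}"
  define N where "N = p1 * p2"
  have N: "N > 0" using p by (simp add: N_def)
  define w where "w = double_eta_quotient p1 p2"
  have div: "Im (z / of_nat k) > 0" if "Im z > 0" "k > 0" for z k
    using that by (simp add: Im_divide_of_nat)
  have neg: "- of_nat k / z = - 1 / (z / of_nat k)" for k and z :: complex
    by (simp add: field_simps)
  have negI: "Im (- of_nat k / z) > 0" if "Im z > 0" "k > 0" for z k
    unfolding neg by (rule Im_minus_inverse_pos[OF div[OF that]])
  have nz: "w z \<noteq> 0" if "Im z > 0" for z
    using that p by (simp add: w_def double_eta_quotient_def dedekind_eta_nonzero div del: of_nat_mult)
  have w24: "w (- of_nat N / z) ^ 24 = w z ^ 24" if z: "Im z > 0" for z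
  proof -
    have z0: "z \<noteq> 0" using z by auto
    have S: "dedekind_eta (- of_nat k / z) ^ 24 = (z / of_nat k) ^ 12 * dedekind_eta (z / of_nat k) ^ 24" if "k > 0" for k
      unfolding neg by (rule dedekind_eta_24_S[OF div[OF z that]])
    have "- of_nat N / z / of_nat p1 = - of_nat p2 / z" "- of_nat N / z / of_nat p2 = - of_nat p1 / z"
      "- of_nat N / z / of_nat N = - of_nat 1 / z"
      using p by (simp_all add: N_def)
    then have "w (- of_nat N / z) ^ 24 =
        ((z / of_nat p2) ^ 12 * dedekind_eta (z / of_nat p2) ^ 24 * ((z / of_nat p1) ^ 12 * dedekind_eta (z / of_nat p1) ^ 24)) /
        ((z / of_nat N) ^ 12 * dedekind_eta (z / of_nat N) ^ 24 * ((z / of_nat 1) ^ 12 * dedekind_eta (z / of_nat 1) ^ 24))"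
      unfolding w_def double_eta_quotient_def N_def[symmetric]
      using p N by (simp only: S power_mult_distrib power_divide)
    also have "\<dots> = ((z / of_nat p2) ^ 12 * (z / of_nat p1) ^ 12 / ((z / of_nat N) ^ 12 * z ^ 12)) * w z ^ 24"
      unfolding w_def double_eta_quotient_def N_def[symmetric]
      by (simp add: power_mult_distrib power_divide mult_ac)
    also have "(z / of_nat p2) ^ 12 * (z / of_nat p1) ^ 12 / ((z / of_nat N) ^ 12 * z ^ 12) = 1"
      using z0 p by (simp add: N_def power_mult_distrib power_divide)
    finally show ?thesis by simp
  qed
  define r where "r z = w (- of_nat N / z) / w z" for z
  have eta_cont: "continuous_on H (\<lambda>z. dedekind_eta (f z))" if "continuous_on H f" "f ` H \<subseteq> H" for f
    using continuous_on_compose2[OF holomorphic_on_imp_continuous_on[OF dedekind_eta_holomorphic] that(1)] that(2)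
    by (simp add: H_def)
  have w_cont: "continuous_on H w"
    unfolding w_def double_eta_quotient_def
    by (intro continuous_intros eta_cont) (use p div in \<open>auto simp: H_def dedekind_eta_nonzero simp del: of_nat_mult\<close>)
  have "continuous_on H (\<lambda>z. w (- of_nat N / z))"
    by (rule continuous_on_compose2[OF w_cont]) (use negI N in \<open>auto simp: H_def intro!: continuous_intros\<close>)
  then have "continuous_on H r"
    unfolding r_def by (intro continuous_intros w_cont) (use nz in \<open>auto simp: H_def\<close>)
  moreover have "connected H"
    unfolding H_def by (intro convex_connected convex_halfspace_Im_gt)
  moreover have "r ` H \<subseteq> {x. x ^ 24 = 1}"
    using w24 nz by (auto simp: r_def H_def power_divide)
  then have "finite (r ` H)"
    by (rule finite_subset) (rule finite_roots_unity, simp)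
  ultimately have "r constant_on H" using continuous_finite_range_constant by blast
  then obtain C where C: "\<And>z. z \<in> H \<Longrightarrow> r z = C" by (auto simp: constant_on_def)
  \<comment> \<open>The fixed point of z -> -N/z.\<close>
  define z0 where "z0 = \<i> * complex_of_real (sqrt (real N))"
  have z0: "z0 \<in> H" using N by (simp add: H_def z0_def)
  have "z0 * z0 = - of_nat N"
    by (simp add: z0_def power2_eq_square[symmetric] power_mult_distrib flip: of_real_power)
  moreover have "z0 \<noteq> 0" using z0 by (auto simp: H_def)
  ultimately have "- of_nat N / z0 = z0" by (metis nonzero_mult_div_cancel_left)
  then have "r z0 = 1" using nz z0 by (simp add: r_def H_def)
  then have "r z = 1" using C[OF z0] C[of z] z by (simp add: H_def)
  then show ?thesis using nz[OF z] by (simp add: r_def w_def N_def)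
qed

section \<open>Imaginary quadratic orders\<close>

lemma bezout3:
  fixes A B C :: int
  assumes "gcd A (gcd B C) = 1"
  obtains u v w where "u * A + v * B + w * C = 1"
proof -
  obtain x y where xy: "x * A + y * gcd B C = 1" using bezout_int[of A "gcd B C"] assms by auto
  obtain v w where vw: "v * B + w * C = gcd B C" using bezout_int[of B C] by auto
  have "x * A + (y * v) * B + (y * w) * C = 1"
    using xy by (simp flip: vw add: algebra_simps)
  then show ?thesis by (rule that)
qed

lemma lattice_eq_iff:
  fixes a b a' b' :: int
  assumes "Im \<alpha> \<noteq> 0"
  shows "of_int a + of_int b * \<alpha> = of_int a' + of_int b' * \<alpha> \<longleftrightarrow> a = a' \<and> b = b'"
  using assms by (auto simp: complex_eq_iff)

text \<open>Linear independence of 1 and \<open>\<alpha>\<close> makes the two coefficient triples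
  proportional; Bezout coefficients of the primitive triple show that the factor is an
  integer.\<close>

lemma quadratic_relation_multiple:
  fixes A B C x y z :: int
  assumes im: "Im \<alpha> \<noteq> 0" and A: "A \<noteq> 0" and prim: "gcd A (gcd B C) = 1"
    and root: "of_int A * \<alpha>\<^sup>2 + of_int B * \<alpha> + of_int C = 0"
    and rel: "of_int x * \<alpha>\<^sup>2 + of_int y * \<alpha> + of_int z = 0"
  obtains k where "x = k * A" "y = k * B" "z = k * C"
proof -
  have A\<alpha>: "of_int A * \<alpha>\<^sup>2 = - (of_int B * \<alpha> + of_int C)"
    using root by (simp add: add_eq_0_iff2 add.assoc)
  have "of_int (x * C) + of_int (x * B) * \<alpha> = - of_int x * (of_int A * \<alpha>\<^sup>2)"
    unfolding A\<alpha> by (simp add: algebra_simps)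
  also have "\<dots> = - of_int A * (of_int x * \<alpha>\<^sup>2)" by simp
  also have "of_int x * \<alpha>\<^sup>2 = - (of_int y * \<alpha> + of_int z)"
    using rel by (simp add: add_eq_0_iff2 add.assoc)
  also have "- of_int A * \<dots> = of_int (A * z) + of_int (A * y) * \<alpha>" by (simp add: algebra_simps)
  finally have eqs: "x * C = A * z" "x * B = A * y"
    unfolding lattice_eq_iff[OF im] by auto
  obtain u v w where uvw: "u * A + v * B + w * C = 1" using bezout3[OF prim] .
  define k where "k = x * u + v * y + w * z"
  have "x = x * (u * A + v * B + w * C)" using uvw by simp
  also have "\<dots> = x * u * A + v * (x * B) + w * (x * C)" by (simp add: algebra_simps)
  also have "\<dots> = k * A" unfolding eqs k_def by (simp add: algebra_simps)
  finally have x: "x = k * A" .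
  have "y = k * B" "z = k * C" using eqs A unfolding x by (auto simp: mult_ac)
  with x show ?thesis by (rule that)
qed

lemma primitive_quadratic:
  fixes A B C :: int
  assumes A: "A > 0" and root: "of_int A * \<alpha>\<^sup>2 + of_int B * \<alpha> + of_int C = (0::complex)"
  obtains A' B' C' :: int where "A' > 0" "gcd A' (gcd B' C') = 1"
    "of_int A' * \<alpha>\<^sup>2 + of_int B' * \<alpha> + of_int C' = 0"
proof -
  define g where "g = gcd A (gcd B C)"
  have g: "g > 0" using A by (simp add: g_def gcd_pos_int)
  have "g dvd A" "g dvd B" "g dvd C"
    unfolding g_def by (meson dvd_trans gcd_dvd1 gcd_dvd2)+
  then obtain A' B' C' where eqs: "A = g * A'" "B = g * B'" "C = g * C'" by (metis dvdE)
  have "A' > 0" using A g by (simp add: eqs zero_less_mult_iff)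
  moreover have "gcd (g * A') (gcd (g * B') (g * C')) = g"
    using g_def unfolding eqs by (rule sym)
  then have "g * gcd A' (gcd B' C') = g * 1"
    using g gcd_mult_distrib_int[of g B' C'] gcd_mult_distrib_int[of g A' "gcd B' C'"] by simp
  then have "gcd A' (gcd B' C') = 1" using g by simp
  moreover have "of_int g * (of_int A' * \<alpha>\<^sup>2 + of_int B' * \<alpha> + of_int C') = 0"
    using root by (simp add: eqs algebra_simps)
  then have "of_int A' * \<alpha>\<^sup>2 + of_int B' * \<alpha> + of_int C' = 0" using g by simp
  ultimately show ?thesis by (rule that)
qed

lemma poly_of_int_add:
  "poly (map_poly of_int (p + q)) \<alpha> = poly (map_poly of_int p) \<alpha> + poly (map_poly of_int q) (\<alpha> :: complex)"
  by (induction p q rule: poly_induct2) (auto simp: map_poly_pCons algebra_simps)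

lemma poly_of_int_smult:
  "poly (map_poly of_int (Polynomial.smult c p)) \<alpha> = of_int c * poly (map_poly of_int p) (\<alpha> :: complex)"
  by (induction p) (auto simp: map_poly_pCons algebra_simps)

lemma poly_of_int_mult:
  "poly (map_poly of_int (p * q)) \<alpha> = poly (map_poly of_int p) \<alpha> * poly (map_poly of_int q) (\<alpha> :: complex)"
  by (induction p) (auto simp: map_poly_pCons poly_of_int_add poly_of_int_smult algebra_simps)

text \<open>By Gauss's lemma, the primitive quadratic polynomial of \<open>\<alpha>\<close> divides every monic
  integer polynomial vanishing at \<open>\<alpha>\<close>.\<close>

lemma algebraic_int_quadratic_monic:
  fixes A B C :: int
  assumes alg: "algebraic_int \<alpha>" and im: "Im \<alpha> \<noteq> 0" and A: "A > 0" and prim: "gcd A (gcd B C) = 1"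
    and root: "of_int A * \<alpha>\<^sup>2 + of_int B * \<alpha> + of_int C = 0"
  shows "A = 1"
proof -
  obtain P :: "int poly" where P: "poly (map_poly of_int P) \<alpha> = 0" "lead_coeff P = 1"
    using alg unfolding algebraic_int_altdef_ipoly by auto
  define Q where "Q = [:C, B, A:]"
  have Q: "Q \<noteq> 0" "degree Q = 2" "lead_coeff Q = A" using A by (auto simp: Q_def)
  have Qr: "poly (map_poly of_int Q) \<alpha> = 0"
    using root by (simp add: Q_def map_poly_pCons algebra_simps power2_eq_square)
  \<comment> \<open>Pseudo-division stays inside integer polynomials. The remainder has degree below
    2 and vanishes at \<open>\<alpha>\<close>, so it is 0.\<close>
  obtain S R where SR: "pseudo_divmod P Q = (S, R)" by force
  define k where "k = Suc (degree P) - degree Q"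
  have eq: "Polynomial.smult (A ^ k) P = Q * S + R" and R: "R = 0 \<or> degree R < 2"
    using pseudo_divmod[OF Q(1) SR] Q by (simp_all add: k_def)
  have "of_int (A ^ k) * poly (map_poly of_int P) \<alpha> =
      poly (map_poly of_int Q) \<alpha> * poly (map_poly of_int S) \<alpha> + poly (map_poly of_int R) \<alpha>"
    unfolding poly_of_int_smult[symmetric] eq by (simp add: poly_of_int_add poly_of_int_mult)
  then have "poly (map_poly of_int R) \<alpha> = 0"
    using P(1) Qr by simp
  moreover obtain r0 r1 where r: "R = [:r0, r1:]"
  proof -
    have "degree R < 2" using R by auto
    then have "R = [:poly.coeff R 0, poly.coeff R 1:]"
      by (intro poly_eqI) (auto simp: coeff_pCons coeff_eq_0 split: nat.split)
    then show ?thesis by (rule that)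
  qed
  ultimately have "R = 0"
    using lattice_eq_iff[OF im, of r0 r1 0 0] by (simp add: map_poly_pCons mult.commute)
  have "content P = 1"
  proof -
    have "content P dvd lead_coeff P" by (rule content_dvd_coeff)
    then show ?thesis using P(2) by (metis is_unit_content_iff)
  qed
  have "content Q = 1"
  proof -
    have "content Q dvd poly.coeff Q 0" "content Q dvd poly.coeff Q 1" "content Q dvd poly.coeff Q 2"
      by (rule content_dvd_coeff)+
    then have "content Q dvd gcd A (gcd B C)" by (auto simp: Q_def numeral_2_eq_2)
    then show ?thesis using prim by (metis is_unit_content_iff)
  qed
  \<comment> \<open>\<open>P\<close> and \<open>Q\<close> have content 1, so the whole factor
    \<open>A ^ k\<close> sits in \<open>S\<close> and can be cancelled; then \<open>A\<close>
    divides the leading coefficient 1 of \<open>P\<close>.\<close>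
  have "A ^ k = content S"
    using arg_cong[OF eq, of content] \<open>R = 0\<close> \<open>content P = 1\<close> \<open>content Q = 1\<close> A
    by (simp add: content_mult)
  then have "Polynomial.smult (A ^ k) P = Polynomial.smult (A ^ k) (Q * primitive_part S)"
    using eq \<open>R = 0\<close> by (metis add_0_right content_times_primitive_part mult_smult_right)
  moreover have "A ^ k \<noteq> 0" using A by simp
  ultimately have "P = Q * primitive_part S"
    using smult_cancel by blast
  then have "1 = A * lead_coeff (primitive_part S)"
    using P(2) Q(3) by (metis lead_coeff_mult)
  then show ?thesis using A by (metis pos_zmult_eq_1_iff)
qed

lemma csqrt_neg_int:
  fixes d :: int
  assumes "d < 0"
  shows "Re (csqrt (of_int d)) = 0" "Im (csqrt (of_int d)) > 0" "(csqrt (of_int d))\<^sup>2 = of_int d"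
proof -
  show "Re (csqrt (of_int d)) = 0" "Im (csqrt (of_int d)) > 0"
    using assms by (simp_all add: csqrt_of_real_nonpos)
  show "(csqrt (of_int d))\<^sup>2 = of_int d" by (rule power2_csqrt)
qed

lemma of_rat_quotient:
  obtains a n :: int where "n > 0" "of_rat x = (of_int a / of_int n :: complex)"
proof -
  obtain a n where an: "quotient_of x = (a, n)" by force
  have "of_rat x = (of_int a / of_int n :: complex)"
    unfolding quotient_of_div[OF an] by (simp add: of_rat_divide)
  then show ?thesis using quotient_of_denom_pos[OF an] by (rule that[rotated])
qed

text \<open>An irrational element satisfies a monic integral quadratic equation, and so does its
  conjugate, so the coefficients are minus the trace and the norm. This replaces an explicit
  integral basis, which would depend on the squarefree part of d.\<close>

lemma algebraic_int_trace_norm: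
  fixes d :: int
  assumes d: "d < 0" and z: "z = of_rat x + of_rat y * csqrt (of_int d)" and alg: "algebraic_int z"
  obtains t n :: int where "z + cnj z = of_int t" "z * cnj z = of_int n"
proof (cases "y = 0")
  case True
  then have "z \<in> \<rat>" by (simp add: z)
  then obtain k where "z = of_int k"
    using rational_algebraic_int_is_int[OF alg] by (auto elim: Ints_cases)
  then have "z + cnj z = of_int (2 * k)" "z * cnj z = of_int (k * k)" by simp_all
  then show ?thesis by (rule that)
next
  case False
  define c where "c = csqrt (of_int d)"
  note c = csqrt_neg_int[OF d, folded c_def]
  obtain a n where x: "n > 0" "of_rat x = (of_int a / of_int n :: complex)" by (rule of_rat_quotient)
  obtain b m where y: "m > 0" "of_rat y = (of_int b / of_int m :: complex)" by (rule of_rat_quotient)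
  have "b \<noteq> 0" using y(2) False by auto
  have zab: "of_int (n * m) * z - of_int (a * m) = of_int (b * n) * c"
    using x y by (simp add: z c_def field_simps)
  have "(of_int (n * m) * z - of_int (a * m))\<^sup>2 = of_int (b * n) ^ 2 * of_int d"
    unfolding zab power_mult_distrib c(3) ..
  then have root0: "of_int ((n * m)\<^sup>2) * z\<^sup>2 + of_int (- 2 * (n * m) * (a * m)) * z + of_int ((a * m)\<^sup>2 - (b * n)\<^sup>2 * d) = 0"
    by (simp add: power2_eq_square algebra_simps)
  have "(n * m)\<^sup>2 > 0" using x y by simp
  from primitive_quadratic[OF this root0] obtain A B C where
    ABC: "A > 0" "gcd A (gcd B C) = 1" "of_int A * z\<^sup>2 + of_int B * z + of_int C = 0" .
  have "Im (of_int (n * m) * z - of_int (a * m)) \<noteq> 0"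
    unfolding zab using c(2) \<open>b \<noteq> 0\<close> x(1) by simp
  then have im: "Im z \<noteq> 0" by auto
  have "A = 1" by (rule algebraic_int_quadratic_monic[OF alg im ABC])
  then have eq: "z * z + of_int B * z + of_int C = 0" using ABC by (simp add: power2_eq_square)
  then have "cnj (z * z + of_int B * z + of_int C) = cnj 0" by (rule arg_cong)
  then have eq': "cnj z * cnj z + of_int B * cnj z + of_int C = 0" by simp
  have "(z - cnj z) * (z + cnj z + of_int B) =
      (z * z + of_int B * z + of_int C) - (cnj z * cnj z + of_int B * cnj z + of_int C)"
    by (simp add: algebra_simps)
  also have "\<dots> = 0" unfolding eq eq' by simp
  finally have "(z - cnj z) * (z + cnj z + of_int B) = 0" .
  moreover have "z - cnj z \<noteq> 0" using im by (auto simp: complex_eq_iff)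
  ultimately have tr: "z + cnj z = of_int (- B)" by (simp add: add_eq_0_iff2)
  have "z * cnj z = z * (z + cnj z) - z * z" by (simp add: algebra_simps)
  moreover have C: "of_int C = - (z * z + of_int B * z)"
    using eq by (simp only: add_eq_0_iff)
  have "z * (z + cnj z) - z * z = of_int C"
    unfolding tr C by (simp add: algebra_simps)
  ultimately have "z * cnj z = of_int C" by simp
  with tr show ?thesis by (rule that)
qed

text \<open>The generator (D + sqrt D)/2 treats D = 0 and D = 1 modulo 4 uniformly.\<close>

definition order_disc :: "int \<Rightarrow> complex set" where
  "order_disc D = {of_int a + of_int b * ((of_int D + csqrt (of_int D)) / 2) | a b. True}"

definition field_disc :: "int \<Rightarrow> complex set" where
  "field_disc D = {of_rat x + of_rat y * csqrt (of_int D) | x y. True}"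

lemma lattice_basis_change:
  fixes h e :: int
  assumes "e = 1 \<or> e = -1" "\<tau> = of_int h + of_int e * \<sigma>"
  shows "{of_int a + of_int b * \<tau> | a b. True} = {of_int a + of_int b * (\<sigma> :: complex) | a b :: int. True}"
proof -
  have 1: "of_int a + of_int b * \<tau> = of_int (a + b * h) + of_int (b * e) * \<sigma>" for a b
    by (simp add: assms(2) algebra_simps)
  have 2: "of_int a + of_int b * \<sigma> = of_int (a - b * e * h) + of_int (b * e) * \<tau>" for a b
    using assms(1) by (auto simp: assms(2) algebra_simps)
  show ?thesis
  proof (intro Set.set_eqI iffI)
    fix z assume "z \<in> {of_int a + of_int b * \<tau> | a b. True}"
    then show "z \<in> {of_int a + of_int b * \<sigma> | a b. True}" using 1 by blast
  next
    fix z assume "z \<in> {of_int a + of_int b * \<sigma> | a b. True}"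
    then show "z \<in> {of_int a + of_int b * \<tau> | a b. True}" using 2 by blast
  qed
qed

lemma square_mod_4:
  fixes t D :: int
  assumes "4 dvd t\<^sup>2 - D"
  shows "4 dvd D\<^sup>2 - D" "2 dvd t - D"
proof -
  obtain m where m: "t\<^sup>2 - D = 4 * m" using assms by blast
  consider k where "t = 2 * k" | k where "t = 2 * k + 1" by (metis evenE oddE)
  moreover have fac: "D\<^sup>2 - D = D * (D - 1)" by (simp add: power2_eq_square algebra_simps)
  ultimately have "4 dvd D\<^sup>2 - D \<and> 2 dvd t - D"
  proof cases
    case 1
    then have D: "D = 4 * (k\<^sup>2 - m)" using m by (simp add: power2_eq_square)
    have "t - D = 2 * (k - 2 * (k\<^sup>2 - m))" by (simp add: 1 D)
    moreover have "4 dvd D" unfolding D by (rule dvd_triv_left)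
    ultimately show ?thesis unfolding fac by simp
  next
    case 2
    then have D: "D - 1 = 4 * (k\<^sup>2 + k - m)" using m by (simp add: power2_eq_square algebra_simps)
    then have "t - D = 2 * (k - 2 * (k\<^sup>2 + k - m))" using 2 by simp
    moreover have "4 dvd D - 1" unfolding D by (rule dvd_triv_left)
    ultimately show ?thesis unfolding fac by simp
  qed
  then show "4 dvd D\<^sup>2 - D" "2 dvd t - D" by simp_all
qed

section \<open>The order, its field and its discriminant\<close>

context
  fixes K :: "complex set" and f :: nat and D d :: int
  assumes d: "d < 0" and K: "K = {of_rat x + of_rat y * csqrt (of_int d) | x y. True}"
    and f: "f > 0" and disc: "is_discriminant (quad_order K f) D" and D: "D < 0"
begin

lemma quad_order_trace_norm:
  assumes "z \<in> quad_order K f"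
  obtains t n :: int where "z + cnj z = of_int t" "z * cnj z = of_int n"
proof -
  obtain a w where z: "z = of_int a + of_nat f * w" and w: "w \<in> K" "algebraic_int w"
    using assms by (auto simp: quad_order_def ring_of_integers_def)
  obtain x y where "w = of_rat x + of_rat y * csqrt (of_int d)" using w(1) K by auto
  from algebraic_int_trace_norm[OF d this w(2)] obtain t n :: int where
    tn: "w + cnj w = of_int t" "w * cnj w = of_int n" .
  have "z + cnj z = of_int (2 * a) + of_nat f * (w + cnj w)"
    by (simp add: z algebra_simps)
  then have "z + cnj z = of_int (2 * a + int f * t)" unfolding tn by simp
  moreover have "z * cnj z = of_int a * of_int a + of_int a * of_nat f * (w + cnj w) + of_nat f * of_nat f * (w * cnj w)"
    by (simp add: z algebra_simps)
  then have "z * cnj z = of_int (a * a + a * int f * t + int f * int f * n)" unfolding tn by simp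
  ultimately show ?thesis by (rule that)
qed

lemma one_in_quad_order: "1 \<in> quad_order K f"
proof -
  have "0 \<in> K" unfolding K by (auto intro!: exI[of _ 0])
  then have "0 \<in> ring_of_integers K" by (simp add: ring_of_integers_def)
  then have "of_int 1 + of_nat f * 0 \<in> quad_order K f" unfolding quad_order_def by blast
  then show ?thesis by simp
qed

text \<open>The discriminant is given through an arbitrary basis \<open>u\<close>, \<open>v\<close>.
  As 1 is a primitive vector of the order, it extends to a basis 1, \<tau>, and \<tau> is known from
  its trace and its discriminant, up to the sign \<open>e\<close> of the square root.\<close>

lemma quad_order_basis:
  obtains t :: int and e :: int where "e = 1 \<or> e = -1" "4 dvd t\<^sup>2 - D"
    "quad_order K f = {of_int a + of_int b * ((of_int t + of_int e * csqrt (of_int D)) / 2) | a b. True}"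
proof -
  define R where "R = quad_order K f"
  obtain u v where uv: "R = {of_int a * u + of_int b * v | a b. True}"
    and D_eq: "of_int D = (u * cnj v - v * cnj u)\<^sup>2"
    using disc unfolding is_discriminant_def R_def by auto
  have mem: "of_int a * u + of_int b * v \<in> R" for a b unfolding uv by blast
  have "1 \<in> R" unfolding R_def by (rule one_in_quad_order)
  then obtain m n where mn: "1 = of_int m * u + of_int n * v" unfolding uv by blast
  \<comment> \<open>Primitivity of 1: if 1 = g w with w in the order, the norm of w is an integer k
    with g^2 k = 1.\<close>
  define g where "g = gcd m n"
  obtain m' n' where mn': "m = g * m'" "n = g * n'" unfolding g_def by (metis gcd_dvd1 gcd_dvd2 dvdE)
  define w where "w = of_int m' * u + of_int n' * v"
  have gw: "of_int g * w = 1" using mn by (simp add: mn' w_def algebra_simps)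
  have "w \<in> R" unfolding w_def by (rule mem)
  then obtain k where k: "w * cnj w = of_int k" using quad_order_trace_norm unfolding R_def by metis
  have "of_int (g * g * k) = (of_int g * w) * cnj (of_int g * w)" using k by (simp add: algebra_simps)
  then have "g * g * k = 1" unfolding gw by (simp only: complex_cnj_one mult_1 of_int_eq_1_iff)
  then have "g * (g * k) = 1" by (simp only: mult.assoc)
  then have "g = 1 \<or> g = -1" by (auto simp: zmult_eq_1_iff)
  moreover have "g \<ge> 0" by (simp add: g_def)
  ultimately have "g = 1" by simp
  then obtain x y where xy: "x * m + y * n = 1" using bezout_int[of m n] by (auto simp: g_def)
  \<comment> \<open>The Bezout coefficients make the change from \<open>u\<close>, \<open>v\<close>
    to 1, \<open>\<tau>\<close> unimodular.\<close>
  define \<tau> where "\<tau> = of_int x * v - of_int y * u"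
  have xy': "of_int x * of_int m + of_int y * of_int n = (1::complex)" using arg_cong[OF xy, of of_int] by simp
  have u: "u = of_int x - of_int n * \<tau>"
  proof -
    have "of_int x - of_int n * \<tau> = of_int x * (of_int m * u + of_int n * v) - of_int n * \<tau>" using mn by simp
    also have "\<dots> = (of_int x * of_int m + of_int y * of_int n) * u" by (simp add: \<tau>_def algebra_simps)
    finally show ?thesis unfolding xy' by simp
  qed
  have v: "v = of_int y + of_int m * \<tau>"
  proof -
    have "of_int y + of_int m * \<tau> = of_int y * (of_int m * u + of_int n * v) + of_int m * \<tau>" using mn by simp
    also have "\<dots> = (of_int x * of_int m + of_int y * of_int n) * v" by (simp add: \<tau>_def algebra_simps)
    finally show ?thesis unfolding xy' by simp
  qed
  have 1: "of_int a * u + of_int b * v = of_int (a * x + b * y) + of_int (b * m - a * n) * \<tau>" for a b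
    unfolding u v by (simp add: algebra_simps)
  have 2: "of_int a + of_int b * \<tau> = of_int (a * m - b * y) * u + of_int (a * n + b * x) * v" for a b
  proof -
    have "of_int a + of_int b * \<tau> = of_int a * (of_int m * u + of_int n * v) + of_int b * \<tau>" using mn by simp
    then show ?thesis by (simp add: \<tau>_def algebra_simps)
  qed
  have R_\<tau>: "R = {of_int a + of_int b * \<tau> | a b. True}"
    unfolding uv
  proof (intro Set.set_eqI iffI)
    fix z assume "z \<in> {of_int a * u + of_int b * v | a b. True}"
    then show "z \<in> {of_int a + of_int b * \<tau> | a b. True}" using 1 by blast
  next
    fix z assume "z \<in> {of_int a + of_int b * \<tau> | a b. True}"
    then show "z \<in> {of_int a * u + of_int b * v | a b. True}" using 2 by blast
  qed
  have "u * cnj v - v * cnj u = (of_int x * of_int m + of_int y * of_int n) * (cnj \<tau> - \<tau>)"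
    unfolding u v by (simp add: algebra_simps)
  then have D_\<tau>: "of_int D = (cnj \<tau> - \<tau>)\<^sup>2" unfolding D_eq xy' by simp
  have "of_int 0 + of_int 1 * \<tau> \<in> R" unfolding R_\<tau> by blast
  then have "\<tau> \<in> R" by simp
  then obtain t N where tN: "\<tau> + cnj \<tau> = of_int t" "\<tau> * cnj \<tau> = of_int N"
    using quad_order_trace_norm unfolding R_def by metis
  have "of_int D = (\<tau> + cnj \<tau>)\<^sup>2 - 4 * (\<tau> * cnj \<tau>)"
    unfolding D_\<tau> by (simp add: power2_eq_square algebra_simps)
  then have "of_int D = (of_int (t\<^sup>2 - 4 * N) :: complex)" unfolding tN by simp
  then have "D = t\<^sup>2 - 4 * N" by (simp only: of_int_eq_iff)
  then have dvd: "4 dvd t\<^sup>2 - D" by simp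
  have "(\<tau> - cnj \<tau>)\<^sup>2 = (csqrt (of_int D))\<^sup>2" using D_\<tau> by (simp add: power2_commute)
  then have "\<tau> - cnj \<tau> = csqrt (of_int D) \<or> \<tau> - cnj \<tau> = - csqrt (of_int D)"
    by (simp only: power2_eq_iff)
  then obtain e :: int where e: "e = 1 \<or> e = -1" "\<tau> - cnj \<tau> = of_int e * csqrt (of_int D)"
    by (metis mult_minus1 mult_1 of_int_1 of_int_minus)
  have "2 * \<tau> = (\<tau> + cnj \<tau>) + (\<tau> - cnj \<tau>)" by simp
  then have "2 * \<tau> = of_int t + of_int e * csqrt (of_int D)" unfolding tN e(2) .
  then have "\<tau> = (of_int t + of_int e * csqrt (of_int D)) / 2"
    by (metis nonzero_mult_div_cancel_left zero_neq_numeral)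
  note \<tau> = this
  show ?thesis by (rule that[OF e(1) dvd R_\<tau>[unfolded \<tau> R_def]])
qed

lemma quad_order_eq: "quad_order K f = order_disc D" and disc_mod_4: "4 dvd D\<^sup>2 - D"
proof -
  obtain t e :: int where e: "e = 1 \<or> e = -1" and t: "4 dvd t\<^sup>2 - D"
    and R: "quad_order K f = {of_int a + of_int b * ((of_int t + of_int e * csqrt (of_int D)) / 2) | a b. True}"
    by (rule quad_order_basis)
  show "4 dvd D\<^sup>2 - D" by (rule square_mod_4[OF t])
  have "2 dvd t - D" by (rule square_mod_4[OF t])
  then have "2 dvd t - e * D" using e by auto
  then obtain h where "t = e * D + 2 * h" by (metis add.commute diff_add_cancel dvdE)
  then have "(of_int t + of_int e * csqrt (of_int D)) / 2 = of_int h + of_int e * ((of_int D + csqrt (of_int D)) / 2)"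
    by (simp add: field_simps)
  then show "quad_order K f = order_disc D"
    unfolding R order_disc_def by (rule lattice_basis_change[OF e])
qed

text \<open>f sqrt d lies in the order, and comparing imaginary parts shows that sqrt d is a
  rational multiple of sqrt D.\<close>

lemma field_eq: "K = field_disc D"
proof -
  define c \<omega> where "c = csqrt (of_int d)" and "\<omega> = csqrt (of_int D)"
  note c = csqrt_neg_int[OF d, folded c_def] and \<omega> = csqrt_neg_int[OF D, folded \<omega>_def]
  have "c \<in> ring_of_integers K"
  proof -
    have "c = of_rat 0 + of_rat 1 * c" by simp
    then have "c \<in> K" unfolding K c_def by blast
    moreover have "algebraic_int c"
      unfolding c_def by (intro algebraic_int_csqrt int_imp_algebraic_int) simp
    ultimately show ?thesis by (simp add: ring_of_integers_def)
  qed
  then have "of_int 0 + of_nat f * c \<in> quad_order K f" unfolding quad_order_def by blast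
  then obtain a b where ab: "of_nat f * c = of_int a + of_int b * ((of_int D + \<omega>) / 2)"
    unfolding quad_order_eq order_disc_def \<omega>_def by auto
  from arg_cong[OF ab, of Im] have im: "real f * Im c = of_int b * Im \<omega> / 2" by simp
  define r where "r = of_int b / (2 * of_nat f :: rat)"
  have "b \<noteq> 0" using im c(2) f by auto
  then have r0: "r \<noteq> 0" using f by (simp add: r_def)
  have cr: "c = of_rat r * \<omega>"
    using im c(1) \<omega>(1) f by (simp add: r_def of_rat_divide of_rat_mult complex_eq_iff field_simps)
  have "x \<in> K \<longleftrightarrow> x \<in> field_disc D" for x
  proof
    assume "x \<in> K"
    then obtain y z where "x = of_rat y + of_rat z * c" unfolding K c_def by blast
    then have "x = of_rat y + of_rat (z * r) * \<omega>" by (simp add: cr of_rat_mult)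
    then show "x \<in> field_disc D" unfolding field_disc_def \<omega>_def by blast
  next
    assume "x \<in> field_disc D"
    then obtain y z where "x = of_rat y + of_rat z * \<omega>" unfolding field_disc_def \<omega>_def by blast
    then have "x = of_rat y + of_rat (z / r) * c" using r0 by (simp add: cr of_rat_divide)
    then show "x \<in> K" unfolding K c_def by blast
  qed
  then show ?thesis by blast
qed

text \<open>Here sqrt D / p is an algebraic integer, so f sqrt D / p lies in the order. Imaginary
  parts in the order are integer multiples of half that of sqrt D, hence p divides 2f.\<close>

lemma square_dvd_discriminant:
  assumes p: "odd p" "prime p" and dvd: "int p ^ 2 dvd D"
  shows "p dvd f"
proof -
  define \<omega> where "\<omega> = csqrt (of_int D)"
  note \<omega> = csqrt_neg_int[OF D, folded \<omega>_def]
  obtain k where k: "D = int p ^ 2 * k" using dvd by blast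
  define w where "w = \<omega> / of_nat p"
  have p0: "p > 0" using p by (simp add: prime_gt_0_nat)
  have "w\<^sup>2 = of_int k" using p0 unfolding w_def power_divide \<omega>(3) by (simp add: k)
  then have "poly [:- of_int k, 0, 1:] w = 0" by (simp add: power2_eq_square)
  then have "algebraic_int w"
    by (intro algebraic_int.intros[of "[:- of_int k, 0, 1:]"]) (auto simp: coeff_pCons split: nat.split)
  moreover have "w = of_rat 0 + of_rat (1 / of_nat p) * \<omega>" by (simp add: w_def of_rat_divide)
  then have "w \<in> K" unfolding field_eq field_disc_def \<omega>_def by blast
  ultimately have "of_int 0 + of_nat f * w \<in> quad_order K f"
    unfolding quad_order_def ring_of_integers_def by blast
  then obtain a b where ab: "of_nat f * w = of_int a + of_int b * ((of_int D + \<omega>) / 2)"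
    unfolding quad_order_eq order_disc_def \<omega>_def by auto
  from arg_cong[OF ab, of Im] have "real f * (Im \<omega> / real p) = of_int b * Im \<omega> / 2" by (simp add: w_def Im_divide_of_nat)
  then have "real f * 2 = of_int b * real p" using \<omega>(2) p0 by (simp add: field_simps)
  then have "of_int (int f * 2) = (of_int (b * int p) :: real)" by simp
  then have "int f * 2 = b * int p" by (simp only: of_int_eq_iff)
  then have "int p dvd int f * 2" by simp
  then have "p dvd f * 2" by (simp flip: int_dvd_int_iff)
  then show ?thesis using p by (metis coprime_dvd_mult_left_iff coprime_right_2_iff_odd)
qed

end

section \<open>Lattices and binary quadratic forms\<close>

definition zlattice :: "complex \<Rightarrow> complex set" where
  "zlattice \<alpha> = {of_int m + of_int n * \<alpha> | m n. True}"

lemma latticeI: "of_int m + of_int n * \<alpha> \<in> zlattice \<alpha>"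
  unfolding zlattice_def by blast

lemma latticeE:
  assumes "z \<in> zlattice \<alpha>"
  obtains m n where "z = of_int m + of_int n * \<alpha>"
  using assms unfolding zlattice_def by blast

lemma one_in_lattice: "1 \<in> zlattice \<alpha>"
  using latticeI[of 1 0 \<alpha>] by simp

lemma in_lattice: "\<alpha> \<in> zlattice \<alpha>"
  using latticeI[of 0 1 \<alpha>] by simp

lemma lattice_of_int: "of_int m \<in> zlattice \<alpha>"
  using latticeI[of m 0 \<alpha>] by simp

lemma lattice_add: "x \<in> zlattice \<alpha> \<Longrightarrow> y \<in> zlattice \<alpha> \<Longrightarrow> x + y \<in> zlattice \<alpha>"
proof (elim latticeE)
  fix m n m' n' assume "x = of_int m + of_int n * \<alpha>" "y = of_int m' + of_int n' * \<alpha>"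
  then have "x + y = of_int (m + m') + of_int (n + n') * \<alpha>" by (simp add: algebra_simps)
  then show ?thesis using latticeI by metis
qed

text \<open>If x preserves the lattice, then x and x \<alpha> lie in it, which yields an integral
  quadratic relation for \<open>\<alpha>\<close>. Being a multiple of the primitive one, it has
  leading coefficient divisible by A.\<close>

lemma lattice_multiplier_ring:
  fixes A B C :: int
  assumes im: "Im \<alpha> \<noteq> 0" and A: "A \<noteq> 0" and prim: "gcd A (gcd B C) = 1"
    and root: "of_int A * \<alpha>\<^sup>2 + of_int B * \<alpha> + of_int C = 0"
  shows "{x. \<forall>y\<in>zlattice \<alpha>. x * y \<in> zlattice \<alpha>} = zlattice (of_int A * \<alpha>)"
proof (intro Set.set_eqI iffI)
  fix x assume x: "x \<in> {x. \<forall>y\<in>zlattice \<alpha>. x * y \<in> zlattice \<alpha>}"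
  then have "x * 1 \<in> zlattice \<alpha>" using one_in_lattice by blast
  then obtain m n where mn: "x = of_int m + of_int n * \<alpha>" by (auto elim: latticeE)
  have "x * \<alpha> \<in> zlattice \<alpha>" using x in_lattice by blast
  then obtain m' n' where "x * \<alpha> = of_int m' + of_int n' * \<alpha>" by (auto elim: latticeE)
  then have "of_int n * \<alpha>\<^sup>2 + of_int (m - n') * \<alpha> + of_int (- m') = 0"
    by (simp add: mn power2_eq_square algebra_simps)
  from quadratic_relation_multiple[OF im A prim root this] obtain k where "n = k * A" by metis
  then have "x = of_int m + of_int k * (of_int A * \<alpha>)" by (simp add: mn)
  then show "x \<in> zlattice (of_int A * \<alpha>)" using latticeI by metis
next
  fix x assume "x \<in> zlattice (of_int A * \<alpha>)"
  then obtain m k where x: "x = of_int m + of_int k * (of_int A * \<alpha>)" by (rule latticeE)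
  have A\<alpha>: "of_int A * \<alpha>\<^sup>2 = - (of_int B * \<alpha> + of_int C)"
    using root by (simp add: add_eq_0_iff2 add.assoc)
  have "x * y \<in> zlattice \<alpha>" if "y \<in> zlattice \<alpha>" for y
  proof -
    from that obtain a b where y: "y = of_int a + of_int b * \<alpha>" by (rule latticeE)
    have "x * y = of_int (m * a) + of_int (m * b + k * A * a) * \<alpha> + of_int (k * b) * (of_int A * \<alpha>\<^sup>2)"
      by (simp add: x y power2_eq_square algebra_simps)
    also have "\<dots> = of_int (m * a - k * b * C) + of_int (m * b + k * A * a - k * b * B) * \<alpha>"
      unfolding A\<alpha> by (simp add: algebra_simps)
    finally show ?thesis using latticeI by metis
  qed
  then show "x \<in> {x. \<forall>y\<in>zlattice \<alpha>. x * y \<in> zlattice \<alpha>}" by blast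
qed

text \<open>\<open>\<beta>\<close> is the Moebius image of \<open>\<alpha>\<close>; clearing the
  denominator keeps the condition polynomial.\<close>

definition sl2_equiv :: "complex \<Rightarrow> complex \<Rightarrow> bool" where
  "sl2_equiv \<alpha> \<beta> \<longleftrightarrow> (\<exists>a b c d :: int. a * d - b * c = 1 \<and>
     \<beta> * (of_int c * \<alpha> + of_int d) = of_int a * \<alpha> + of_int b)"

text \<open>The base changes in both directions are integral and mutually inverse, so the
  determinant is 1 or -1; the latter would map the upper half-plane to the lower one.\<close>

lemma homothetic_lattices_imp_sl2_equiv:
  assumes im: "Im \<alpha> > 0" "Im \<beta> > 0" and x: "zlattice \<beta> = (\<lambda>y. x * y) ` zlattice \<alpha>"
  shows "sl2_equiv \<alpha> \<beta>"
proof -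
  have "1 \<in> (\<lambda>y. x * y) ` zlattice \<alpha>" "\<beta> \<in> (\<lambda>y. x * y) ` zlattice \<alpha>"
    unfolding x[symmetric] by (rule one_in_lattice in_lattice)+
  then obtain y y' where y: "y \<in> zlattice \<alpha>" "1 = x * y" "y' \<in> zlattice \<alpha>" "\<beta> = x * y'" by blast
  obtain c d where "y = of_int d + of_int c * \<alpha>" using y(1) by (rule latticeE)
  moreover obtain a b where "y' = of_int b + of_int a * \<alpha>" using y(3) by (rule latticeE)
  ultimately have 1: "1 = x * (of_int d + of_int c * \<alpha>)" and \<beta>: "\<beta> = x * (of_int b + of_int a * \<alpha>)"
    using y by simp_all
  have im': "Im \<beta> \<noteq> 0" using im by simp
  have "x * 1 \<in> zlattice \<beta>" "x * \<alpha> \<in> zlattice \<beta>"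
    unfolding x using one_in_lattice in_lattice by blast+
  then obtain a' b' c' d' where x1: "x = of_int d' + of_int c' * \<beta>" and x\<alpha>: "x * \<alpha> = of_int b' + of_int a' * \<beta>"
    by (auto elim!: latticeE)
  have "of_int 0 + of_int 1 * \<beta> = x * of_int b + of_int a * (x * \<alpha>)" using \<beta> by (simp add: algebra_simps)
  also have "\<dots> = of_int (d' * b + a * b') + of_int (c' * b + a * a') * \<beta>"
    unfolding x\<alpha> by (subst x1) (simp add: algebra_simps)
  finally have "0 = d' * b + a * b' \<and> 1 = c' * b + a * a'"
    unfolding lattice_eq_iff[OF im'] .
  note e1 = this[THEN conjunct1, symmetric] this[THEN conjunct2, symmetric]
  have "of_int 1 + of_int 0 * \<beta> = x * of_int d + of_int c * (x * \<alpha>)" using 1 by (simp add: algebra_simps)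
  also have "\<dots> = of_int (d' * d + c * b') + of_int (c' * d + c * a') * \<beta>"
    unfolding x\<alpha> by (subst x1) (simp add: algebra_simps)
  finally have "1 = d' * d + c * b' \<and> 0 = c' * d + c * a'"
    unfolding lattice_eq_iff[OF im'] .
  note e2 = this[THEN conjunct1, symmetric] this[THEN conjunct2, symmetric]
  have "(a * d - b * c) * (a' * d' - b' * c') =
      (c' * b + a * a') * (d' * d + c * b') - (d' * b + a * b') * (c' * d + c * a')"
    by (simp add: algebra_simps)
  then have "(a * d - b * c) * (a' * d' - b' * c') = 1" unfolding e1 e2 by simp
  then have det: "a * d - b * c = 1 \<or> a * d - b * c = -1" by (auto simp: zmult_eq_1_iff)
  have rel: "\<beta> * (of_int c * \<alpha> + of_int d) = of_int a * \<alpha> + of_int b"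
    using 1 \<beta> by (metis (no_types, lifting) add.commute mult.assoc mult.commute mult.left_neutral)
  have cd: "c \<noteq> 0 \<or> d \<noteq> 0" using det by auto
  have nz: "of_int c * \<alpha> + of_int d \<noteq> 0" by (rule moebius_denominator_nonzero[OF im(1) cd])
  then have "\<beta> = (of_int a * \<alpha> + of_int b) / (of_int c * \<alpha> + of_int d)"
    using rel by (simp add: field_simps)
  then have pos: "of_int (a * d - b * c) * Im \<alpha> / (norm (of_int c * \<alpha> + of_int d))\<^sup>2 > 0"
    using im(2) unfolding moebius_Im[OF im(1) cd, symmetric] by simp
  have "a * d - b * c \<noteq> -1"
  proof
    assume "a * d - b * c = -1"
    from pos[unfolded this] im(1) show False by (auto simp: zero_less_divide_iff divide_less_0_iff)
  qed
  then show ?thesis using det rel unfolding sl2_equiv_def by blast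
qed

lemma sl2_lattice:
  fixes a b c d :: int
  assumes det: "a * d - b * c = 1"
    and rel: "\<beta> * (of_int c * \<alpha> + of_int d) = of_int a * \<alpha> + of_int b"
  shows "zlattice \<alpha> = (\<lambda>y. (of_int c * \<alpha> + of_int d) * y) ` zlattice \<beta>"
proof -
  define j where "j = of_int c * \<alpha> + of_int d"
  have 1: "j * (of_int m + of_int n * \<beta>) = of_int (m * d + n * b) + of_int (m * c + n * a) * \<alpha>" for m n
  proof -
    have "j * (of_int m + of_int n * \<beta>) = of_int m * j + of_int n * (\<beta> * j)" by (simp add: algebra_simps)
    then show ?thesis unfolding j_def rel by (simp add: algebra_simps)
  qed
  have 2: "of_int m + of_int n * \<alpha> = j * (of_int (m * a - n * b) + of_int (n * d - m * c) * \<beta>)" for m n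
  proof -
    have "(m * a - n * b) * d + (n * d - m * c) * b = m * (a * d - b * c)"
      "(m * a - n * b) * c + (n * d - m * c) * a = n * (a * d - b * c)" by (simp_all add: algebra_simps)
    then show ?thesis unfolding 1 det by simp
  qed
  show ?thesis unfolding j_def[symmetric]
  proof (intro Set.set_eqI iffI)
    fix z assume "z \<in> zlattice \<alpha>"
    then obtain m n where "z = of_int m + of_int n * \<alpha>" by (rule latticeE)
    then show "z \<in> (\<lambda>y. j * y) ` zlattice \<beta>" unfolding 2 using latticeI by blast
  next
    fix z assume "z \<in> (\<lambda>y. j * y) ` zlattice \<beta>"
    then obtain y where y: "y \<in> zlattice \<beta>" "z = j * y" by blast
    obtain m n where "y = of_int m + of_int n * \<beta>" using y(1) by (rule latticeE)
    then have "z = j * (of_int m + of_int n * \<beta>)" using y(2) by simp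
    then show "z \<in> zlattice \<alpha>" unfolding 1 using latticeI by metis
  qed
qed

lemma forms_iff:
  assumes "D < 0"
  shows "(A, B, C) \<in> forms D \<longleftrightarrow> A > 0 \<and> gcd A (gcd B C) = 1 \<and> B\<^sup>2 - 4 * A * C = D"
proof -
  have "positive_definite (A, B, C) \<longleftrightarrow> A > 0" if disc: "B\<^sup>2 - 4 * A * C = D"
  proof
    assume "positive_definite (A, B, C)"
    then have "\<forall>x y. (x, y) \<noteq> (0, 0) \<longrightarrow> A * x\<^sup>2 + B * x * y + C * y\<^sup>2 > 0"
      by (simp add: positive_definite_def)
    from this[rule_format, of 1 0] show "A > 0" by simp
  next
    assume A: "A > 0"
    have "A * x\<^sup>2 + B * x * y + C * y\<^sup>2 > 0" if xy: "(x, y) \<noteq> (0, 0)" for x y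
    proof -
      have eq: "4 * A * (A * x\<^sup>2 + B * x * y + C * y\<^sup>2) = (2 * A * x + B * y)\<^sup>2 + (- D) * y\<^sup>2"
        by (simp add: power2_eq_square algebra_simps flip: disc)
      have "(2 * A * x + B * y)\<^sup>2 + (- D) * y\<^sup>2 > 0"
      proof (cases "y = 0")
        case True
        then show ?thesis using xy A by simp
      next
        case False
        then have "(- D) * y\<^sup>2 > 0" using assms by (intro mult_pos_pos) auto
        then show ?thesis by (intro add_nonneg_pos zero_le_power2)
      qed
      then show ?thesis unfolding eq[symmetric] using A by (simp add: zero_less_mult_iff)
    qed
    then show "positive_definite (A, B, C)" by (simp add: positive_definite_def)
  qed
  then show ?thesis by (auto simp: forms_def)
qed

lemma form_root_props:
  assumes D: "D < 0" and q: "(A, B, C) \<in> forms D"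
  shows "Im (form_root D (A, B, C)) > 0"
    and "of_int A * (form_root D (A, B, C))\<^sup>2 + of_int B * form_root D (A, B, C) + of_int C = 0"
    and "of_int A * form_root D (A, B, C) = (- of_int B + csqrt (of_int D)) / 2"
proof -
  note q' = q[unfolded forms_iff[OF D]]
  define \<omega> where "\<omega> = csqrt (of_int D)"
  note \<omega> = csqrt_neg_int[OF D, folded \<omega>_def]
  define \<alpha> where "\<alpha> = form_root D (A, B, C)"
  have A0: "(of_int A :: complex) \<noteq> 0" using q' by simp
  have \<alpha>: "2 * of_int A * \<alpha> = - of_int B + \<omega>" using A0 by (simp add: \<alpha>_def form_root_def \<omega>_def)
  then show 3: "of_int A * form_root D (A, B, C) = (- of_int B + csqrt (of_int D)) / 2"
    by (simp add: \<alpha>_def \<omega>_def field_simps)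
  have "Im (of_int A * \<alpha>) = Im \<omega> / 2" unfolding \<alpha>_def 3 \<omega>_def by simp
  then have "of_int A * Im \<alpha> > 0" using \<omega>(2) by simp
  then show "Im (form_root D (A, B, C)) > 0" using q' by (simp add: \<alpha>_def zero_less_mult_iff)
  have "\<omega>\<^sup>2 = of_int B ^ 2 - 4 * of_int A * of_int C" 
  proof -
    have "of_int D = (of_int (B\<^sup>2 - 4 * A * C) :: complex)" using q' by simp
    then show ?thesis unfolding \<omega>(3) by simp
  qed
  then have "4 * of_int A * (of_int A * \<alpha>\<^sup>2 + of_int B * \<alpha> + of_int C) = (2 * of_int A * \<alpha> + of_int B)\<^sup>2 - \<omega>\<^sup>2"
    by (simp add: power2_eq_square algebra_simps)
  also have "\<dots> = 0" unfolding \<alpha> by simp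
  finally show "of_int A * (form_root D (A, B, C))\<^sup>2 + of_int B * form_root D (A, B, C) + of_int C = 0"
    using A0 by (simp add: \<alpha>_def)
qed

lemma form_ideal_eq_lattice:
  assumes D: "D < 0" and q: "(A, B, C) \<in> forms D"
  shows "form_ideal D (A, B, C) = (\<lambda>y. of_int A * y) ` zlattice (form_root D (A, B, C))"
proof -
  have *: "of_int A * (of_int m + of_int n * form_root D (A, B, C)) =
      of_int m * of_int A + of_int n * ((- of_int B + csqrt (of_int D)) / 2)" for m n
    unfolding form_root_props(3)[OF D q, symmetric] by (simp add: algebra_simps)
  show ?thesis
  proof (intro Set.set_eqI iffI)
    fix z assume "z \<in> form_ideal D (A, B, C)"
    then obtain m n where "z = of_int m * of_int A + of_int n * ((- of_int B + csqrt (of_int D)) / 2)"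
      unfolding form_ideal_def by auto
    then show "z \<in> (\<lambda>y. of_int A * y) ` zlattice (form_root D (A, B, C))"
      unfolding *[symmetric] using latticeI by blast
  next
    fix z assume "z \<in> (\<lambda>y. of_int A * y) ` zlattice (form_root D (A, B, C))"
    then obtain y where y: "y \<in> zlattice (form_root D (A, B, C))" "z = of_int A * y" by blast
    obtain m n where "y = of_int m + of_int n * form_root D (A, B, C)" using y(1) by (rule latticeE)
    then have "z = of_int m * of_int A + of_int n * ((- of_int B + csqrt (of_int D)) / 2)"
      unfolding y(2) using * by simp
    then show "z \<in> form_ideal D (A, B, C)" unfolding form_ideal_def by auto
  qed
qed

lemma form_root_inj:
  assumes D: "D < 0" and q: "(A, B, C) \<in> forms D" "(A', B', C') \<in> forms D"
    and eq: "form_root D (A, B, C) = form_root D (A', B', C')"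
  shows "A = A'" "B = B'" "C = C'"
proof -
  note q' = q[unfolded forms_iff[OF D]]
  define \<omega> where "\<omega> = csqrt (of_int D)"
  note \<omega> = csqrt_neg_int[OF D, folded \<omega>_def]
  have A0: "(of_int A :: complex) \<noteq> 0" "(of_int A' :: complex) \<noteq> 0" using q' by simp_all
  have "of_int A' * (of_int A * form_root D (A, B, C)) = of_int A * (of_int A' * form_root D (A', B', C'))"
    unfolding eq by simp
  then have rel: "of_int A' * (- of_int B + \<omega>) = of_int A * (- of_int B' + \<omega>)"
    unfolding form_root_props(3)[OF D q(1)] form_root_props(3)[OF D q(2)] \<omega>_def by simp
  from arg_cong[OF rel, of Im] show A: "A = A'" using \<omega> by simp
  from rel show B: "B = B'" unfolding A using A0 by simp
  have "4 * A * C = 4 * A * C'" "4 * A \<noteq> 0" using q' A B by auto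
  then show "C = C'" by (metis mult_left_cancel)
qed

text \<open>The form is transformed by a, b, c, d, its root by the inverse matrix. Primitivity
  survives because the inverse substitution recovers A, B, C as integral combinations of the new
  coefficients.\<close>

lemma form_substitution:
  fixes a b c d :: int
  assumes D: "D < 0" and q: "(A, B, C) \<in> forms D" and det: "a * d - b * c = 1"
  defines "A' \<equiv> A * a\<^sup>2 + B * a * c + C * c\<^sup>2"
    and "B' \<equiv> 2 * A * a * b + B * (a * d + b * c) + 2 * C * c * d"
    and "C' \<equiv> A * b\<^sup>2 + B * b * d + C * d\<^sup>2"
  shows "(A', B', C') \<in> forms D"
    and "form_root D (A, B, C) * (of_int c * form_root D (A', B', C') + of_int d) =
      of_int a * form_root D (A', B', C') + of_int b"
proof -
  note q' = q[unfolded forms_iff[OF D]]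
  have "A' > 0"
  proof -
    have "(a, c) \<noteq> (0, 0)" using det by auto
    then show ?thesis using q by (auto simp: forms_def positive_definite_def A'_def)
  qed
  moreover have "B'\<^sup>2 - 4 * A' * C' = (a * d - b * c)\<^sup>2 * (B\<^sup>2 - 4 * A * C)"
    by (simp add: A'_def B'_def C'_def power2_eq_square algebra_simps)
  then have "B'\<^sup>2 - 4 * A' * C' = D" using q' by (simp add: det)
  moreover have "gcd A' (gcd B' C') = 1"
  proof -
    have "A * (a * d - b * c)\<^sup>2 = A' * d\<^sup>2 - B' * c * d + C' * c\<^sup>2"
      "B * (a * d - b * c)\<^sup>2 = B' * (a * d + b * c) - 2 * A' * b * d - 2 * C' * a * c"
      "C * (a * d - b * c)\<^sup>2 = A' * b\<^sup>2 - B' * a * b + C' * a\<^sup>2"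
      by (simp_all add: A'_def B'_def C'_def power2_eq_square algebra_simps)
    then have inv: "A = A' * d\<^sup>2 - B' * c * d + C' * c\<^sup>2"
      "B = B' * (a * d + b * c) - 2 * A' * b * d - 2 * C' * a * c"
      "C = A' * b\<^sup>2 - B' * a * b + C' * a\<^sup>2"
      by (simp_all add: det)
    define g where "g = gcd A' (gcd B' C')"
    have "g dvd A'" "g dvd B'" "g dvd C'"
      unfolding g_def by (meson dvd_trans gcd_dvd1 gcd_dvd2)+
    then have "g dvd A" "g dvd B" "g dvd C"
      unfolding inv by (auto intro!: dvd_add dvd_diff dvd_mult2 dvd_mult)
    then have "g dvd gcd A (gcd B C)" by simp
    then have "is_unit g" using q' by simp
    then show ?thesis by (simp add: g_def)
  qed
  ultimately show q2: "(A', B', C') \<in> forms D" by (simp add: forms_iff[OF D])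
  define \<alpha> where "\<alpha> = form_root D (A, B, C)"
  define \<omega> where "\<omega> = csqrt (of_int D)"
  note \<omega> = csqrt_neg_int[OF D, folded \<omega>_def]
  have \<alpha>: "Im \<alpha> > 0" "of_int A * \<alpha>\<^sup>2 + of_int B * \<alpha> + of_int C = 0" "of_int A * \<alpha> = (- of_int B + \<omega>) / 2"
    using form_root_props[OF D q] by (simp_all add: \<alpha>_def \<omega>_def)
  have "- c \<noteq> 0 \<or> a \<noteq> 0" using det by auto
  then have nz: "of_int (- c) * \<alpha> + of_int a \<noteq> 0" by (rule moebius_denominator_nonzero[OF \<alpha>(1)])
  have A'0: "(of_int A' :: complex) \<noteq> 0" using \<open>A' > 0\<close> by simp
  have "(of_int (- c) * \<alpha> + of_int a) * (- of_int B' + \<omega>) = 2 * of_int A' * (of_int d * \<alpha> - of_int b)"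
  proof -
    have \<omega>': "\<omega> = 2 * of_int A * \<alpha> + of_int B" by (simp add: \<alpha>(3) mult.assoc diff_divide_distrib)
    \<comment> \<open>The difference of the sides is a combination of the quadratic relation of
      \<open>\<alpha>\<close> and of 1 - (a d - b c).\<close>
    have "(of_int (- c) * \<alpha> + of_int a) * (- of_int B' + \<omega>) - 2 * of_int A' * (of_int d * \<alpha> - of_int b)
       = - 2 * of_int c * (of_int A * \<alpha>\<^sup>2 + of_int B * \<alpha> + of_int C)
         + of_int (1 - (a * d - b * c)) * (of_int (2 * A * a + B * c) * \<alpha> + of_int (a * B + 2 * c * C))"
      unfolding \<omega>' A'_def B'_def by (simp add: power2_eq_square algebra_simps)
    then show ?thesis unfolding \<alpha>(2) det by simp
  qed
  then have root': "form_root D (A', B', C') * (of_int (- c) * \<alpha> + of_int a) = of_int d * \<alpha> - of_int b"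
    using A'0 by (simp add: form_root_def \<omega>_def field_simps)
  define \<beta> where "\<beta> = form_root D (A', B', C')"
  have "\<alpha> * (of_int c * \<beta> + of_int d) - (of_int a * \<beta> + of_int b) =
     (of_int d * \<alpha> - of_int b) - \<beta> * (of_int (- c) * \<alpha> + of_int a)"
    by (simp add: algebra_simps)
  also have "\<dots> = 0" unfolding \<beta>_def root' by simp
  finally show "form_root D (A, B, C) * (of_int c * form_root D (A', B', C') + of_int d) =
      of_int a * form_root D (A', B', C') + of_int b"
    unfolding \<alpha>_def \<beta>_def by simp
qed

section \<open>Proper ideals\<close>

text \<open>The factor may be any nonzero complex number, whereas \<open>same_ideal_class\<close>
  takes it from K; for ideals of forms the two notions agree
  (\<open>same_ideal_class_iff_homothetic\<close>).\<close>

definition homothetic :: "complex set \<Rightarrow> complex set \<Rightarrow> bool" where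
  "homothetic L M \<longleftrightarrow> (\<exists>x. x \<noteq> 0 \<and> M = (\<lambda>y. x * y) ` L)"

lemma homotheticI: "x \<noteq> 0 \<Longrightarrow> M = (\<lambda>y. x * y) ` L \<Longrightarrow> homothetic L M"
  unfolding homothetic_def by blast

lemma homothetic_sym:
  assumes "homothetic L M"
  shows "homothetic M L"
proof -
  obtain x where x: "x \<noteq> 0" "M = (\<lambda>y. x * y) ` L" using assms by (auto simp: homothetic_def)
  then have "L = (\<lambda>y. inverse x * y) ` M" by (simp add: image_image flip: mult.assoc)
  then show ?thesis using x(1) by (intro homotheticI[of "inverse x"]) auto
qed

lemma homothetic_trans:
  assumes "homothetic L M" "homothetic M R"
  shows "homothetic L R"
proof -
  obtain x y where "x \<noteq> 0" "M = (\<lambda>z. x * z) ` L" "y \<noteq> 0" "R = (\<lambda>z. y * z) ` M"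
    using assms by (auto simp: homothetic_def)
  then have "R = (\<lambda>z. (y * x) * z) ` L" "y * x \<noteq> 0" by (auto simp: image_image mult.assoc)
  then show ?thesis by (intro homotheticI[of "y * x"])
qed

lemma sl2_equiv_imp_homothetic:
  assumes "sl2_equiv \<alpha> \<beta>" "Im \<alpha> > 0"
  shows "homothetic (zlattice \<beta>) (zlattice \<alpha>)"
proof -
  obtain a b c d :: int where det: "a * d - b * c = 1"
    and rel: "\<beta> * (of_int c * \<alpha> + of_int d) = of_int a * \<alpha> + of_int b"
    using assms(1) unfolding sl2_equiv_def by blast
  have "c \<noteq> 0 \<or> d \<noteq> 0" using det by auto
  then show ?thesis
    by (intro homotheticI[OF moebius_denominator_nonzero[OF assms(2)] sl2_lattice[OF det rel]])
qed

lemma multiplier_ring_scale: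
  fixes a :: complex
  assumes a: "a \<noteq> 0"
  shows "{x. \<forall>y\<in>(\<lambda>y. a * y) ` L. x * y \<in> (\<lambda>y. a * y) ` L} = {x. \<forall>y\<in>L. x * y \<in> L}"
proof -
  have "x * (a * y) \<in> (\<lambda>y. a * y) ` L \<longleftrightarrow> x * y \<in> L" for x y
  proof
    assume "x * (a * y) \<in> (\<lambda>y. a * y) ` L"
    then obtain w where w: "w \<in> L" "x * (a * y) = a * w" by blast
    then have "a * (x * y) = a * w" by (simp only: mult.left_commute)
    then show "x * y \<in> L" using a w(1) by simp
  next
    assume "x * y \<in> L"
    then have "a * (x * y) \<in> (\<lambda>y. a * y) ` L" by (rule imageI)
    then show "x * (a * y) \<in> (\<lambda>y. a * y) ` L" by (simp only: mult.left_commute)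
  qed
  then show ?thesis by (simp only: ball_simps)
qed

text \<open>The order and its field in terms of D alone; \<open>disc_mod_4\<close>,
  \<open>field_eq\<close> and \<open>quad_order_eq\<close> supply the last three
  assumptions.\<close>

locale quad_order_disc =
  fixes K :: "complex set" and f :: nat and D :: int
  assumes D: "D < 0" and D4: "4 dvd D\<^sup>2 - D"
    and K: "K = field_disc D" and order: "quad_order K f = order_disc D"
begin

definition \<omega> :: complex where "\<omega> = csqrt (of_int D)"

lemmas \<omega> = csqrt_neg_int[OF D, folded \<omega>_def]

lemma KI: "of_rat x + of_rat y * \<omega> \<in> K"
  unfolding K field_disc_def \<omega>_def by blast

lemma KE:
  assumes "z \<in> K"
  obtains x y where "z = of_rat x + of_rat y * \<omega>"
  using assms unfolding K field_disc_def \<omega>_def by blast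

lemma K_of_rat: "of_rat x \<in> K"
  using KI[of x 0] by simp

lemma K_mult: "x \<in> K \<Longrightarrow> y \<in> K \<Longrightarrow> x * y \<in> K"
proof (elim KE)
  fix a b a' b' assume xy: "x = of_rat a + of_rat b * \<omega>" "y = of_rat a' + of_rat b' * \<omega>"
  have "x * y = of_rat a * of_rat a' + of_rat b * of_rat b' * \<omega>\<^sup>2 + (of_rat a * of_rat b' + of_rat b * of_rat a') * \<omega>"
    by (simp add: xy power2_eq_square algebra_simps)
  also have "\<dots> = of_rat (a * a' + b * b' * of_int D) + of_rat (a * b' + b * a') * \<omega>"
    unfolding \<omega>(3) by (simp add: of_rat_add of_rat_mult)
  finally show ?thesis using KI by metis
qed

lemma K_inverse: "x \<in> K \<Longrightarrow> inverse x \<in> K"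
proof (elim KE)
  fix a b assume x: "x = of_rat a + of_rat b * \<omega>"
  show ?thesis
  proof (cases "x = 0")
    case True
    then show ?thesis using K_of_rat[of 0] by simp
  next
    case False
    define n where "n = a\<^sup>2 - b\<^sup>2 * of_int D"
    have "x * (of_rat a - of_rat b * \<omega>) = of_rat a ^ 2 - of_rat b ^ 2 * \<omega>\<^sup>2"
      by (simp add: x power2_eq_square algebra_simps)
    also have "\<dots> = of_rat n" unfolding \<omega>(3) by (simp add: n_def of_rat_diff of_rat_mult of_rat_power)
    finally have xn: "x * (of_rat a - of_rat b * \<omega>) = of_rat n" .
    have "n \<noteq> 0"
    proof
      assume "n = 0"
      then have "a\<^sup>2 + b\<^sup>2 * of_int (- D) = 0" by (simp add: n_def)
      moreover have "b\<^sup>2 * of_int (- D) \<ge> 0" using D by (intro mult_nonneg_nonneg) auto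
      ultimately have "a\<^sup>2 = 0 \<and> b\<^sup>2 * of_int (- D) = 0"
        by (metis add_nonneg_eq_0_iff zero_le_power2)
      then have "a = 0 \<and> b = 0" using D by auto
      then show False using False by (simp add: x)
    qed
    then have "inverse x = (of_rat a - of_rat b * \<omega>) / of_rat n"
      using False xn by (simp add: field_simps)
    also have "\<dots> = of_rat (a / n) + of_rat (- b / n) * \<omega>"
      by (simp add: of_rat_divide of_rat_minus diff_divide_distrib)
    finally show ?thesis using KI by metis
  qed
qed

lemma K_of_int: "of_int k \<in> K"
  using K_of_rat[of "of_int k"] by simp

lemma same_ideal_class_sym:
  assumes "same_ideal_class K I J"
  shows "same_ideal_class K J I"
proof -
  obtain x where x: "x \<in> K" "x \<noteq> 0" "J = (\<lambda>y. x * y) ` I" using assms by (auto simp: same_ideal_class_def)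
  then have "I = (\<lambda>y. inverse x * y) ` J" by (simp add: image_image flip: mult.assoc)
  then show ?thesis using x K_inverse unfolding same_ideal_class_def by (intro bexI[of _ "inverse x"]) auto
qed

lemma same_ideal_class_trans:
  assumes "same_ideal_class K I J" "same_ideal_class K J M"
  shows "same_ideal_class K I M"
proof -
  obtain x y where "x \<in> K" "y \<in> K" "x \<noteq> 0" "J = (\<lambda>z. x * z) ` I" "y \<noteq> 0" "M = (\<lambda>z. y * z) ` J"
    using assms by (auto simp: same_ideal_class_def)
  then have "M = (\<lambda>z. (y * x) * z) ` I" "y * x \<noteq> 0" "y * x \<in> K"
    by (auto simp: image_image mult.assoc K_mult)
  then show ?thesis unfolding same_ideal_class_def by blast
qed

lemma same_ideal_class_refl: "same_ideal_class K I I"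
  unfolding same_ideal_class_def using K_of_int[of 1] by (intro bexI[of _ 1]) auto

lemma order_eq_zlattice:
  assumes "2 dvd D + B"
  shows "quad_order K f = zlattice ((- of_int B + \<omega>) / 2)"
proof -
  obtain h where h: "D + B = 2 * h" using assms by blast
  then have B: "B = 2 * h - D" by simp
  have "(of_int D + \<omega>) / 2 = of_int h + of_int 1 * ((- of_int B + \<omega>) / 2)"
    unfolding B by (simp add: field_simps)
  from lattice_basis_change[OF _ this] show ?thesis
    unfolding order order_disc_def zlattice_def \<omega>_def[symmetric] by simp
qed

lemma form_middle_parity:
  assumes "(A, B, C) \<in> forms D"
  shows "2 dvd D + B"
proof -
  have "B\<^sup>2 - D = 4 * (A * C)" using assms unfolding forms_iff[OF D] by auto
  then have "4 dvd B\<^sup>2 - D" by simp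
  then have "2 dvd B - D" by (rule square_mod_4)
  then show ?thesis by presburger
qed

lemma order_eq_form:
  assumes "(A, B, C) \<in> forms D"
  shows "quad_order K f = zlattice (of_int A * form_root D (A, B, C))"
  unfolding form_root_props(3)[OF D assms] order_eq_zlattice[OF form_middle_parity[OF assms]] \<omega>_def ..

lemma principal_form: "(1, D, (D\<^sup>2 - D) div 4) \<in> forms D"
  unfolding forms_iff[OF D] using D4 by auto

lemma order_mult:
  assumes "x \<in> quad_order K f" "y \<in> quad_order K f"
  shows "x * y \<in> quad_order K f"
proof -
  define \<tau> where "\<tau> = form_root D (1, D, (D\<^sup>2 - D) div 4)"
  note \<tau> = form_root_props[OF D principal_form, folded \<tau>_def]
  have O: "quad_order K f = zlattice \<tau>"
    using order_eq_form[OF principal_form] by (simp add: \<tau>_def)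
  have "{x. \<forall>y\<in>zlattice \<tau>. x * y \<in> zlattice \<tau>} = zlattice (of_int 1 * \<tau>)"
    by (rule lattice_multiplier_ring[OF _ _ _ \<tau>(2)]) (use \<tau>(1) in auto)
  then show ?thesis using assms unfolding O by auto
qed

lemma order_add: "x \<in> quad_order K f \<Longrightarrow> y \<in> quad_order K f \<Longrightarrow> x + y \<in> quad_order K f"
  unfolding order_eq_form[OF principal_form] by (rule lattice_add)

lemma order_of_int: "of_int k \<in> quad_order K f"
  unfolding order_eq_form[OF principal_form] by (rule lattice_of_int)

lemma order_subset_K: "quad_order K f \<subseteq> K"
proof
  fix x assume "x \<in> quad_order K f"
  then obtain a b where "x = of_int a + of_int b * ((of_int D + \<omega>) / 2)"
    unfolding order order_disc_def \<omega>_def by blast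
  then have "x = of_rat (of_int a + of_int b * of_int D / 2) + of_rat (of_int b / 2) * \<omega>"
    by (simp add: of_rat_add of_rat_mult of_rat_divide field_simps)
  then show "x \<in> K" using KI by metis
qed

lemma order_uminus: "x \<in> quad_order K f \<Longrightarrow> - x \<in> quad_order K f"
  using order_mult[OF order_of_int[of "-1"]] by simp

lemma ring_quad_order: "ring (quad_order_ring K f)"
proof (rule ringI)
  show "abelian_group (quad_order_ring K f)"
  proof (rule abelian_groupI)
    fix x assume "x \<in> carrier (quad_order_ring K f)"
    then show "\<exists>y\<in>carrier (quad_order_ring K f). y \<oplus>\<^bsub>quad_order_ring K f\<^esub> x = \<zero>\<^bsub>quad_order_ring K f\<^esub>"
      using order_uminus by (intro bexI[of _ "- x"]) (auto simp: quad_order_ring_def)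
  qed (use order_add order_of_int[of 0] in \<open>auto simp: quad_order_ring_def add_ac\<close>)
  show "Group.monoid (quad_order_ring K f)"
    by (rule monoidI) (use order_mult order_of_int[of 1] in \<open>auto simp: quad_order_ring_def mult_ac\<close>)
qed (auto simp: quad_order_ring_def algebra_simps)

lemma ideal_iff:
  "ideal I (quad_order_ring K f) \<longleftrightarrow> I \<subseteq> quad_order K f \<and> 0 \<in> I \<and> (\<forall>x\<in>I. \<forall>y\<in>I. x + y \<in> I) \<and>
     (\<forall>r\<in>quad_order K f. \<forall>x\<in>I. r * x \<in> I)" (is "?L \<longleftrightarrow> ?R")
proof
  assume ?L
  then interpret ideal I "quad_order_ring K f" .
  show ?R
    using a_subset additive_subgroup.zero_closed[OF is_additive_subgroup]
      additive_subgroup.a_closed[OF is_additive_subgroup] I_l_closed by (auto simp: quad_order_ring_def)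
next
  assume R: ?R
  interpret R: ring "quad_order_ring K f" by (rule ring_quad_order)
  have uminus: "- x \<in> I" if "x \<in> I" for x
    using R that order_of_int[of "-1"] by (metis mult_minus1 of_int_1 of_int_minus)
  have R': "\<forall>r\<in>quad_order K f. \<forall>x\<in>I. x * r \<in> I" using R by (simp add: mult.commute)
  show ?L
  proof (rule idealI[OF ring_quad_order])
    show "subgroup I (add_monoid (quad_order_ring K f))"
    proof (rule group.subgroupI)
      show "Group.group (add_monoid (quad_order_ring K f))" by (rule R.a_group)
      fix x assume x: "x \<in> I"
      have "inv\<^bsub>add_monoid (quad_order_ring K f)\<^esub> x = - x"
        by (rule group.inv_equality[OF R.a_group]) (use x R uminus in \<open>auto simp: quad_order_ring_def\<close>)
      then show "inv\<^bsub>add_monoid (quad_order_ring K f)\<^esub> x \<in> I" using uminus[OF x] by simp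
    qed (use R in \<open>auto simp: quad_order_ring_def\<close>)
  qed (use R R' in \<open>auto simp: quad_order_ring_def\<close>)
qed

lemma form_ideal_proper:
  assumes q: "q \<in> forms D"
  shows "form_ideal D q \<in> proper_ideals K f"
proof -
  obtain A B C where qABC: "q = (A, B, C)" by (rule prod_cases3)
  define \<alpha> where "\<alpha> = form_root D (A, B, C)"
  note q' = q[unfolded qABC]
  note qi = q'[unfolded forms_iff[OF D]]
  note \<alpha> = form_root_props[OF D q', folded \<alpha>_def]
  have I: "form_ideal D q = (\<lambda>y. of_int A * y) ` zlattice \<alpha>"
    unfolding qABC \<alpha>_def by (rule form_ideal_eq_lattice[OF D q'])
  have O: "quad_order K f = zlattice (of_int A * \<alpha>)" unfolding \<alpha>_def by (rule order_eq_form[OF q'])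
  have mult: "{x. \<forall>y\<in>zlattice \<alpha>. x * y \<in> zlattice \<alpha>} = quad_order K f"
    unfolding O by (rule lattice_multiplier_ring[OF _ _ _ \<alpha>(2)]) (use \<alpha>(1) qi in auto)
  have A0: "(of_int A :: complex) \<noteq> 0" using qi by simp
  have "{x. \<forall>y\<in>form_ideal D q. x * y \<in> form_ideal D q} = {x. \<forall>y\<in>zlattice \<alpha>. x * y \<in> zlattice \<alpha>}"
    unfolding I by (rule multiplier_ring_scale[OF A0])
  then have mult': "{x. \<forall>y\<in>form_ideal D q. x * y \<in> form_ideal D q} = quad_order K f" using mult by simp
  have "ideal (form_ideal D q) (quad_order_ring K f)"
    unfolding ideal_iff
  proof (intro conjI ballI)
    show "form_ideal D q \<subseteq> quad_order K f"
    proof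
      fix z assume "z \<in> form_ideal D q"
      then obtain m n where "z = of_int m * of_int A + of_int n * ((- of_int B + csqrt (of_int D)) / 2)"
        unfolding form_ideal_def qABC prod.case by blast
      then have "z = of_int (m * A) + of_int n * (of_int A * \<alpha>)" unfolding \<alpha>(3) by simp
      then show "z \<in> quad_order K f" unfolding O using latticeI by metis
    qed
    have "of_int A * of_int 0 \<in> form_ideal D q" unfolding I by (intro imageI lattice_of_int)
    then show "0 \<in> form_ideal D q" by simp
    show "x + y \<in> form_ideal D q" if x: "x \<in> form_ideal D q" and y: "y \<in> form_ideal D q" for x y
    proof -
      obtain x' y' where "x' \<in> zlattice \<alpha>" "y' \<in> zlattice \<alpha>" "x = of_int A * x'" "y = of_int A * y'"
        using x y unfolding I by blast
      then have "x + y = of_int A * (x' + y')" "x' + y' \<in> zlattice \<alpha>"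
        by (simp_all add: distrib_left lattice_add)
      then show ?thesis unfolding I by blast
    qed
    show "r * x \<in> form_ideal D q" if "r \<in> quad_order K f" "x \<in> form_ideal D q" for r x
      using that mult' by blast
  qed
  moreover have "form_ideal D q \<noteq> {0}"
  proof
    assume *: "form_ideal D q = {0}"
    have "of_int A * 1 \<in> form_ideal D q" unfolding I by (intro imageI one_in_lattice)
    then show False unfolding * using A0 by simp
  qed
  moreover have "{x \<in> K. \<forall>y\<in>form_ideal D q. x * y \<in> form_ideal D q} = quad_order K f"
  proof -
    have "{x \<in> K. \<forall>y\<in>form_ideal D q. x * y \<in> form_ideal D q} =
        K \<inter> {x. \<forall>y\<in>form_ideal D q. x * y \<in> form_ideal D q}" by (rule Collect_conj_eq[of "\<lambda>x. x \<in> K", simplified])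
    also have "\<dots> = quad_order K f" unfolding mult' using order_subset_K by (rule Int_absorb1)
    finally show ?thesis .
  qed
  ultimately show ?thesis unfolding proper_ideals_def by simp
qed

text \<open>Each form ideal is an integer multiple of the lattice of its root. A homothety factor
  lies in K automatically: it sends the nonzero integer A1 into an ideal contained in K.\<close>

lemma same_ideal_class_iff_homothetic:
  assumes q1: "(A1, B1, C1) \<in> forms D" and q2: "(A2, B2, C2) \<in> forms D"
  shows "same_ideal_class K (form_ideal D (A1, B1, C1)) (form_ideal D (A2, B2, C2)) \<longleftrightarrow>
    homothetic (zlattice (form_root D (A1, B1, C1))) (zlattice (form_root D (A2, B2, C2)))"
proof -
  define L1 L2 where "L1 = zlattice (form_root D (A1, B1, C1))" and "L2 = zlattice (form_root D (A2, B2, C2))"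
  have A0: "(of_int A1 :: complex) \<noteq> 0" "(of_int A2 :: complex) \<noteq> 0"
    using q1 q2 unfolding forms_iff[OF D] by simp_all
  have I: "form_ideal D (A1, B1, C1) = (\<lambda>y. of_int A1 * y) ` L1" "form_ideal D (A2, B2, C2) = (\<lambda>y. of_int A2 * y) ` L2"
    unfolding L1_def L2_def by (rule form_ideal_eq_lattice[OF D q1] form_ideal_eq_lattice[OF D q2])+
  have h: "homothetic L1 (form_ideal D (A1, B1, C1))" "homothetic L2 (form_ideal D (A2, B2, C2))"
    unfolding I using A0 by (auto intro: homotheticI[OF _ refl])
  have "same_ideal_class K (form_ideal D (A1, B1, C1)) (form_ideal D (A2, B2, C2)) \<longleftrightarrow>
      homothetic (form_ideal D (A1, B1, C1)) (form_ideal D (A2, B2, C2))"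
  proof
    assume "homothetic (form_ideal D (A1, B1, C1)) (form_ideal D (A2, B2, C2))"
    then obtain x where x: "x \<noteq> 0" "form_ideal D (A2, B2, C2) = (\<lambda>y. x * y) ` form_ideal D (A1, B1, C1)"
      by (auto simp: homothetic_def)
    have "of_int A1 * 1 \<in> form_ideal D (A1, B1, C1)" unfolding I L1_def using one_in_lattice by blast
    then have "x * (of_int A1 * 1) \<in> form_ideal D (A2, B2, C2)" unfolding x(2) by (rule imageI)
    then have "x * of_int A1 \<in> form_ideal D (A2, B2, C2)" by simp
    moreover have "form_ideal D (A2, B2, C2) \<subseteq> K"
      using form_ideal_proper[OF q2] order_subset_K by (auto simp: proper_ideals_def ideal_iff)
    ultimately have "x * of_int A1 \<in> K" by blast
    from K_mult[OF this K_inverse[OF K_of_int[of A1]]] have "x * of_int A1 * inverse (of_int A1) \<in> K" .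
    moreover have "x * of_int A1 * inverse (of_int A1) = x" using A0 by (simp add: field_simps)
    ultimately have "x \<in> K" by simp
    then show "same_ideal_class K (form_ideal D (A1, B1, C1)) (form_ideal D (A2, B2, C2))"
      using x unfolding same_ideal_class_def by blast
  qed (auto simp: same_ideal_class_def homothetic_def)
  also have "\<dots> \<longleftrightarrow> homothetic L1 L2"
    using homothetic_trans[OF homothetic_trans[OF h(1)] homothetic_sym[OF h(2)]]
      homothetic_trans[OF homothetic_trans[OF homothetic_sym[OF h(1)]] h(2)] by blast
  finally show ?thesis unfolding L1_def L2_def .
qed

lemma order_cnj:
  assumes "x \<in> quad_order K f"
  shows "cnj x \<in> quad_order K f"
proof -
  obtain a b where x: "x = of_int a + of_int b * ((of_int D + \<omega>) / 2)"
    using assms unfolding order order_disc_def \<omega>_def by blast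
  have "cnj \<omega> = - \<omega>" using \<omega>(1) by (simp add: complex_eq_iff)
  then have "cnj x = of_int (a + b * D) + of_int (- b) * ((of_int D + \<omega>) / 2)"
    by (simp add: x field_simps)
  then show ?thesis unfolding order order_disc_def \<omega>_def by blast
qed

lemma order_int_if_real:
  assumes "x \<in> quad_order K f" "Im x = 0"
  obtains a :: int where "x = of_int a"
proof -
  obtain a b where x: "x = of_int a + of_int b * ((of_int D + \<omega>) / 2)"
    using assms unfolding order order_disc_def \<omega>_def by blast
  then have "b = 0" using assms(2) \<omega>(2) by simp
  then show ?thesis using x that by simp
qed

text \<open>Hermite normal form: \<open>e\<close> is the least positive integer in the ideal and
  \<open>g\<close> the least positive coefficient of (D + \<omega>)/2 among its elements; division
  with remainder does the rest.\<close>

lemma proper_ideal_lattice_basis: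
  assumes "I \<in> proper_ideals K f"
  obtains e g h :: int where "e > 0" "g > 0"
    "I = (\<lambda>y. of_int e * y) ` zlattice ((of_int h + of_int g * ((of_int D + \<omega>) / 2)) / of_int e)"
proof -
  define \<tau> where "\<tau> = (of_int D + \<omega>) / 2"
  have I: "I \<subseteq> quad_order K f" "0 \<in> I" "\<And>x y. x \<in> I \<Longrightarrow> y \<in> I \<Longrightarrow> x + y \<in> I"
    "\<And>r x. r \<in> quad_order K f \<Longrightarrow> x \<in> I \<Longrightarrow> r * x \<in> I" "I \<noteq> {0}"
    using assms unfolding proper_ideals_def ideal_iff by blast+
  have I_int: "of_int k * x \<in> I" if "x \<in> I" for k x using I(4)[OF order_of_int that] .
  have I_diff: "x - of_int k * y \<in> I" if "x \<in> I" "y \<in> I" for k x y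
    using I(3)[OF that(1) I_int[OF that(2), of "- k"]] by simp
  have O: "quad_order K f = {of_int a + of_int b * \<tau> | a b. True}"
    unfolding order order_disc_def \<tau>_def \<omega>_def ..
  have \<tau>: "\<tau> \<in> quad_order K f" unfolding O by (intro CollectI exI[of _ 0] exI[of _ 1]) auto
  obtain y where y: "y \<in> I" "y \<noteq> 0" using I(2,5) by blast
  \<comment> \<open>The norm of a nonzero element is a positive integer in the ideal, so
    \<open>e\<close> exists.\<close>
  have "cnj y * y \<in> I" using I(1,4) y(1) order_cnj by blast
  moreover have cy: "cnj y * y = of_real ((norm y)\<^sup>2)" unfolding complex_norm_square by (rule mult.commute)
  ultimately have nI: "of_real ((norm y)\<^sup>2) \<in> I" by (simp only:)
  with I(1) have "of_real ((norm y)\<^sup>2) \<in> quad_order K f" by blast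
  from order_int_if_real[OF this Im_complex_of_real] obtain n where n1: "of_real ((norm y)\<^sup>2) = (of_int n :: complex)" .
  note n = n1 nI[unfolded n1]
  have "(norm y)\<^sup>2 = of_int n" using n(1) by (metis of_real_eq_iff of_real_of_int_eq)
  moreover have "(norm y)\<^sup>2 > 0" using y(2) by simp
  ultimately have "n > 0" by simp
  define P where "P k \<longleftrightarrow> k > 0 \<and> of_nat k \<in> I" for k :: nat
  have "P (nat n)" using n(2) \<open>n > 0\<close> by (simp add: P_def)
  define e where "e = (LEAST k. P k)"
  have e: "e > 0" "of_nat e \<in> I" using LeastI[of P, OF \<open>P (nat n)\<close>] by (auto simp: e_def P_def)
  have e_dvd: "int e dvd k" if "of_int k \<in> I" for k
  proof -
    have "of_int k - of_int (k div int e) * of_nat e \<in> I" by (rule I_diff[OF that e(2)])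
    also have "of_int k - of_int (k div int e) * of_nat e = (of_int (k - (k div int e) * int e) :: complex)" by simp
    also have "k - (k div int e) * int e = k mod int e" by (rule minus_div_mult_eq_mod)
    finally have m: "of_nat (nat (k mod int e)) \<in> I" using e(1) by simp
    have "\<not> P (nat (k mod int e))"
      unfolding e_def by (rule not_less_Least) (use e(1) in \<open>simp add: nat_less_iff flip: e_def\<close>)
    then have "\<not> k mod int e > 0" using m e(1) by (simp add: P_def)
    moreover have "k mod int e \<ge> 0" using e(1) by simp
    ultimately have "k mod int e = 0" by simp
    then show ?thesis by (rule dvd_eq_mod_eq_0[THEN iffD2])
  qed
  define Q where "Q k \<longleftrightarrow> k > 0 \<and> (\<exists>a :: int. of_int a + of_nat k * \<tau> \<in> I)" for k :: nat
  \<comment> \<open>This element shows that a positive coefficient of \<open>\<tau>\<close> occurs,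
    so \<open>g\<close> exists.\<close>
  have "\<tau> * of_nat e \<in> I" using I(4)[OF \<tau> e(2)] .
  then have "of_int 0 + of_nat e * \<tau> \<in> I" by (simp add: mult.commute)
  then have "Q e" unfolding Q_def using e(1) by blast
  define g where "g = (LEAST k. Q k)"
  have "Q g" unfolding g_def by (rule LeastI[of Q, OF \<open>Q e\<close>])
  then obtain h :: int where g: "g > 0" "of_int h + of_nat g * \<tau> \<in> I" by (auto simp: Q_def)
  have basis: "\<exists>x y :: int. z = of_nat e * of_int x + of_int y * (of_int h + of_nat g * \<tau>)" if z: "z \<in> I" for z
  proof -
    obtain a b where ab: "z = of_int a + of_int b * \<tau>" using z I(1) unfolding O by blast
    define k where "k = b div int g"
    have zk: "z - of_int k * (of_int h + of_nat g * \<tau>) \<in> I" by (rule I_diff[OF z g(2)])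
    also have "z - of_int k * (of_int h + of_nat g * \<tau>) = of_int (a - k * h) + of_int (b - k * int g) * \<tau>"
      by (simp add: ab algebra_simps)
    also have "b - k * int g = b mod int g" unfolding k_def by (rule minus_div_mult_eq_mod)
    finally have m: "of_int (a - k * h) + of_int (b mod int g) * \<tau> \<in> I" .
    then have m': "of_int (a - k * h) + of_nat (nat (b mod int g)) * \<tau> \<in> I" using g(1) by simp
    have "\<not> Q (nat (b mod int g))"
      unfolding g_def by (rule not_less_Least) (use g(1) in \<open>simp add: nat_less_iff flip: g_def\<close>)
    moreover have "Q (nat (b mod int g))" if "nat (b mod int g) > 0"
      unfolding Q_def by (intro conjI exI[of _ "a - k * h"] that m')
    ultimately have "\<not> nat (b mod int g) > 0" by blast
    moreover have "b mod int g \<ge> 0" using g(1) by simp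
    ultimately have b0: "b mod int g = 0" by simp
    then have "of_int (a - k * h) \<in> I" using m by simp
    then obtain x where x: "a - k * h = int e * x" using e_dvd by blast
    have "z = of_int (a - k * h) + of_int (b - k * int g) * \<tau> + of_int k * (of_int h + of_nat g * \<tau>)"
      by (simp add: ab algebra_simps)
    moreover have "b - k * int g = 0" unfolding k_def minus_div_mult_eq_mod b0 ..
    ultimately have "z = of_nat e * of_int x + of_int k * (of_int h + of_nat g * \<tau>)" by (simp add: x)
    then show ?thesis by blast
  qed
  define \<alpha> where "\<alpha> = (of_int h + of_int (int g) * \<tau>) / of_int (int e)"
  have e\<alpha>: "of_int (int e) * \<alpha> = of_int h + of_nat g * \<tau>" using e(1) by (simp add: \<alpha>_def)
  have "I = (\<lambda>y. of_int (int e) * y) ` zlattice \<alpha>"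
  proof (intro Set.set_eqI iffI)
    fix z assume "z \<in> I"
    then obtain x y :: int where "z = of_nat e * of_int x + of_int y * (of_int h + of_nat g * \<tau>)"
      using basis by blast
    then have "z = of_int (int e) * (of_int x + of_int y * \<alpha>)"
      unfolding e\<alpha>[symmetric] by (simp add: algebra_simps)
    then show "z \<in> (\<lambda>y. of_int (int e) * y) ` zlattice \<alpha>" using latticeI by blast
  next
    fix z assume "z \<in> (\<lambda>y. of_int (int e) * y) ` zlattice \<alpha>"
    then obtain w where w: "w \<in> zlattice \<alpha>" "z = of_int (int e) * w" by blast
    obtain x y where "w = of_int x + of_int y * \<alpha>" using w(1) by (rule latticeE)
    then have "z = of_int x * of_nat e + of_int y * (of_int h + of_nat g * \<tau>)"
      unfolding w(2) e\<alpha>[symmetric] by (simp add: algebra_simps)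
    then show "z \<in> I" using I(3) I_int e(2) g(2) by simp
  qed
  then show ?thesis using that[of "int e" "int g" h] e(1) g(1) unfolding \<alpha>_def \<tau>_def by simp
qed

text \<open>The form is the primitive quadratic equation of the basis quotient. Properness forces
  its discriminant to be D, since the multiplier ring generated by 1 and A \<alpha> must be the
  given order.\<close>

lemma proper_ideal_form:
  assumes I: "I \<in> proper_ideals K f"
  obtains q where "q \<in> forms D" "same_ideal_class K (form_ideal D q) I"
proof -
  define \<tau> where "\<tau> = (of_int D + \<omega>) / 2"
  obtain e g h :: int where e: "e > 0" "g > 0"
    and I_eq: "I = (\<lambda>y. of_int e * y) ` zlattice ((of_int h + of_int g * \<tau>) / of_int e)"
    using proper_ideal_lattice_basis[OF I] unfolding \<tau>_def by metis
  define \<alpha> where "\<alpha> = (of_int h + of_int g * \<tau>) / of_int e"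
  have e0: "(of_int e :: complex) \<noteq> 0" using e by simp
  have e\<alpha>: "2 * of_int e * \<alpha> = of_int (2 * h + g * D) + of_int g * \<omega>"
    using e0 by (simp add: \<alpha>_def \<tau>_def field_simps)
  have "Im (2 * of_int e * \<alpha>) > 0" unfolding e\<alpha> using e \<omega>(2) by simp
  then have im: "Im \<alpha> > 0" using e by (simp add: zero_less_mult_iff)
  have "(2 * of_int e * \<alpha> - of_int (2 * h + g * D))\<^sup>2 = of_int g ^ 2 * of_int D"
    unfolding e\<alpha> \<omega>(3)[symmetric] by (simp add: power_mult_distrib)
  then have root0: "of_int (4 * e\<^sup>2) * \<alpha>\<^sup>2 + of_int (- 4 * e * (2 * h + g * D)) * \<alpha> + of_int ((2 * h + g * D)\<^sup>2 - g\<^sup>2 * D) = 0"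
    by (simp add: power2_eq_square algebra_simps)
  have "4 * e\<^sup>2 > 0" using e by simp
  from primitive_quadratic[OF this root0] obtain A B C where
    A: "A > 0" and prim: "gcd A (gcd B C) = 1" and root: "of_int A * \<alpha>\<^sup>2 + of_int B * \<alpha> + of_int C = 0" .
  have mult: "{x. \<forall>y\<in>zlattice \<alpha>. x * y \<in> zlattice \<alpha>} = zlattice (of_int A * \<alpha>)"
    by (rule lattice_multiplier_ring[OF _ _ prim root]) (use im A in auto)
  have I_\<alpha>: "I = (\<lambda>y. of_int e * y) ` zlattice \<alpha>" unfolding I_eq \<alpha>_def ..
  have "{x. \<forall>y\<in>I. x * y \<in> I} = zlattice (of_int A * \<alpha>)"
    unfolding I_\<alpha> multiplier_ring_scale[OF e0] by (rule mult)
  moreover have "{x \<in> K. \<forall>y\<in>I. x * y \<in> I} = quad_order K f"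
    using I unfolding proper_ideals_def by blast
  moreover have "zlattice (of_int A * \<alpha>) \<subseteq> K"
  proof
    fix x assume "x \<in> zlattice (of_int A * \<alpha>)"
    then obtain m n where "x = of_int m + of_int n * (of_int A * \<alpha>)" by (rule latticeE)
    also have "\<alpha> = (of_int (2 * h + g * D) + of_int g * \<omega>) / (2 * of_int e)"
      using e\<alpha> e0 by (simp add: field_simps)
    finally have "x = of_rat (of_int m + of_int (n * A * (2 * h + g * D)) / of_int (2 * e)) + of_rat (of_int (n * A * g) / of_int (2 * e)) * \<omega>"
      using e0 by (simp add: of_rat_add of_rat_mult of_rat_divide field_simps)
    then show "x \<in> K" using KI by metis
  qed
  ultimately have O: "quad_order K f = zlattice (of_int A * \<alpha>)" by blast
  have O': "quad_order K f = zlattice \<tau>"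
    using order_eq_zlattice[of "- D"] by (simp add: \<tau>_def)
  have im\<tau>: "Im \<tau> \<noteq> 0" using \<omega>(2) by (simp add: \<tau>_def)
  \<comment> \<open>1, A \<alpha> and 1, \<tau> are bases of the same order, so n = 1 or n = -1, and
    both points lie in the upper half-plane.\<close>
  have "of_int A * \<alpha> \<in> zlattice \<tau>"
    unfolding O'[symmetric] O by (rule in_lattice)
  then obtain m n where mn1: "of_int A * \<alpha> = of_int m + of_int n * \<tau>" by (rule latticeE)
  have "\<tau> \<in> zlattice (of_int A * \<alpha>)"
    unfolding O[symmetric] O' by (rule in_lattice)
  then obtain m' n' where "\<tau> = of_int m' + of_int n' * (of_int A * \<alpha>)" by (rule latticeE)
  note mn = mn1 this
  have "of_int 0 + of_int 1 * \<tau> = of_int (m' + n' * m) + of_int (n' * n) * \<tau>"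
    by (subst mn(2), subst mn(1)) (simp add: algebra_simps)
  then have "n' * n = 1" unfolding lattice_eq_iff[OF im\<tau>] by simp
  then have "n = 1 \<or> n = -1" by (auto simp: zmult_eq_1_iff)
  moreover have "Im (of_int A * \<alpha>) > 0" using A im by simp
  then have "of_int n * Im \<omega> > 0" unfolding mn(1) by (simp add: \<tau>_def)
  then have "n > 0" using \<omega>(2) by (simp add: zero_less_mult_iff)
  ultimately have "n = 1" by auto
  then have im2: "Im (2 * of_int A * \<alpha> + of_int B) = Im \<omega>"
    using arg_cong[OF mn(1), of Im] by (simp add: \<tau>_def)
  have "(2 * of_int A * \<alpha> + of_int B)\<^sup>2 = 4 * of_int A * (of_int A * \<alpha>\<^sup>2 + of_int B * \<alpha> + of_int C) + of_int (B\<^sup>2 - 4 * A * C)"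
    by (simp add: power2_eq_square algebra_simps)
  then have sq: "(2 * of_int A * \<alpha> + of_int B)\<^sup>2 = of_int (B\<^sup>2 - 4 * A * C)" unfolding root by simp
  \<comment> \<open>The square is real and the imaginary part is not 0, so the real part vanishes;
    this identifies 2 A \<alpha> + B with \<open>\<omega>\<close>.\<close>
  from arg_cong[OF sq, of Im] have "Re (2 * of_int A * \<alpha> + of_int B) = 0"
    using im2 \<omega>(2) im A by (auto simp: power2_eq_square simp del: of_int_power)
  then have eq: "2 * of_int A * \<alpha> + of_int B = \<omega>" using im2 \<omega>(1) by (simp add: complex_eq_iff)
  have "B\<^sup>2 - 4 * A * C = D" using sq unfolding eq \<omega>(3) by (simp only: of_int_eq_iff)
  then have q: "(A, B, C) \<in> forms D" unfolding forms_iff[OF D] using A prim by simp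
  have A0: "(of_int A :: complex) \<noteq> 0" using A by simp
  have \<alpha>_root: "form_root D (A, B, C) = \<alpha>"
    using eq A0 by (simp add: form_root_def \<omega>_def[symmetric] field_simps)
  have "I = (\<lambda>y. (of_int e / of_int A) * y) ` form_ideal D (A, B, C)"
    unfolding form_ideal_eq_lattice[OF D q] \<alpha>_root I_\<alpha> image_image using A0 by simp
  moreover have "of_int e / of_int A \<in> K"
    unfolding divide_inverse by (intro K_mult K_inverse K_of_int)
  ultimately have "same_ideal_class K (form_ideal D (A, B, C)) I"
    unfolding same_ideal_class_def using e0 A0 by (intro bexI[of _ "of_int e / of_int A"]) auto
  then show ?thesis using q that by blast
qed

end

section \<open>Forms of level N\<close>

text \<open>Modulo N, the coefficient C2 is b Y and (B2 - B1)/2 is b X, with X = A1 a + B1 c and Y =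
  A1 b + B1 d. Both are 0, and b A1 = (b X) d - (b Y) c with A1 prime to N.\<close>

lemma level_equivalence:
  fixes a b c d N :: int
  assumes D: "D < 0" and q1: "(A1, B1, C1) \<in> forms D" and q2: "(A2, B2, C2) \<in> forms D"
    and N: "gcd A1 N = 1" "N dvd C1" "N dvd C2" "[B1 = B2] (mod 2 * N)"
    and det: "a * d - b * c = 1"
    and rel: "form_root D (A1, B1, C1) * (of_int c * form_root D (A2, B2, C2) + of_int d) =
      of_int a * form_root D (A2, B2, C2) + of_int b"
  shows "N dvd b"
proof -
  define \<alpha>1 \<alpha>2 where "\<alpha>1 = form_root D (A1, B1, C1)" and "\<alpha>2 = form_root D (A2, B2, C2)"
  define A' where "A' = A1 * a\<^sup>2 + B1 * a * c + C1 * c\<^sup>2"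
  define B' where "B' = 2 * A1 * a * b + B1 * (a * d + b * c) + 2 * C1 * c * d"
  define C' where "C' = A1 * b\<^sup>2 + B1 * b * d + C1 * d\<^sup>2"
  define \<beta> where "\<beta> = form_root D (A', B', C')"
  have q': "(A', B', C') \<in> forms D" and rel': "\<alpha>1 * (of_int c * \<beta> + of_int d) = of_int a * \<beta> + of_int b"
    using form_substitution[OF D q1 det] by (simp_all add: A'_def B'_def C'_def \<beta>_def \<alpha>1_def)
  have "- c \<noteq> 0 \<or> a \<noteq> 0" using det by auto
  then have "of_int c * \<alpha>1 - of_int a \<noteq> 0"
    using moebius_denominator_nonzero[OF form_root_props(1)[OF D q1], of "- c" a] by (auto simp: \<alpha>1_def)
  moreover have "(of_int c * \<alpha>1 - of_int a) * \<gamma> = of_int b - \<alpha>1 * of_int d"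
    if "\<alpha>1 * (of_int c * \<gamma> + of_int d) = of_int a * \<gamma> + of_int b" for \<gamma>
  proof -
    have "(of_int c * \<alpha>1 - of_int a) * \<gamma> = \<alpha>1 * (of_int c * \<gamma> + of_int d) - of_int a * \<gamma> - \<alpha>1 * of_int d"
      by (simp add: algebra_simps)
    then show ?thesis unfolding that by simp
  qed
  \<comment> \<open>Both roots solve one linear equation with nonzero leading coefficient, so the
    transformed form is the second form.\<close>
  from this[OF rel'] this[OF rel[folded \<alpha>1_def \<alpha>2_def]]
  have "(of_int c * \<alpha>1 - of_int a) * \<beta> = (of_int c * \<alpha>1 - of_int a) * \<alpha>2" by simp
  ultimately have "\<beta> = \<alpha>2" by simp
  then have "B' = B2" "C' = C2"
    using form_root_inj[OF D q' q2] by (simp_all add: \<beta>_def \<alpha>2_def)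
  define X Y where "X = A1 * a + B1 * c" and "Y = A1 * b + B1 * d"
  have "C2 = b * Y + C1 * d\<^sup>2"
    unfolding \<open>C' = C2\<close>[symmetric] C'_def Y_def by (simp add: power2_eq_square algebra_simps)
  then have "b * Y = C2 - C1 * d\<^sup>2" by simp
  then have "N dvd b * Y" using N(2,3) by simp
  have "2 * N dvd B2 - B1" using N(4) by (simp add: cong_iff_dvd_diff dvd_diff_commute)
  moreover have "B2 - B1 = 2 * (b * X + C1 * c * d)"
  proof -
    have "B2 - B1 = 2 * (b * X + C1 * c * d) + B1 * (a * d - b * c - 1)"
      unfolding \<open>B' = B2\<close>[symmetric] B'_def X_def by (simp add: algebra_simps)
    then show ?thesis unfolding det by simp
  qed
  ultimately have "2 * N dvd 2 * (b * X + C1 * c * d)" by simp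
  then obtain k where "2 * (b * X + C1 * c * d) = 2 * N * k" by (rule dvdE)
  then have "b * X = N * k - C1 * c * d" by simp
  then have "N dvd b * X" using N(2) by simp
  have "b * A1 = (b * X) * d - (b * Y) * c"
  proof -
    have "(b * X) * d - (b * Y) * c = b * A1 * (a * d - b * c)" by (simp add: X_def Y_def algebra_simps)
    then show ?thesis unfolding det by simp
  qed
  then have "N dvd b * A1" using \<open>N dvd b * X\<close> \<open>N dvd b * Y\<close> by simp
  moreover have "coprime N A1" using N(1) by (simp add: coprime_iff_gcd_eq_1 gcd.commute)
  ultimately show "N dvd b" by (simp add: coprime_dvd_mult_left_iff)
qed

lemma form_fricke:
  fixes N :: int
  assumes D: "D < 0" and q: "(A, B, N * C) \<in> forms D" and N: "N > 0"
    and prim: "gcd C (gcd B (A * N)) = 1"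
  shows "(C, - B, A * N) \<in> forms D"
    and "form_root D (C, - B, A * N) = - of_int N / form_root D (A, B, N * C)"
proof -
  note qi = q[unfolded forms_iff[OF D]]
  define \<omega> where "\<omega> = csqrt (of_int D)"
  have disc: "B\<^sup>2 - D = 4 * A * N * C" using qi by (auto simp: mult_ac)
  have "4 * A * N * C > 0" unfolding disc[symmetric] using D zero_le_power2[of B] by linarith
  then have "(A * N) * C > 0" by (simp add: mult_ac)
  moreover have "A * N > 0" using qi N by simp
  ultimately have C: "C > 0" by (simp only: zero_less_mult_pos)
  show "(C, - B, A * N) \<in> forms D"
    unfolding forms_iff[OF D] using C prim disc by (simp add: mult_ac)
  have nz: "(of_int A :: complex) \<noteq> 0" "(of_int C :: complex) \<noteq> 0" "(of_int N :: complex) \<noteq> 0"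
    using C N qi by auto
  have "of_int B ^ 2 - \<omega>\<^sup>2 = (of_int (4 * A * N * C) :: complex)"
    unfolding \<omega>_def csqrt_neg_int(3)[OF D] disc[symmetric] by simp
  then have "(- of_int B + \<omega>) * (of_int B + \<omega>) = - (4 * of_int A * of_int N * of_int C)"
    by (simp add: power2_eq_square algebra_simps)
  moreover from this have "- of_int B + \<omega> \<noteq> 0" using nz by auto
  ultimately show "form_root D (C, - B, A * N) = - of_int N / form_root D (A, B, N * C)"
    using nz by (simp add: form_root_def \<omega>_def[symmetric] field_simps)
qed

text \<open>Conjugation by z -> -N/z turns a, b, c, d into d, -c N, -b/N, a, which is integral
  because N divides b.\<close>

lemma sl2_equiv_fricke:
  fixes a b c d N :: int
  assumes det: "a * d - b * c = 1" and N: "N > 0" "N dvd b" and im: "Im x > 0" "Im \<beta> > 0"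
    and rel: "\<beta> * (of_int c * (- of_int N / x) + of_int d) = of_int a * (- of_int N / x) + of_int b"
  shows "sl2_equiv x (- of_int N / \<beta>)"
proof -
  obtain b' where b: "b = N * b'" using N(2) by blast
  have nz: "x \<noteq> 0" "\<beta> \<noteq> 0" "(of_int N :: complex) \<noteq> 0" using im N by auto
  have "\<beta> * (of_int d * x - of_int (c * N)) = of_int N * (of_int b' * x - of_int a)"
    using rel nz by (simp add: b field_simps)
  then have "(- of_int N / \<beta>) * (of_int (- b') * x + of_int a) = of_int d * x + of_int (- c * N)"
    using nz by (simp add: field_simps)
  moreover have "d * a - (- c * N) * (- b') = 1" using det by (simp add: b algebra_simps)
  ultimately show ?thesis unfolding sl2_equiv_def by blast
qed

context quad_order_disc
begin

lemma same_ideal_class_imp_matrix: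
  assumes q1: "(A1, B1, C1) \<in> forms D" and q2: "(A2, B2, C2) \<in> forms D"
    and same: "same_ideal_class K (form_ideal D (A1, B1, C1)) (form_ideal D (A2, B2, C2))"
  shows "sl2_equiv (form_root D (A2, B2, C2)) (form_root D (A1, B1, C1))"
proof -
  have "homothetic (zlattice (form_root D (A2, B2, C2))) (zlattice (form_root D (A1, B1, C1)))"
    using same unfolding same_ideal_class_iff_homothetic[OF q1 q2] by (rule homothetic_sym)
  then show ?thesis
    using homothetic_lattices_imp_sl2_equiv[OF form_root_props(1)[OF D q2] form_root_props(1)[OF D q1]]
    unfolding homothetic_def by blast
qed

text \<open>Coprimality with N is asked of A1 alone: the second form will also be a Fricke image,
  whose leading coefficient may share a factor with N. The matrix is returned along with the values
  because the Fricke case conjugates it.\<close>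

lemma class_value_eq:
  assumes q1: "(A1, B1, C1) \<in> forms D" and q2: "(A2, B2, C2) \<in> forms D"
    and N: "gcd A1 (int (p1 * p2)) = 1" "int (p1 * p2) dvd C1" "int (p1 * p2) dvd C2"
      "[B1 = B2] (mod 2 * int (p1 * p2))"
    and p: "odd p1" "odd p2"
    and same: "same_ideal_class K (form_ideal D (A1, B1, C1)) (form_ideal D (A2, B2, C2))"
  obtains a b c d :: int where "a * d - b * c = 1" "int (p1 * p2) dvd b"
    "form_root D (A1, B1, C1) * (of_int c * form_root D (A2, B2, C2) + of_int d) =
      of_int a * form_root D (A2, B2, C2) + of_int b"
    "double_eta_quotient p1 p2 (form_root D (A1, B1, C1)) ^ eta_exponent p1 p2 =
     double_eta_quotient p1 p2 (form_root D (A2, B2, C2)) ^ eta_exponent p1 p2"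
proof -
  obtain a b c d where det: "a * d - b * c = 1" and rel: "form_root D (A1, B1, C1) * (of_int c * form_root D (A2, B2, C2) + of_int d) =
      of_int a * form_root D (A2, B2, C2) + of_int b"
    using same_ideal_class_imp_matrix[OF q1 q2 same] unfolding sl2_equiv_def by blast
  have b: "int (p1 * p2) dvd b" by (rule level_equivalence[OF D q1 q2 N det rel])
  note im = form_root_props(1)[OF D q2]
  have "c \<noteq> 0 \<or> d \<noteq> 0" using det by auto
  then have "of_int c * form_root D (A2, B2, C2) + of_int d \<noteq> 0"
    by (rule moebius_denominator_nonzero[OF im])
  then have "form_root D (A1, B1, C1) = (of_int a * form_root D (A2, B2, C2) + of_int b) / (of_int c * form_root D (A2, B2, C2) + of_int d)"
    using rel by (simp add: eq_divide_eq)
  then have "double_eta_quotient p1 p2 (form_root D (A1, B1, C1)) ^ eta_exponent p1 p2 =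
     double_eta_quotient p1 p2 (form_root D (A2, B2, C2)) ^ eta_exponent p1 p2"
    using double_eta_quotient_moebius[OF im p det b] by simp
  then show ?thesis by (rule that[OF det b rel])
qed

section \<open>Ideal classes and their representation by N-systems\<close>

definition class_rel :: "(complex set \<times> complex set) set" where
  "class_rel = {(I, J). I \<in> proper_ideals K f \<and> J \<in> proper_ideals K f \<and> same_ideal_class K I J}"

lemma equiv_class_rel: "equiv (proper_ideals K f) class_rel"
proof (rule equivI)
  show "class_rel \<subseteq> proper_ideals K f \<times> proper_ideals K f" by (auto simp: class_rel_def)
  show "refl_on (proper_ideals K f) class_rel"
    by (auto simp: refl_on_def class_rel_def same_ideal_class_refl)
  show "sym class_rel" by (auto simp: sym_def class_rel_def same_ideal_class_sym)
  show "trans class_rel" by (auto simp: trans_def class_rel_def intro: same_ideal_class_trans)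
qed

lemma class_number_eq: "class_number K f = card (proper_ideals K f // class_rel)"
  by (simp add: class_number_def class_rel_def)

lemma form_class_mem: "q \<in> forms D \<Longrightarrow> class_rel `` {form_ideal D q} \<in> proper_ideals K f // class_rel"
  by (intro quotientI form_ideal_proper)

lemma form_class_eq_iff:
  assumes "q1 \<in> forms D" "q2 \<in> forms D"
  shows "class_rel `` {form_ideal D q1} = class_rel `` {form_ideal D q2} \<longleftrightarrow>
    same_ideal_class K (form_ideal D q1) (form_ideal D q2)"
  using eq_equiv_class_iff[OF equiv_class_rel form_ideal_proper[OF assms(1)] form_ideal_proper[OF assms(2)]]
    form_ideal_proper[OF assms(1)] form_ideal_proper[OF assms(2)] by (simp add: class_rel_def)

text \<open>An N-system is defined by covering all classes with the right cardinality; for a finite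
  set this means exactly one form in each class.\<close>

lemma N_system_classes_bij:
  assumes S: "N_system K f D N S"
  shows "bij_betw (\<lambda>q. class_rel `` {form_ideal D q}) S (proper_ideals K f // class_rel)"
proof -
  define cls where "cls q = class_rel `` {form_ideal D q}" for q
  have SD: "S \<subseteq> forms D" and fin: "finite S" and card: "card S = card (proper_ideals K f // class_rel)"
    and cover: "\<And>I. I \<in> proper_ideals K f \<Longrightarrow> \<exists>q\<in>S. same_ideal_class K (form_ideal D q) I"
    using S by (auto simp: N_system_def class_number_eq)
  have "cls ` S = proper_ideals K f // class_rel"
  proof
    show "cls ` S \<subseteq> proper_ideals K f // class_rel" using SD form_class_mem by (auto simp: cls_def)
    show "proper_ideals K f // class_rel \<subseteq> cls ` S"
    proof
      fix X assume "X \<in> proper_ideals K f // class_rel"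
      then obtain I where I: "I \<in> proper_ideals K f" "X = class_rel `` {I}" by (auto elim: quotientE)
      then obtain q where q: "q \<in> S" "same_ideal_class K (form_ideal D q) I" using cover by blast
      moreover have "q \<in> forms D" using q(1) SD by blast
      ultimately have "(form_ideal D q, I) \<in> class_rel"
        using I form_ideal_proper by (simp add: class_rel_def)
      then have "cls q = X" unfolding cls_def I(2) by (rule equiv_class_eq[OF equiv_class_rel])
      then show "X \<in> cls ` S" using q by blast
    qed
  qed
  moreover from this have "inj_on cls S" using fin card by (intro eq_card_imp_inj_on) auto
  ultimately show ?thesis by (simp add: bij_betw_def cls_def[abs_def])
qed

lemma N_system_unique:
  assumes "N_system K f D N S" "q1 \<in> S" "q2 \<in> S" "same_ideal_class K (form_ideal D q1) (form_ideal D q2)"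
  shows "q1 = q2"
proof -
  have "q1 \<in> forms D" "q2 \<in> forms D" using assms by (auto simp: N_system_def)
  then have "class_rel `` {form_ideal D q1} = class_rel `` {form_ideal D q2}"
    using assms(4) form_class_eq_iff by simp
  then show ?thesis
    by (rule inj_onD[OF bij_betw_imp_inj_on[OF N_system_classes_bij[OF assms(1)]] _ assms(2,3)])
qed

lemma N_system_cover:
  assumes "N_system K f D N S" "q \<in> forms D"
  obtains q' where "q' \<in> S" "same_ideal_class K (form_ideal D q') (form_ideal D q)"
proof -
  have "\<exists>q'\<in>S. same_ideal_class K (form_ideal D q') (form_ideal D q)"
    using assms(1) form_ideal_proper[OF assms(2)] unfolding N_system_def by simp
  then show ?thesis using that by blast
qed

text \<open>Both systems have the same finite cardinality, so an injective, value-preserving map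
  between them is a bijection.\<close>

lemma N_system_prod_eq:
  fixes v :: "bqf \<Rightarrow> complex"
  assumes S: "N_system K f D N S" and S': "N_system K f D N S'"
    and h: "\<And>q. q \<in> S' \<Longrightarrow> h q \<in> S" "inj_on h S'" "\<And>q. q \<in> S' \<Longrightarrow> v (h q) = v q"
  shows "(\<Prod>q\<in>S. [:- v q, 1:]) = (\<Prod>q\<in>S'. [:- v q, 1:])"
proof -
  have "finite S" "card S = card S'" using S S' by (auto simp: N_system_def)
  then have "h ` S' = S"
    using card_image[OF h(2)] h(1) by (intro card_subset_eq) auto
  then have "(\<Prod>q\<in>S. [:- v q, 1:]) = (\<Prod>q\<in>S'. [:- v (h q), 1:])"
    using prod.reindex[OF h(2), of "\<lambda>q. [:- v q, 1:]"] by (simp add: o_def)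
  also have "\<dots> = (\<Prod>q\<in>S'. [:- v q, 1:])" using h(3) by (intro prod.cong) auto
  finally show ?thesis .
qed

end

section \<open>Class numbers and N-systems\<close>

text \<open>For each prime, one of the values at (1, 0), (0, 1), (1, 1) is prime to it, since
  otherwise all three coefficients would be divisible.\<close>

lemma form_value_coprime:
  fixes A B C :: int and p1 p2 :: nat
  assumes p: "prime p1" "prime p2" "p1 \<noteq> p2" and prim: "gcd A (gcd B C) = 1"
  obtains x y :: int where "coprime x y" "coprime (A * x\<^sup>2 + B * x * y + C * y\<^sup>2) (int (p1 * p2))"
proof -
  define v where "v x y = A * x\<^sup>2 + B * x * y + C * y\<^sup>2" for x y
  have ex: "\<exists>x y. \<not> int p dvd v x y" if "prime p" for p
  proof (rule ccontr)
    assume "\<not> ?thesis"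
    then have "int p dvd v 1 0" "int p dvd v 0 1" "int p dvd v 1 1" by auto
    then have d: "int p dvd A" "int p dvd C" "int p dvd A + B + C" by (simp_all add: v_def)
    have "B = (A + B + C) - A - C" by simp
    then have "int p dvd B" using d by (metis dvd_diff)
    then have "int p dvd gcd A (gcd B C)" using d by simp
    then show False using prim that by (simp add: prime_nat_iff)
  qed
  obtain x1 y1 where 1: "\<not> int p1 dvd v x1 y1" using ex[OF p(1)] by blast
  obtain x2 y2 where 2: "\<not> int p2 dvd v x2 y2" using ex[OF p(2)] by blast
  \<comment> \<open>As in the Chinese remainder theorem: modulo p1 the point is p2 (x1, y1), modulo
    p2 it is p1 (x2, y2). A common factor of \<open>x\<close> and \<open>y\<close> is divided out
    afterwards.\<close>
  define x y where "x = int p2 * x1 + int p1 * x2" and "y = int p2 * y1 + int p1 * y2"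
  have ndvd: "\<not> int p1 dvd int p2" "\<not> int p2 dvd int p1"
    unfolding int_dvd_int_iff using p primes_dvd_imp_eq[of p1 p2] primes_dvd_imp_eq[of p2 p1] by auto
  have prime_int: "prime (int p1)" "prime (int p2)" using p by simp_all
  have v1: "v x y = (int p2)\<^sup>2 * v x1 y1 + int p1 * (int p1 * v x2 y2 + int p2 * (2 * A * x1 * x2 + B * (x1 * y2 + x2 * y1) + 2 * C * y1 * y2))"
    by (simp add: v_def x_def y_def power2_eq_square algebra_simps)
  have v2: "v x y = (int p1)\<^sup>2 * v x2 y2 + int p2 * (int p2 * v x1 y1 + int p1 * (2 * A * x1 * x2 + B * (x1 * y2 + x2 * y1) + 2 * C * y1 * y2))"
    by (simp add: v_def x_def y_def power2_eq_square algebra_simps)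
  have n1: "\<not> int p1 dvd v x y"
  proof
    assume "int p1 dvd v x y"
    then have "int p1 dvd (int p2)\<^sup>2 * v x1 y1"
      unfolding v1 by (simp only: dvd_add_left_iff[OF dvd_triv_left])
    then show False using 1 ndvd prime_int
      by (simp add: prime_dvd_mult_iff power2_eq_square)
  qed
  have n2: "\<not> int p2 dvd v x y"
  proof
    assume "int p2 dvd v x y"
    then have "int p2 dvd (int p1)\<^sup>2 * v x2 y2"
      unfolding v2 by (simp only: dvd_add_left_iff[OF dvd_triv_left])
    then show False using 2 ndvd prime_int
      by (simp add: prime_dvd_mult_iff power2_eq_square)
  qed
  define g where "g = gcd x y"
  have "x \<noteq> 0 \<or> y \<noteq> 0"
  proof (rule ccontr)
    assume "\<not> ?thesis"
    then have "v x y = 0" by (simp add: v_def)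
    then show False using n1 by simp
  qed
  then have g: "g \<noteq> 0" by (simp add: g_def)
  obtain x' y' where xy: "x = x' * g" "y = y' * g" "coprime x' y'"
    using gcd_coprime_exists[of x y] g unfolding g_def by auto
  have "v x y = g\<^sup>2 * v x' y'" by (simp add: v_def xy(1,2) power2_eq_square algebra_simps)
  then have "\<not> int p1 dvd v x' y'" "\<not> int p2 dvd v x' y'" using n1 n2 by auto
  then have "coprime (v x' y') (int p1)" "coprime (v x' y') (int p2)"
    using prime_int by (simp_all add: prime_imp_coprime coprime_commute)
  then have "coprime (v x' y') (int (p1 * p2))" by simp
  then show ?thesis using that xy(3) by (simp add: v_def)
qed

text \<open>A common prime r of the new coefficients cannot divide A, so it divides N. Then r^2
  divides B^2 and N C, hence D.\<close>

lemma form_fricke_primitive: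
  fixes p1 p2 :: nat
  assumes D: "D < 0" and p: "prime p1" "prime p2"
    and sq: "\<not> int p1 ^ 2 dvd D" "\<not> int p2 ^ 2 dvd D"
    and q: "(A, B, int (p1 * p2) * C) \<in> forms D"
  shows "gcd C (gcd B (A * int (p1 * p2))) = 1"
proof (rule ccontr)
  note qi = q[unfolded forms_iff[OF D]]
  define g where "g = gcd C (gcd B (A * int (p1 * p2)))"
  assume "gcd C (gcd B (A * int (p1 * p2))) \<noteq> 1"
  then have "\<not> is_unit g" by (simp add: g_def)
  moreover have "g \<noteq> 0" using qi p by (auto simp: g_def)
  ultimately obtain r where r: "prime r" "r dvd g" using prime_divisor_exists by blast
  have rd: "r dvd C" "r dvd B" "r dvd A * int (p1 * p2)"
    using r(2) unfolding g_def by (meson dvd_trans gcd_dvd1 gcd_dvd2)+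
  have "\<not> r dvd A"
  proof
    assume "r dvd A"
    then have "r dvd gcd A (gcd B (int (p1 * p2) * C))" using rd by (intro gcd_greatest dvd_mult)
    then have "is_unit r" using qi by (simp only:)
    then show False using r(1) not_prime_unit by blast
  qed
  then have rN: "r dvd int p1 * int p2" using rd(3) r(1) by (simp add: prime_dvd_mult_iff)
  then have "r dvd int p1 \<or> r dvd int p2" using r(1) by (simp add: prime_dvd_mult_iff)
  then have "r = int p1 \<or> r = int p2" using r(1) p by (auto simp: primes_dvd_imp_eq)
  moreover have "r ^ 2 dvd D"
  proof -
    have "r * r dvd B * B" using rd by (intro mult_dvd_mono)
    moreover have "r * r dvd (int p1 * int p2) * C" using rN rd by (intro mult_dvd_mono)
    moreover have "D = B * B - 4 * A * ((int p1 * int p2) * C)" using qi by (simp add: power2_eq_square)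
    ultimately show ?thesis by (simp add: power2_eq_square)
  qed
  ultimately show False using sq by blast
qed

context quad_order_disc
begin

lemma form_substitution_same_class:
  fixes a b c d :: int
  assumes q: "(A, B, C) \<in> forms D" and det: "a * d - b * c = 1"
    and q': "q' = (A * a\<^sup>2 + B * a * c + C * c\<^sup>2, 2 * A * a * b + B * (a * d + b * c) + 2 * C * c * d, A * b\<^sup>2 + B * b * d + C * d\<^sup>2)"
  shows "q' \<in> forms D" "same_ideal_class K (form_ideal D q') (form_ideal D (A, B, C))"
proof -
  obtain A' B' C' where ABC: "q' = (A', B', C')" by (rule prod_cases3)
  have q2: "(A', B', C') \<in> forms D" and rel: "form_root D (A, B, C) * (of_int c * form_root D (A', B', C') + of_int d) =
      of_int a * form_root D (A', B', C') + of_int b"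
    using form_substitution[OF D q det] q' ABC by simp_all
  show "q' \<in> forms D" unfolding ABC by (rule q2)
  have "sl2_equiv (form_root D (A', B', C')) (form_root D (A, B, C))"
    unfolding sl2_equiv_def using rel det by blast
  then have "homothetic (zlattice (form_root D (A, B, C))) (zlattice (form_root D (A', B', C')))"
    by (rule sl2_equiv_imp_homothetic[OF _ form_root_props(1)[OF D q2]])
  then show "same_ideal_class K (form_ideal D q') (form_ideal D (A, B, C))"
    unfolding ABC same_ideal_class_iff_homothetic[OF q2 q] by (rule homothetic_sym)
qed

text \<open>A properly represented value prime to N becomes the leading coefficient; a translation
  then adjusts the middle one modulo 2N. That N divides C' follows from B'^2 = D modulo 4N.\<close>

lemma level_representative:
  fixes p1 p2 :: nat
  assumes p: "prime p1" "prime p2" "p1 \<noteq> p2" and B: "[B\<^sup>2 = D] (mod 4 * int (p1 * p2))"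
    and q: "q \<in> forms D"
  obtains A' B' C' where "(A', B', C') \<in> forms D" "gcd A' (int (p1 * p2)) = 1" "int (p1 * p2) dvd C'"
    "[B' = B] (mod 2 * int (p1 * p2))" "same_ideal_class K (form_ideal D (A', B', C')) (form_ideal D q)"
proof -
  define N where "N = int (p1 * p2)"
  obtain A0 B0 C0 where q0: "q = (A0, B0, C0)" by (rule prod_cases3)
  have "gcd A0 (gcd B0 C0) = 1" using q unfolding q0 forms_iff[OF D] by simp
  from form_value_coprime[OF p this] obtain a c where
    ac: "coprime a c" "coprime (A0 * a\<^sup>2 + B0 * a * c + C0 * c\<^sup>2) N" unfolding N_def .
  obtain d b' where "d * a + b' * c = 1" using bezout_int[of a c] ac(1) by (auto simp: coprime_iff_gcd_eq_1)
  then have det: "a * d - (- b') * c = 1" by (simp add: algebra_simps)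
  obtain A1 B1 C1 where q1: "(A1, B1, C1) \<in> forms D" "coprime A1 N"
    "same_ideal_class K (form_ideal D (A1, B1, C1)) (form_ideal D q)"
    using form_substitution_same_class[OF q[unfolded q0] det refl] ac(2) unfolding q0 by blast
  have "2 dvd D + B1" by (rule form_middle_parity[OF q1(1)])
  have BD: "4 * N dvd B\<^sup>2 - D" using B by (simp add: N_def cong_iff_dvd_diff)
  then have "4 dvd B\<^sup>2 - D" by (metis dvd_mult_left)
  then have "2 dvd B - D" by (rule square_mod_4)
  then have "2 dvd B - B1" using \<open>2 dvd D + B1\<close> by presburger
  then obtain m where m: "B - B1 = 2 * m" by blast
  \<comment> \<open>\<open>k0\<close> inverts \<open>A1\<close> modulo N, so translating by k0 m
    moves the middle coefficient from B1 to B modulo 2N.\<close>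
  obtain k0 where "[A1 * k0 = 1] (mod N)" using cong_solve_coprime_int[OF q1(2)] by blast
  then have "[A1 * k0 * m = 1 * m] (mod N)" by (rule cong_scalar_right)
  then obtain t where t: "A1 * k0 * m - m = N * t" by (auto simp: cong_iff_dvd_diff)
  define k where "k = k0 * m"
  define B' where "B' = 2 * A1 * k + B1"
  have B'B: "B' = B + 2 * N * t" using t m by (simp add: B'_def k_def algebra_simps)
  define C' where "C' = A1 * k\<^sup>2 + B1 * k + C1"
  have "(1::int) * 1 - k * 0 = 1" by simp
  note sub = form_substitution_same_class[OF q1(1) this refl]
  have q': "(A1, B', C') \<in> forms D" "same_ideal_class K (form_ideal D (A1, B', C')) (form_ideal D (A1, B1, C1))"
    using sub by (simp_all add: B'_def C'_def)
  have "B'\<^sup>2 - D = (B\<^sup>2 - D) + 4 * N * (t * (B + N * t))"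
    by (simp add: B'B power2_eq_square algebra_simps)
  then have "4 * N dvd B'\<^sup>2 - D" by (simp only:) (intro dvd_add BD, simp)
  moreover have "B'\<^sup>2 - D = 4 * (A1 * C')" using q'(1) unfolding forms_iff[OF D] by auto
  ultimately have "4 * N dvd 4 * (A1 * C')" by simp
  then have "N dvd A1 * C'" by simp
  then have NC: "N dvd C'" using q1(2) by (simp add: coprime_dvd_mult_right_iff coprime_commute)
  have "gcd A1 N = 1" using q1(2) by simp
  moreover have "[B' = B] (mod 2 * N)" unfolding B'B by (simp add: cong_iff_dvd_diff)
  moreover have "same_ideal_class K (form_ideal D (A1, B', C')) (form_ideal D q)"
    by (rule same_ideal_class_trans[OF q'(2) q1(3)])
  ultimately show ?thesis using that[OF q'(1)] NC by (simp add: N_def)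
qed

text \<open>Take the least leading coefficient in the class and translate to make the middle one
  small; the form with A and C exchanged then shows A <= C by minimality.\<close>

lemma reduced_representative:
  assumes q: "q \<in> forms D"
  obtains A B C where "(A, B, C) \<in> forms D" "\<bar>B\<bar> \<le> A" "A \<le> C"
    "same_ideal_class K (form_ideal D (A, B, C)) (form_ideal D q)"
proof -
  define P where "P q' \<longleftrightarrow> q' \<in> forms D \<and> same_ideal_class K (form_ideal D q') (form_ideal D q)" for q'
  have "P q" using q same_ideal_class_refl by (simp add: P_def)
  from ex_has_least_nat[of P, OF this, of "\<lambda>(A, B, C). nat A"]
  obtain q0 where "P q0" and least0: "\<And>q'. P q' \<Longrightarrow> (case q0 of (A, B, C) \<Rightarrow> nat A) \<le> (case q' of (A, B, C) \<Rightarrow> nat A)"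
    by blast
  obtain A B0 C0 where q0: "q0 = (A, B0, C0)" by (rule prod_cases3)
  have P0: "P (A, B0, C0)" using \<open>P q0\<close> by (simp add: q0)
  have A: "A > 0" if "P (A, B, C)" for A B C
    using that unfolding P_def forms_iff[OF D] by simp
  have least: "A \<le> A'" if "P (A', B', C')" for A' B' C'
    using least0[OF that] A[OF that] by (simp add: q0)
  have PS: "P (A * a\<^sup>2 + B * a * c + C * c\<^sup>2, 2 * A * a * b + B * (a * d + b * c) + 2 * C * c * d, A * b\<^sup>2 + B * b * d + C * d\<^sup>2)"
    if "P (A, B, C)" "a * d - b * c = 1" for A B C a b c d
    using form_substitution_same_class[OF _ that(2) refl] that(1) same_ideal_class_trans unfolding P_def by blast
  define k where "k = - ((B0 + A) div (2 * A))"
  define B where "B = 2 * A * k + B0"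
  define C where "C = A * k\<^sup>2 + B0 * k + C0"
  have P1: "P (A, B, C)" using PS[OF P0, of 1 1 k 0] by (simp add: B_def C_def)
  have "B = (B0 + A) - (B0 + A) div (2 * A) * (2 * A) - A" by (simp add: B_def k_def algebra_simps)
  also have "\<dots> = (B0 + A) mod (2 * A) - A" by (simp add: minus_div_mult_eq_mod)
  finally have "B = (B0 + A) mod (2 * A) - A" .
  moreover have "0 \<le> (B0 + A) mod (2 * A)" "(B0 + A) mod (2 * A) < 2 * A"
    using A[OF P0] by simp_all
  ultimately have "\<bar>B\<bar> \<le> A" by simp
  moreover have "A \<le> C" using least PS[OF P1, of 0 0 "-1" 1] by simp
  ultimately show ?thesis using that P1 unfolding P_def by blast
qed

text \<open>From 4 A^2 <= 4 A C = B^2 - D <= A^2 - D one gets A <= -D, and the cruder bounds on B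
  and C follow.\<close>

lemma finite_reduced_forms: "finite {(A, B, C). (A, B, C) \<in> forms D \<and> \<bar>B\<bar> \<le> A \<and> A \<le> C}" (is "finite ?R")
proof (rule finite_subset)
  show "?R \<subseteq> {0..- D} \<times> {D..- D} \<times> {0..D\<^sup>2 - D}"
  proof
    fix x assume "x \<in> ?R"
    then obtain A B C where x: "x = (A, B, C)" and q: "(A, B, C) \<in> forms D" and B: "\<bar>B\<bar> \<le> A" and C: "A \<le> C"
      by blast
    note qi = q[unfolded forms_iff[OF D]]
    have "B\<^sup>2 \<le> A\<^sup>2" using B qi abs_le_square_iff[of B A] by simp
    moreover have "A * A \<le> A * C" using C qi by (intro mult_left_mono) auto
    moreover have disc: "4 * (A * C) = B\<^sup>2 - D" using qi by auto
    moreover have "A \<le> A\<^sup>2" using qi by (simp add: self_le_power)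
    moreover have "0 \<le> A\<^sup>2" by simp
    moreover have "A > 0" using qi by simp
    ultimately have AD: "A \<le> - D" unfolding power2_eq_square by linarith
    then have AB: "A \<in> {0..- D}" "B \<in> {D..- D}" using qi B by auto
    have "\<bar>B\<bar> \<le> \<bar>D\<bar>" using B AD by simp
    then have "B\<^sup>2 \<le> D\<^sup>2" using abs_le_square_iff[of B D] by simp
    moreover have "C \<le> 4 * (A * C)"
      using mult_right_mono[of 1 "4 * A" C] qi C by simp
    ultimately have "C \<le> D\<^sup>2 - D" using disc by linarith
    then have "C \<in> {0..D\<^sup>2 - D}" using qi C by simp
    then show "x \<in> {0..- D} \<times> {D..- D} \<times> {0..D\<^sup>2 - D}" unfolding x using AB by blast
  qed
qed simp

text \<open>Needed for \<open>class_number\<close> to be a true count, and hence for the finite set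
  demanded of an N-system to exist.\<close>

lemma finite_classes: "finite (proper_ideals K f // class_rel)"
proof (rule finite_subset)
  let ?R = "{(A, B, C). (A, B, C) \<in> forms D \<and> \<bar>B\<bar> \<le> A \<and> A \<le> C}"
  show "proper_ideals K f // class_rel \<subseteq> (\<lambda>q. class_rel `` {form_ideal D q}) ` ?R"
  proof
    fix X assume "X \<in> proper_ideals K f // class_rel"
    then obtain I where I: "I \<in> proper_ideals K f" "X = class_rel `` {I}" by (auto elim: quotientE)
    from proper_ideal_form[OF I(1)] obtain q where q: "q \<in> forms D" "same_ideal_class K (form_ideal D q) I" .
    from reduced_representative[OF q(1)] obtain A B C where r: "(A, B, C) \<in> forms D" "\<bar>B\<bar> \<le> A" "A \<le> C"
      "same_ideal_class K (form_ideal D (A, B, C)) (form_ideal D q)" .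
    have "(form_ideal D (A, B, C), I) \<in> class_rel"
      using same_ideal_class_trans[OF r(4) q(2)] form_ideal_proper[OF r(1)] I(1) by (simp add: class_rel_def)
    then have "class_rel `` {form_ideal D (A, B, C)} = X"
      unfolding I(2) by (rule equiv_class_eq[OF equiv_class_rel])
    then show "X \<in> (\<lambda>q. class_rel `` {form_ideal D q}) ` ?R" using r by blast
  qed
qed (intro finite_imageI finite_reduced_forms)

lemma N_system_exists:
  fixes p1 p2 :: nat
  assumes p: "prime p1" "prime p2" "p1 \<noteq> p2" and B: "[B\<^sup>2 = D] (mod 4 * int (p1 * p2))"
  obtains S where "N_system K f D (p1 * p2) S" "(1, B, (B\<^sup>2 - D) div 4) \<in> S"
proof -
  define N where "N = p1 * p2"
  define Q where "Q = proper_ideals K f // class_rel"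
  define cls where "cls q = class_rel `` {form_ideal D q}" for q
  define good where "good q \<longleftrightarrow> q \<in> forms D \<and> (case q of (A', B', C') \<Rightarrow> gcd A' (int N) = 1 \<and> int N dvd C' \<and> [B' = B] (mod 2 * int N))" for q
  define q0 where "q0 = (1 :: int, B, (B\<^sup>2 - D) div 4)"
  have "4 * int N dvd B\<^sup>2 - D" using B by (simp add: N_def cong_iff_dvd_diff)
  then obtain k where "B\<^sup>2 - D = 4 * int N * k" by (rule dvdE)
  then have k: "B\<^sup>2 - D = 4 * (int N * k)" by (simp only: mult.assoc)
  have C0: "(B\<^sup>2 - D) div 4 = int N * k" unfolding k by simp
  have good0: "good q0"
    unfolding good_def q0_def forms_iff[OF D] C0 using k by simp
  \<comment> \<open>The class of [1, B, (B^2 - D)/4] must be represented by that very form, so the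
    choice is pinned there.\<close>
  have "\<exists>q. good q \<and> cls q = X \<and> (X = cls q0 \<longrightarrow> q = q0)" if X: "X \<in> Q" for X
  proof (cases "X = cls q0")
    case False
    obtain I where I: "I \<in> proper_ideals K f" "X = class_rel `` {I}" using X by (auto simp: Q_def elim: quotientE)
    from proper_ideal_form[OF I(1)] obtain q where q: "q \<in> forms D" "same_ideal_class K (form_ideal D q) I" .
    from level_representative[OF p B q(1)] obtain A' B' C' where r: "(A', B', C') \<in> forms D" "gcd A' (int N) = 1" "int N dvd C'"
      "[B' = B] (mod 2 * int N)" "same_ideal_class K (form_ideal D (A', B', C')) (form_ideal D q)" unfolding N_def .
    have "(form_ideal D (A', B', C'), I) \<in> class_rel"
      using same_ideal_class_trans[OF r(5) q(2)] form_ideal_proper[OF r(1)] I(1) by (simp add: class_rel_def)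
    then have "cls (A', B', C') = X"
      unfolding I(2) cls_def by (rule equiv_class_eq[OF equiv_class_rel])
    moreover have "good (A', B', C')" using r by (simp add: good_def)
    ultimately show ?thesis using False by blast
  qed (use good0 in blast)
  then obtain r where r: "\<And>X. X \<in> Q \<Longrightarrow> good (r X)" "\<And>X. X \<in> Q \<Longrightarrow> cls (r X) = X"
    "\<And>X. X \<in> Q \<Longrightarrow> X = cls q0 \<Longrightarrow> r X = q0" by metis
  define S where "S = r ` Q"
  have goodS: "good q" if "q \<in> S" for q using that r(1) by (auto simp: S_def)
  have "cls q0 \<in> Q" unfolding cls_def Q_def using good0 by (intro form_class_mem) (simp add: good_def)
  then have "q0 \<in> S" unfolding S_def using r(3) by force
  have finQ: "finite Q" unfolding Q_def by (rule finite_classes)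
  have "inj_on r Q" by (rule inj_on_inverseI[where g = cls]) (rule r(2))
  then have card: "card S = class_number K f"
    unfolding S_def class_number_eq Q_def[symmetric] by (rule card_image)
  have "\<exists>q\<in>S. same_ideal_class K (form_ideal D q) I" if I: "I \<in> proper_ideals K f" for I
  proof -
    define X where "X = class_rel `` {I}"
    have X: "X \<in> Q" unfolding X_def Q_def using I by (rule quotientI)
    have rf: "r X \<in> forms D" using r(1)[OF X] by (simp add: good_def)
    have "class_rel `` {form_ideal D (r X)} = class_rel `` {I}" using r(2)[OF X] by (simp add: cls_def X_def)
    then have "(form_ideal D (r X), I) \<in> class_rel"
      using eq_equiv_class_iff[OF equiv_class_rel form_ideal_proper[OF rf] I] by simp
    then have "same_ideal_class K (form_ideal D (r X)) I" by (simp add: class_rel_def)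
    then show ?thesis using X by (auto simp: S_def)
  qed
  moreover have "\<forall>(A, B, C)\<in>S. gcd A (int N) = 1 \<and> int N dvd C"
    using goodS by (fastforce simp: good_def)
  moreover have "\<forall>(A, B, C)\<in>S. \<forall>(A', B', C')\<in>S. [B = B'] (mod 2 * int N)"
  proof (intro ballI, clarify)
    fix A1 B1 C1 A2 B2 C2 assume "(A1, B1, C1) \<in> S" "(A2, B2, C2) \<in> S"
    then have "good (A1, B1, C1)" "good (A2, B2, C2)" using goodS by blast+
    then show "[B1 = B2] (mod 2 * int N)" unfolding good_def by (auto intro: cong_trans cong_sym)
  qed
  moreover have "S \<subseteq> forms D" using goodS by (auto simp: good_def)
  moreover have "finite S" unfolding S_def using finQ by simp
  ultimately have "N_system K f D N S" unfolding N_system_def using card by blast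
  then show ?thesis using that \<open>q0 \<in> S\<close> by (simp add: N_def q0_def)
qed

end

section \<open>Class polynomials\<close>

context quad_order_disc
begin

lemma N_system_class_map:
  fixes g :: "bqf \<Rightarrow> bqf"
  assumes S: "N_system K f D N S" and g: "\<And>q. q \<in> S' \<Longrightarrow> g q \<in> forms D"
  shows "\<exists>h. \<forall>q\<in>S'. h q \<in> S \<and> same_ideal_class K (form_ideal D (h q)) (form_ideal D (g q))"
proof (rule bchoice, rule ballI)
  fix q assume "q \<in> S'"
  from N_system_cover[OF S g[OF this]] obtain q' where
    "q' \<in> S" "same_ideal_class K (form_ideal D q') (form_ideal D (g q))" .
  then show "\<exists>q'. q' \<in> S \<and> same_ideal_class K (form_ideal D q') (form_ideal D (g q))" by blast
qed

lemma N_systemD: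
  assumes "N_system K f D N S" "(A, B, C) \<in> S"
  shows "(A, B, C) \<in> forms D" "gcd A (int N) = 1" "int N dvd C"
  using assms unfolding N_system_def by blast+

lemma N_system_cong:
  assumes "N_system K f D N S" "(A, B, C) \<in> S" "(A', B', C') \<in> S"
  shows "[B = B'] (mod 2 * int N)"
  using assms unfolding N_system_def by blast

definition class_value :: "nat \<Rightarrow> nat \<Rightarrow> bqf \<Rightarrow> complex" where
  "class_value p1 p2 q = double_eta_quotient p1 p2 (form_root D q) ^ eta_exponent p1 p2"

text \<open>Forms of the two systems are matched by ideal class. With B = B' this is the
  independence of the polynomial from the chosen system.\<close>

lemma class_polys_eq:
  fixes p1 p2 :: nat
  assumes p: "odd p1" "odd p2"
    and P: "P \<in> class_polys K f D p1 p2 B" and P': "P' \<in> class_polys K f D p1 p2 B'"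
    and BB': "[B = B'] (mod 2 * int (p1 * p2))"
  shows "P = P'"
proof -
  define N where "N = p1 * p2"
  define v where "v = class_value p1 p2"
  obtain S where S: "N_system K f D N S" "(1, B, (B\<^sup>2 - D) div 4) \<in> S" and P_eq: "P = (\<Prod>q\<in>S. [:- v q, 1:])"
    using P unfolding class_polys_def N_def v_def class_value_def by blast
  obtain S' where S': "N_system K f D N S'" "(1, B', (B'\<^sup>2 - D) div 4) \<in> S'" and P'_eq: "P' = (\<Prod>q\<in>S'. [:- v q, 1:])"
    using P' unfolding class_polys_def N_def v_def class_value_def by blast
  have S'D: "q \<in> forms D" if "q \<in> S'" for q using S'(1) that by (auto simp: N_system_def)
  obtain h where h: "\<And>q. q \<in> S' \<Longrightarrow> h q \<in> S"
    "\<And>q. q \<in> S' \<Longrightarrow> same_ideal_class K (form_ideal D (h q)) (form_ideal D q)"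
    using N_system_class_map[OF S(1) S'D, of S' "\<lambda>q. q"] by auto
  have "inj_on h S'"
  proof (rule inj_onI)
    fix q1 q2 assume q: "q1 \<in> S'" "q2 \<in> S'" and "h q1 = h q2"
    then have "same_ideal_class K (form_ideal D q1) (form_ideal D q2)"
      using same_ideal_class_trans[OF same_ideal_class_sym[OF h(2)[OF q(1)]]] h(2)[OF q(2)] by simp
    then show "q1 = q2" by (rule N_system_unique[OF S'(1) q])
  qed
  moreover have "v (h q) = v q" if q: "q \<in> S'" for q
  proof -
    obtain A1 B1 C1 where hq: "h q = (A1, B1, C1)" by (rule prod_cases3)
    obtain A2 B2 C2 where q2: "q = (A2, B2, C2)" by (rule prod_cases3)
    note h1 = h(1)[OF q, unfolded hq] and q' = q[unfolded q2]
    have cong: "[B1 = B2] (mod 2 * int (p1 * p2))"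
      using N_system_cong[OF S(1) h1 S(2)] N_system_cong[OF S'(1) S'(2) q'] BB' unfolding N_def
      by (meson cong_trans)
    note d1 = N_systemD[OF S(1) h1, unfolded N_def] and d2 = N_systemD[OF S'(1) q', unfolded N_def]
    have same: "same_ideal_class K (form_ideal D (A1, B1, C1)) (form_ideal D (A2, B2, C2))"
      using h(2)[OF q] unfolding hq unfolding q2 .
    have "v (A1, B1, C1) = v (A2, B2, C2)"
      unfolding v_def class_value_def
      by (rule class_value_eq[OF d1(1) d2(1) d1(2,3) d2(3) cong p same])
    then show ?thesis unfolding hq unfolding q2 .
  qed
  ultimately show ?thesis
    unfolding P_eq P'_eq by (intro N_system_prod_eq[OF S(1) S'(1), where h = h] h(1)) blast
qed

text \<open>The Fricke images of the second system have middle coefficients congruent to B modulo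
  2N. Each is matched with the form of the first system in its class, and the value is unchanged by
  both steps.\<close>

lemma class_polys_eq_minus:
  fixes p1 p2 :: nat
  assumes p: "odd p1" "odd p2" "prime p1" "prime p2"
    and sq: "\<not> int p1 ^ 2 dvd D" "\<not> int p2 ^ 2 dvd D"
    and P: "P \<in> class_polys K f D p1 p2 B" and P': "P' \<in> class_polys K f D p1 p2 B'"
    and BB': "[B = - B'] (mod 2 * int (p1 * p2))"
  shows "P = P'"
proof -
  define N where "N = p1 * p2"
  have N0: "int N > 0" using p by (simp add: N_def prime_gt_0_nat)
  define v where "v = class_value p1 p2"
  obtain S where S: "N_system K f D N S" "(1, B, (B\<^sup>2 - D) div 4) \<in> S" and P_eq: "P = (\<Prod>q\<in>S. [:- v q, 1:])"
    using P unfolding class_polys_def N_def v_def class_value_def by blast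
  obtain S' where S': "N_system K f D N S'" "(1, B', (B'\<^sup>2 - D) div 4) \<in> S'" and P'_eq: "P' = (\<Prod>q\<in>S'. [:- v q, 1:])"
    using P' unfolding class_polys_def N_def v_def class_value_def by blast
  define W :: "bqf \<Rightarrow> bqf" where "W = (\<lambda>(A, B, C). (C div int N, - B, A * int N))"
  have W: "W (A, B, C) = (C div int N, - B, A * int N)"
    "(C div int N, - B, A * int N) \<in> forms D"
    "form_root D (C div int N, - B, A * int N) = - of_int (int N) / form_root D (A, B, C)"
    if q: "(A, B, C) \<in> S'" for A B C
  proof -
    show "W (A, B, C) = (C div int N, - B, A * int N)" by (simp add: W_def)
    note d = N_systemD[OF S'(1) q]
    have C: "C = int N * (C div int N)" using d(3) by simp
    have q': "(A, B, int N * (C div int N)) \<in> forms D" using d(1) C by simp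
    have prim: "gcd (C div int N) (gcd B (A * int N)) = 1"
      using form_fricke_primitive[OF D p(3,4) sq, folded N_def, OF q'] .
    show "(C div int N, - B, A * int N) \<in> forms D" by (rule form_fricke(1)[OF D q' N0 prim])
    show "form_root D (C div int N, - B, A * int N) = - of_int (int N) / form_root D (A, B, C)"
      using form_fricke(2)[OF D q' N0 prim] C by simp
  qed
  have WD: "W q \<in> forms D" if "q \<in> S'" for q
  proof -
    obtain A2 B2 C2 where q2: "q = (A2, B2, C2)" by (rule prod_cases3)
    show ?thesis using W(1,2)[OF that[unfolded q2]] by (simp add: q2)
  qed
  obtain h where h: "\<And>q. q \<in> S' \<Longrightarrow> h q \<in> S"
    "\<And>q. q \<in> S' \<Longrightarrow> same_ideal_class K (form_ideal D (h q)) (form_ideal D (W q))"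
    using N_system_class_map[OF S(1) WD, of S' "\<lambda>q. q"] by auto
  \<comment> \<open>Besides the equality of values, the class of \<open>q\<close> is recovered from
    \<open>h q\<close> as that of -N over its root; this makes \<open>h\<close> injective.\<close>
  have match: "v (h q) = v q \<and> homothetic (zlattice (- of_int (int N) / form_root D (h q))) (zlattice (form_root D q))"
    if q: "q \<in> S'" for q
  proof -
    obtain A1 B1 C1 where hq: "h q = (A1, B1, C1)" by (rule prod_cases3)
    obtain A2 B2 C2 where q2: "q = (A2, B2, C2)" by (rule prod_cases3)
    note h1 = h(1)[OF q, unfolded hq] and q' = q[unfolded q2]
    note Wq = W[OF q']
    note d1 = N_systemD[OF S(1) h1] and d2 = N_systemD[OF S'(1) q']
    have "[- B' = - B2] (mod 2 * int N)"
      using N_system_cong[OF S'(1) S'(2) q'] by (simp add: cong_minus_minus_iff)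
    then have cong: "[B1 = - B2] (mod 2 * int N)"
      using N_system_cong[OF S(1) h1 S(2)] BB' unfolding N_def by (meson cong_trans)
    have same: "same_ideal_class K (form_ideal D (A1, B1, C1)) (form_ideal D (C2 div int N, - B2, A2 * int N))"
      using h(2)[OF q] unfolding hq unfolding q2 Wq(1) .
    have dvd: "int N dvd A2 * int N" by simp
    define x where "x = form_root D (A2, B2, C2)"
    have imx: "Im x > 0" using form_root_props(1)[OF D d2(1)] by (simp add: x_def)
    obtain a b c d :: int where m: "a * d - b * c = 1" "int N dvd b"
      "form_root D (A1, B1, C1) * (of_int c * (- of_int (int N) / x) + of_int d) = of_int a * (- of_int (int N) / x) + of_int b"
      "double_eta_quotient p1 p2 (form_root D (A1, B1, C1)) ^ eta_exponent p1 p2 =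
       double_eta_quotient p1 p2 (- of_int (int N) / x) ^ eta_exponent p1 p2"
      by (rule class_value_eq[OF d1(1) Wq(2)[unfolded N_def] d1(2,3)[unfolded N_def] dvd[unfolded N_def]
            cong[unfolded N_def] p(1,2) same[unfolded N_def], folded N_def, unfolded Wq(3), folded x_def])
    have "double_eta_quotient p1 p2 (- of_int (int N) / x) = double_eta_quotient p1 p2 x"
      using double_eta_quotient_fricke[OF imx, of p1 p2] p(3,4) by (simp add: N_def prime_gt_0_nat)
    then have "v (A1, B1, C1) = v (A2, B2, C2)"
      using m(4) unfolding v_def class_value_def x_def by simp
    moreover have "sl2_equiv x (- of_int (int N) / form_root D (A1, B1, C1))"
      by (rule sl2_equiv_fricke[OF m(1) N0 m(2) imx form_root_props(1)[OF D d1(1)] m(3)])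
    then have "homothetic (zlattice (- of_int (int N) / form_root D (A1, B1, C1))) (zlattice x)"
      by (rule sl2_equiv_imp_homothetic[OF _ imx])
    ultimately show ?thesis unfolding hq unfolding q2 x_def by blast
  qed
  have "inj_on h S'"
  proof (rule inj_onI)
    fix q1 q2 assume q: "q1 \<in> S'" "q2 \<in> S'" and eq: "h q1 = h q2"
    obtain A1 B1 C1 where q1: "q1 = (A1, B1, C1)" by (rule prod_cases3)
    obtain A2 B2 C2 where q2: "q2 = (A2, B2, C2)" by (rule prod_cases3)
    have "homothetic (zlattice (form_root D q1)) (zlattice (form_root D q2))"
      using match[OF q(1)] match[OF q(2)] unfolding eq by (meson homothetic_sym homothetic_trans)
    then have "same_ideal_class K (form_ideal D q1) (form_ideal D q2)"
      unfolding q1 q2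
      using same_ideal_class_iff_homothetic[OF N_systemD(1)[OF S'(1) q(1)[unfolded q1]] N_systemD(1)[OF S'(1) q(2)[unfolded q2]]]
      by blast
    then show "q1 = q2" by (rule N_system_unique[OF S'(1) q])
  qed
  moreover have "v (h q) = v q" if "q \<in> S'" for q using match[OF that] by blast
  ultimately show ?thesis
    unfolding P_eq P'_eq by (intro N_system_prod_eq[OF S(1) S'(1), where h = h] h(1)) blast
qed

end

section \<open>Square roots of D modulo 4N and the count\<close>

lemma prime_dvd_imp_cong_2N:
  fixes p1 p2 :: nat and x :: int
  assumes p: "prime p1" "prime p2" "p1 \<noteq> p2" "odd p1" "odd p2"
    and x: "int p1 dvd x" "int p2 dvd x" "2 dvd x"
  shows "2 * int (p1 * p2) dvd x"
proof -
  have "coprime (int p1) (int p2)" using p by (simp add: primes_coprime)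
  from divides_mult[OF x(1,2) this] have "int p1 * int p2 dvd x" .
  moreover have "coprime 2 (int p1 * int p2)" using p by simp
  ultimately have "2 * (int p1 * int p2) dvd x" by (rule divides_mult[OF x(3)])
  then show ?thesis by simp
qed

lemma Legendre_cases:
  fixes p :: nat
  assumes "Legendre D (int p) \<noteq> -1"
  obtains x where "int p dvd x\<^sup>2 - D"
proof (cases "[D = 0] (mod int p)")
  case True
  then have "int p dvd 0\<^sup>2 - D" by (simp add: cong_0_iff)
  then show ?thesis by (rule that)
next
  case False
  then have "QuadRes (int p) D" using assms by (auto simp: Legendre_def split: if_splits)
  then obtain x where "[x\<^sup>2 = D] (mod int p)" by (auto simp: QuadRes_def)
  then show ?thesis using that by (simp add: cong_iff_dvd_diff)
qed

lemma sqrt_mod_4N_exists: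
  fixes p1 p2 :: nat
  assumes p: "prime p1" "prime p2" "p1 \<noteq> p2" "odd p1" "odd p2"
    and L: "Legendre D (int p1) \<noteq> -1" "Legendre D (int p2) \<noteq> -1" and D4: "4 dvd D\<^sup>2 - D"
  obtains B where "[B\<^sup>2 = D] (mod 4 * int (p1 * p2))"
proof -
  obtain x1 where x1: "int p1 dvd x1\<^sup>2 - D" using Legendre_cases[OF L(1)] .
  obtain x2 where x2: "int p2 dvd x2\<^sup>2 - D" using Legendre_cases[OF L(2)] .
  have cop12: "coprime (int p1) (int p2)" using p by (simp add: primes_coprime)
  have cop4: "coprime (int p1 * int p2) 4"
  proof -
    have "coprime (int p1 * int p2) 2" using p by simp
    then have "coprime (int p1 * int p2) (2 ^ 2)" by (rule coprime_power_right_iff[THEN iffD2, OF disjI1])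
    then show ?thesis by simp
  qed
  obtain y where y: "[y = x1] (mod int p1)" "[y = x2] (mod int p2)"
    using binary_chinese_remainder_int[OF cop12] by blast
  \<comment> \<open>D is a square root of itself modulo 4, because 4 divides D^2 - D.\<close>
  obtain B where B: "[B = y] (mod int p1 * int p2)" "[B = D] (mod 4)"
    using binary_chinese_remainder_int[OF cop4] by blast
  have B1: "[B = x1] (mod int p1)" "[B = x2] (mod int p2)"
    by (rule cong_trans[OF cong_dvd_modulus[OF B(1)] y(1)] cong_trans[OF cong_dvd_modulus[OF B(1)] y(2)], simp)+
  have sq: "m dvd B\<^sup>2 - D" if "[B = x] (mod m)" "m dvd x\<^sup>2 - D" for m x
  proof -
    have "[B\<^sup>2 = x\<^sup>2] (mod m)" using that(1) by (rule cong_pow)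
    moreover have "[x\<^sup>2 = D] (mod m)" using that(2) by (simp add: cong_iff_dvd_diff)
    ultimately have "[B\<^sup>2 = D] (mod m)" by (rule cong_trans)
    then show ?thesis by (simp add: cong_iff_dvd_diff)
  qed
  have "int p1 * int p2 dvd B\<^sup>2 - D"
    by (rule divides_mult[OF sq[OF B1(1) x1] sq[OF B1(2) x2] cop12])
  from divides_mult[OF this sq[OF B(2) D4] cop4] have "(int p1 * int p2) * 4 dvd B\<^sup>2 - D" .
  then have "[B\<^sup>2 = D] (mod 4 * int (p1 * p2))" by (simp add: cong_iff_dvd_diff mult_ac)
  then show ?thesis by (rule that)
qed

lemma card_le_2I:
  assumes "x \<in> U" and "\<And>y z. y \<in> U \<Longrightarrow> z \<in> U \<Longrightarrow> y \<noteq> x \<Longrightarrow> z \<noteq> x \<Longrightarrow> y = z"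
  shows "card U \<in> {1, 2}"
proof (cases "U = {x}")
  case False
  then obtain y where "y \<in> U" "y \<noteq> x" using assms(1) by blast
  then have "U = {x, y}" using assms by blast
  then show ?thesis using \<open>y \<noteq> x\<close> by simp
qed simp

theorem theorem3p5:
  fixes p1 p2 f :: nat and D :: int and K :: "complex set"
  assumes "prime p1" and "prime p2" and "odd p1" and "odd p2" and "p1 \<noteq> p2"
    and "imaginary_quadratic_field K" and "f > 0"
    and "is_discriminant (quad_order K f) D" and "D < 0"
    and "Legendre D (int p1) \<noteq> -1" and "Legendre D (int p2) \<noteq> -1"
    and "\<not> p1 dvd f" and "\<not> p2 dvd f"
  shows "(Legendre D (int p1) = 1 \<and> Legendre D (int p2) = 1 \<longrightarrow>
            num_class_polys K f D p1 p2 \<in> {1, 2}) \<and>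
         (Legendre D (int p1) = 1 \<and> Legendre D (int p2) = 0 \<longrightarrow>
            num_class_polys K f D p1 p2 = 1)"
proof -
  note p = assms(1,2,5,3,4)
  obtain d where d: "d < 0" and K: "K = {of_rat x + of_rat y * csqrt (of_int d) | x y. True}"
    using assms(6) unfolding imaginary_quadratic_field_def by blast
  note order_hyps = d K assms(7,8,9)
  have D4: "4 dvd D\<^sup>2 - D" by (rule disc_mod_4[OF order_hyps])
  interpret quad_order_disc K f D
    by unfold_locales (rule assms(9) D4 field_eq[OF order_hyps] quad_order_eq[OF order_hyps])+
  have sq: "\<not> int p1 ^ 2 dvd D" "\<not> int p2 ^ 2 dvd D"
    using square_dvd_discriminant[OF order_hyps] assms by blast+
  define sols where "sols = {B. [B\<^sup>2 = D] (mod 4 * int (p1 * p2))}"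
  define U where "U = (\<Union>B\<in>sols. class_polys K f D p1 p2 B)"
  have num: "num_class_polys K f D p1 p2 = card U"
    unfolding num_class_polys_def U_def sols_def ..
  obtain B0 where B0: "B0 \<in> sols"
    using sqrt_mod_4N_exists[OF p assms(10,11) D4] by (auto simp: sols_def)
  obtain S where S: "N_system K f D (p1 * p2) S" "(1, B0, (B0\<^sup>2 - D) div 4) \<in> S"
    using N_system_exists[OF p(1,2,3)] B0 unfolding sols_def by blast
  \<comment> \<open>A reference polynomial: it shows that the count is positive, and all others are
    compared with it.\<close>
  define P0 where "P0 = (\<Prod>q\<in>S. [:- (double_eta_quotient p1 p2 (form_root D q) ^ eta_exponent p1 p2), 1:])"
  have P0: "P0 \<in> class_polys K f D p1 p2 B0" unfolding class_polys_def P0_def using S by blast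
  then have P0U: "P0 \<in> U" using B0 by (auto simp: U_def)
  have sol_dvd: "4 dvd B\<^sup>2 - D" "int p1 dvd B\<^sup>2 - D" "int p2 dvd B\<^sup>2 - D" if "B \<in> sols" for B
  proof -
    have "4 * int (p1 * p2) dvd B\<^sup>2 - D" using that by (simp add: sols_def cong_iff_dvd_diff)
    moreover have "4 dvd 4 * int (p1 * p2)" "int p1 dvd 4 * int (p1 * p2)" "int p2 dvd 4 * int (p1 * p2)" by simp_all
    ultimately show "4 dvd B\<^sup>2 - D" "int p1 dvd B\<^sup>2 - D" "int p2 dvd B\<^sup>2 - D" by (meson dvd_trans)+
  qed
  have factor: "int r dvd B - B' \<or> int r dvd B + B'"
    if "prime r" "int r dvd B\<^sup>2 - D" "int r dvd B'\<^sup>2 - D" for r B B'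
  proof -
    have "int r dvd (B\<^sup>2 - D) - (B'\<^sup>2 - D)" using that(2,3) by (rule dvd_diff)
    also have "(B\<^sup>2 - D) - (B'\<^sup>2 - D) = (B - B') * (B + B')" by (simp add: power2_eq_square algebra_simps)
    finally show ?thesis using that(1) by (simp add: prime_dvd_mult_iff)
  qed
  have even: "2 dvd B - B'" "2 dvd B + B'" if "B \<in> sols" "B' \<in> sols" for B B'
    using square_mod_4(2)[OF sol_dvd(1)[OF that(1)]] square_mod_4(2)[OF sol_dvd(1)[OF that(2)]] by presburger+
  have same: "P = P'"
    if "B \<in> sols" "B' \<in> sols" "P \<in> class_polys K f D p1 p2 B" "P' \<in> class_polys K f D p1 p2 B'"
      "(int p1 dvd B - B' \<and> int p2 dvd B - B') \<or> (int p1 dvd B + B' \<and> int p2 dvd B + B')" for B B' P P'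
    using that(5)
  proof
    assume "int p1 dvd B - B' \<and> int p2 dvd B - B'"
    then have "2 * int (p1 * p2) dvd B - B'" using even(1)[OF that(1,2)] by (intro prime_dvd_imp_cong_2N p) auto
    then have "[B = B'] (mod 2 * int (p1 * p2))" by (simp add: cong_iff_dvd_diff)
    then show ?thesis by (rule class_polys_eq[OF p(4,5) that(3,4)])
  next
    assume "int p1 dvd B + B' \<and> int p2 dvd B + B'"
    then have "2 * int (p1 * p2) dvd B + B'" using even(2)[OF that(1,2)] by (intro prime_dvd_imp_cong_2N p) auto
    then have "[B = - B'] (mod 2 * int (p1 * p2))" by (simp add: cong_iff_dvd_diff)
    then show ?thesis by (rule class_polys_eq_minus[OF p(4,5,1,2) sq that(3,4)])
  qed
  \<comment> \<open>Modulo each prime B is B0 or -B0. Equal signs at both primes give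
    \<open>P0\<close>, so any other polynomial comes from opposite signs.\<close>
  have mixed: "(int p1 dvd B - B0 \<and> int p2 dvd B + B0) \<or> (int p1 dvd B + B0 \<and> int p2 dvd B - B0)"
    if "B \<in> sols" "P \<in> class_polys K f D p1 p2 B" "P \<noteq> P0" for B P
    using same[OF that(1) B0 that(2) P0] that(3)
      factor[OF p(1) sol_dvd(2)[OF that(1)] sol_dvd(2)[OF B0]] factor[OF p(2) sol_dvd(3)[OF that(1)] sol_dvd(3)[OF B0]]
    by blast
  have "card U \<in> {1, 2}"
  proof (rule card_le_2I[OF P0U])
    fix P P' assume "P \<in> U" "P' \<in> U" and ne: "P \<noteq> P0" "P' \<noteq> P0"
    obtain B where B: "B \<in> sols" "P \<in> class_polys K f D p1 p2 B"
      using \<open>P \<in> U\<close> unfolding U_def by blast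
    obtain B' where B': "B' \<in> sols" "P' \<in> class_polys K f D p1 p2 B'"
      using \<open>P' \<in> U\<close> unfolding U_def by blast
    \<comment> \<open>Two mixed roots with the same sign pattern agree modulo both primes; with
      opposite patterns they are negatives of each other.\<close>
    have sub: "r dvd B - B'" if "(r dvd B - B0 \<and> r dvd B' - B0) \<or> (r dvd B + B0 \<and> r dvd B' + B0)" for r
      using that dvd_diff[of r "B - B0" "B' - B0"] dvd_diff[of r "B + B0" "B' + B0"] by auto
    have add: "r dvd B + B'" if "(r dvd B - B0 \<and> r dvd B' + B0) \<or> (r dvd B + B0 \<and> r dvd B' - B0)" for r
      using that dvd_add[of r "B - B0" "B' + B0"] dvd_add[of r "B + B0" "B' - B0"] by auto
    show "P = P'"
      by (rule same[OF B(1) B'(1) B(2) B'(2)])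
        (use mixed[OF B ne(1)] mixed[OF B' ne(2)] sub add in blast)
  qed
  moreover have "card U = 1" if "Legendre D (int p2) = 0"
  proof -
    have "int p2 dvd D" using that by (simp add: Legendre_def cong_0_iff split: if_splits)
    have p2B: "int p2 dvd B" if "B \<in> sols" for B
    proof -
      have "int p2 dvd (B\<^sup>2 - D) + D" using sol_dvd(3)[OF that] \<open>int p2 dvd D\<close> by (rule dvd_add)
      then have "int p2 dvd B\<^sup>2" by simp
      then show ?thesis using p(2) by (simp add: prime_dvd_power_iff)
    qed
    have "P = P0" if PU: "P \<in> U" for P
    proof -
      obtain B where B: "B \<in> sols" "P \<in> class_polys K f D p1 p2 B" 
        using PU unfolding U_def by blast
      \<comment> \<open>Modulo p2 both roots are 0, so the sign found at p1 may be used at p2 as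
        well.\<close>
      have "int p2 dvd B - B0" "int p2 dvd B + B0" using p2B[OF B(1)] p2B[OF B0] by auto
      then show ?thesis
        using same[OF B(1) B0 B(2) P0] factor[OF p(1) sol_dvd(2)[OF B(1)] sol_dvd(2)[OF B0]] by blast
    qed
    then have "U = {P0}" using P0U by blast
    then show ?thesis by simp
  qed
  ultimately show ?thesis unfolding num by blast
qed

end
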